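(* Let $Q$ be a finite quiver, let $M\in\mathrm{rep}_{\mathbb{C}}(Q)$ be straight and $\mathbf{e}\in\mathbb{Z}^{Q_0}$, and let $T_M$ act on $X=\mathrm{Gr}_{\mathbf{e}}(M)$. Take a generic attractive cocharacter $\chi\in\mathfrak{X}_*(T_M)$ and a compatible basis $B$. Then the corresponding moment graph $\mathcal{G}=\mathcal{G}(X,T_M,\chi)$ is given by the following data: (G0) the vertices are the $\mathbf{e}$-dimensional successor closed subquivers $S\subseteq Q(M,B)$; (G1) the fundamental mutations $m^{(i)}_{k,\ell}:S\to S'$ parameterize the edge set $\mathcal{G}_1$; (G2) the edge $m^{(i)}_{k,\ell}:S\to S'$ is labeled by the character $$\epsilon_r+\delta_{a'_1}+\dots+\delta_{a'_{p'}}-(\epsilon_q+\delta_{a_1}+\dots+\delta_{a_p}),$$ where $r$ is the index of the segment (connected component of $Q(M,B)$) containing $b^{(i)}_\ell$, $q$ is the index of the segment containing $b^{(i)}_k$, $a'_{p'}\circ\dots\circ a'_1$ is the path in $Q$ underlying the preceding segment of $b^{(i)}_\ell$ in $Q(M,B)$, and $a_p\circ\dots\circ a_1$ is the path in $Q$ underlying the preceding segment of $b^{(i)}_k$ in $Q(M,B)$.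
   Context: A quiver $Q$ has vertex set $Q_0$ and arrow set $Q_1$; an arrow $a$ has source $s_a$ and target $t_a$. $\mathrm{rep}_{\mathbb{C}}(Q)$ is the category of finite-dimensional complex representations. $\mathrm{Gr}_{\mathbf e}(M)$ is the closed subvariety of $\prod_{i\in Q_0}\mathrm{Gr}_{e_i}(M^{(i)})$ of all subrepresentations $U\subseteq M$ with $\dim U^{(i)}=e_i$. For an indexed basis $B=\{b^{(i)}_k:i\in Q_0,1\le k\le\dim M^{(i)}\}$ with $b^{(i)}_k\in M^{(i)}$, the coefficient quiver $Q(M,B)$ has vertex set $B$ and an arrow $b^{(i)}_k\to b^{(j)}_\ell$ for each $(a:i\to j)\in Q_1$ such that the coefficient of $b^{(j)}_\ell$ in $M_ab^{(i)}_k$ is non-zero. $M$ is straight if for some $B$ (a straightening basis) all connected components of $Q(M,B)$ are equioriented strings $\bullet\to\cdots\to\bullet$. Basis vectors are normalized so that $M_ab\in B\cup\{0\}$. Torus: $d$ is the number of components of $Q(M,B)$, $c$ the number of arrows of $\mathrm{supp}\,M$ (vertices $i$ with $M^{(i)}\ne0$, arrows $a$ with $M_a\neq0$). $T_M=(\mathbb{C}^* )^{d+c}\ni((\gamma_i)_{i\in[d]},(\nu_j)_{j\in[c]})$ scales the starting vertex of the $i$-th string by $\gamma_i$, and along each arrow of $Q(M,B)$ the scaling factor is multiplied by $\nu_j$, $j$ the label of the underlying arrow of $Q$; this induces an action on $\mathrm{Gr}_{\mathbf e}(M)$. The characters $\epsilon_q$, $\delta_a$ of $T_M$ are the projections to $\gamma_q$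 ($q\in[d]$) and $\nu_a$ ($a\in[c]$), respectively; the character group is written additively. $\mathfrak{X}_*(T_M)$ is the group of cocharacters; $\chi$ is generic if $X^{T_M}=X^{\chi(\mathbb{C}^* )}$. The pair $(\chi,B)$ is attractive and compatible if $B$ is a straightening basis with $Q(M,B)$ aligned and the grading $\mathrm{wt}:B\to\mathbb{Z}$ given by $\chi(\lambda).b=\lambda^{\mathrm{wt}(b)}b$ is attractive. Aligned: over each $(a:i\to j)\in Q_1$, (1) if $M_ab^{(i)}_\ell=0$ and $M_ab^{(i)}_k\ne0$ then $\ell>k$; (2) if $M_ab^{(i)}_\ell=b^{(j)}_{\ell'}$, $M_ab^{(i)}_k=b^{(j)}_{k'}$ and $\ell>k$ then $\ell'>k'$. Attractive: (1) $\mathrm{wt}(b^{(i)}_k)>\mathrm{wt}(b^{(i)}_\ell)$ whenever $k>\ell$; (2) for each $a\in Q_1$ there is $\mathrm{wt}(a)\in\mathbb{Z}$ with $\mathrm{wt}(b')=\mathrm{wt}(b)+\mathrm{wt}(a)$ for each arrow $b\to b'$ of $Q(M,B)$ over $a$. Moment graph $\mathcal{G}(X,T,\chi)$ of a GKM-variety (projective variety with torus action having finitely many fixed points and one-dimensional orbits, and vanishing odd rational cohomology; $(\mathrm{Gr}_{\mathbf e}(M),T_M)$ is one): vertices are the $T$-fixed points; edges are the closures $\overline E=E\cup\{x,y\}$ of one-dimensional $T$-orbits $E$, oriented from $x$ to $y$ if $\lim_{\lambda\to0}\chi(\lambda).p=x$ for $p\in E$; each edge is labeled by a character $\alpha_E$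 of $T$ describing the $T$-action on $E$ (unique up to a sign, which is fixed by choice). Here a subquiver $S\subseteq Q(M,B)$ corresponds to the fixed point spanned by $S_0\subseteq B$. A subquiver $S$ of a quiver is successor closed if for all vertices $i\in S_0$ and all arrows $a$ with $s_a=i$ also $t_a\in S_0$; such $S$ is taken full. It is $\mathbf e$-dimensional if it contains exactly $e_i$ of the vertices $b^{(i)}_k$ for every $i\in Q_0$. A mutation is a morphism $m:S\to S'$ between two $\mathbf e$-dimensional successor closed subquivers $S,S'\subseteq Q(M,B)$ such that $L=S\setminus S'$ and $L'=S'\setminus S$ are connected (and non-empty) and project to the same path in $Q$; it is determined by $S$ and the triple $(i,k,\ell)$, where $b^{(i)}_k$ is the starting vertex of $L$ and $b^{(i)}_\ell$ that of $L'$, and denoted $m^{(i)}_{k,\ell}$. It is a fundamental mutation if $k<\ell$. The preceding segment of $b\in B$ is the path in $Q(M,B)$ from the starting vertex of the string containing $b$ to $b$. *)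

theory Defs
  imports
    "HOL-Analysis.Analysis"
    "HOL-Computational_Algebra.Polynomial"
    "HOL-Library.Extended_Nat"
    "Graph_Theory.Digraph_Component"
begin

section \<open>Topological preliminaries\<close>

definition final_topology :: "'a topology \<Rightarrow> ('a \<Rightarrow> 'b) \<Rightarrow> 'b topology" where
  "final_topology Y f =
     topology (\<lambda>V. V \<subseteq> f ` topspace Y \<and> openin Y {y \<in> topspace Y. f y \<in> V})"

lemma openin_final_topology:
  "openin (final_topology Y f) V \<longleftrightarrow>
     V \<subseteq> f ` topspace Y \<and> openin Y {y \<in> topspace Y. f y \<in> V}"
proof -
  have "istopology (\<lambda>V. V \<subseteq> f ` topspace Y \<and> openin Y {y \<in> topspace Y. f y \<in> V})"
    unfolding istopology_def
  proof (intro conjI allI impI)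
    fix S T
    assume "S \<subseteq> f ` topspace Y \<and> openin Y {y \<in> topspace Y. f y \<in> S}"
      and "T \<subseteq> f ` topspace Y \<and> openin Y {y \<in> topspace Y. f y \<in> T}"
    moreover have "{y \<in> topspace Y. f y \<in> S \<inter> T} =
        {y \<in> topspace Y. f y \<in> S} \<inter> {y \<in> topspace Y. f y \<in> T}"
      by blast
    ultimately show "S \<inter> T \<subseteq> f ` topspace Y"
      and "openin Y {y \<in> topspace Y. f y \<in> S \<inter> T}"
      by (auto intro: openin_Int)
  next
    fix K
    assume K: "\<forall>V\<in>K. V \<subseteq> f ` topspace Y \<and> openin Y {y \<in> topspace Y. f y \<in> V}"
    have "{y \<in> topspace Y. f y \<in> \<Union>K} = (\<Union>V\<in>K. {y \<in> topspace Y. f y \<in> V})"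
      by blast
    with K show "\<Union>K \<subseteq> f ` topspace Y" and "openin Y {y \<in> topspace Y. f y \<in> \<Union>K}"
      by auto
  qed
  then show ?thesis
    by (simp add: final_topology_def topology_inverse')
qed

text \<open>
  The Zariski and the classical topology on a set \<open>S\<close> on which an algebra \<open>A\<close> of complex-valued
  polynomial functions is given.
\<close>

definition zariski_topology :: "'a set \<Rightarrow> ('a \<Rightarrow> complex) set \<Rightarrow> 'a topology" where
  "zariski_topology S A = topology (\<lambda>V. \<exists>P\<subseteq>A. V = {x \<in> S. \<exists>p\<in>P. p x \<noteq> 0})"

definition classical_topology :: "'a set \<Rightarrow> ('a \<Rightarrow> complex) set \<Rightarrow> 'a topology" where
  "classical_topology S A = topology_generated_by {{x \<in> S. p x \<in> W} |p W. p \<in> A \<and> open W}"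

lemma openin_zariski_topology:
  assumes mult: "\<And>p q. p \<in> A \<Longrightarrow> q \<in> A \<Longrightarrow> (\<lambda>x. p x * q x) \<in> A"
  shows "openin (zariski_topology S A) V \<longleftrightarrow> (\<exists>P\<subseteq>A. V = {x \<in> S. \<exists>p\<in>P. p x \<noteq> 0})"
proof -
  have "istopology (\<lambda>V. \<exists>P\<subseteq>A. V = {x \<in> S. \<exists>p\<in>P. p x \<noteq> 0})"
    unfolding istopology_def
  proof (intro conjI allI impI)
    fix U V
    assume "\<exists>P\<subseteq>A. U = {x \<in> S. \<exists>p\<in>P. p x \<noteq> 0}" and "\<exists>P\<subseteq>A. V = {x \<in> S. \<exists>p\<in>P. p x \<noteq> 0}"
    then obtain P P' where P: "P \<subseteq> A" "P' \<subseteq> A" "U = {x \<in> S. \<exists>p\<in>P. p x \<noteq> 0}"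
        "V = {x \<in> S. \<exists>p\<in>P'. p x \<noteq> 0}"
      by blast
    let ?P = "{(\<lambda>x. p x * q x) |p q. p \<in> P \<and> q \<in> P'}"
    have "?P \<subseteq> A"
      using P mult by blast
    moreover have "U \<inter> V = {x \<in> S. \<exists>p\<in>?P. p x \<noteq> 0}"
    proof (intro equalityI subsetI)
      fix x
      assume "x \<in> U \<inter> V"
      then obtain p q where pq: "x \<in> S" "p \<in> P" "q \<in> P'" "p x * q x \<noteq> 0"
        using P(3,4) by auto
      have r: "(\<lambda>x. p x * q x) \<in> ?P"
        using pq(2,3) by blast
      have "\<exists>p\<in>?P. p x \<noteq> 0"
        by (rule bexI[OF _ r]) (rule pq(4))
      with pq(1) show "x \<in> {x \<in> S. \<exists>p\<in>?P. p x \<noteq> 0}"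
        by (intro CollectI conjI)
    next
      fix x
      assume "x \<in> {x \<in> S. \<exists>p\<in>?P. p x \<noteq> 0}"
      then show "x \<in> U \<inter> V"
        unfolding P(3,4) by auto
    qed
    ultimately show "\<exists>P\<subseteq>A. U \<inter> V = {x \<in> S. \<exists>p\<in>P. p x \<noteq> 0}"
      by blast
  next
    fix K
    assume "\<forall>V\<in>K. \<exists>P\<subseteq>A. V = {x \<in> S. \<exists>p\<in>P. p x \<noteq> 0}"
    then have "\<exists>P. \<forall>V\<in>K. P V \<subseteq> A \<and> V = {x \<in> S. \<exists>p\<in>P V. p x \<noteq> 0}"
      by (intro bchoice) blast
    then obtain P where "\<forall>V\<in>K. P V \<subseteq> A \<and> V = {x \<in> S. \<exists>p\<in>P V. p x \<noteq> 0}" ..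
    note P = bspec[OF this]
    have "\<Union>K = {x \<in> S. \<exists>p\<in>(\<Union>V\<in>K. P V). p x \<noteq> 0}"
    proof (intro equalityI subsetI)
      fix x
      assume "x \<in> \<Union>K"
      then obtain V where V: "V \<in> K" "x \<in> V"
        by blast
      with P[OF V(1)] have "x \<in> S" "\<exists>p\<in>P V. p x \<noteq> 0"
        by auto
      with V(1) show "x \<in> {x \<in> S. \<exists>p\<in>(\<Union>V\<in>K. P V). p x \<noteq> 0}"
        by blast
    next
      fix x
      assume "x \<in> {x \<in> S. \<exists>p\<in>(\<Union>V\<in>K. P V). p x \<noteq> 0}"
      then obtain V where V: "V \<in> K" "x \<in> {x \<in> S. \<exists>p\<in>P V. p x \<noteq> 0}"
        by blast
      with P[OF V(1)] show "x \<in> \<Union>K"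
        by auto
    qed
    moreover have "(\<Union>V\<in>K. P V) \<subseteq> A"
      using P by (intro UN_least) (rule conjunct1)
    ultimately show "\<exists>P\<subseteq>A. \<Union>K = {x \<in> S. \<exists>p\<in>P. p x \<noteq> 0}"
      by blast
  qed
  then show ?thesis
    by (simp add: zariski_topology_def topology_inverse')
qed

definition irreducible_closed :: "'a topology \<Rightarrow> 'a set \<Rightarrow> bool" where
  "irreducible_closed X Z \<longleftrightarrow> closedin X Z \<and> Z \<noteq> {} \<and>
     (\<forall>A B. closedin X A \<and> closedin X B \<and> Z = A \<union> B \<longrightarrow> Z = A \<or> Z = B)"

definition krull_dim :: "'a topology \<Rightarrow> enat" where
  "krull_dim X = (SUP n \<in> {n. \<exists>Z. (\<forall>k\<le>n. irreducible_closed X (Z k)) \<and>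
                                    (\<forall>k<n. Z k \<subset> Z (Suc k))}. enat n)"


section \<open>Quiver representations\<close>

text \<open>
  A quiver is a \<^typ>\<open>('v, 'e) pre_digraph\<close> (loops and multiple arrows are allowed).  The vector spaces
  of a representation are finite-dimensional subspaces of a common, arbitrary complex vector
  space \<^typ>\<open>'b\<close>; different \<open>rep_space M i\<close> may well intersect or coincide.
\<close>

record ('v, 'e, 'b) quiver_rep =
  rep_scale :: "complex \<Rightarrow> 'b \<Rightarrow> 'b"
  rep_space :: "'v \<Rightarrow> 'b set"
  rep_map :: "'e \<Rightarrow> 'b \<Rightarrow> 'b"

definition is_representation ::
    "('v, 'e) pre_digraph \<Rightarrow> ('v, 'e, 'b::ab_group_add) quiver_rep \<Rightarrow> bool" where
  "is_representation Q M \<longleftrightarrow>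
     vector_space (rep_scale M) \<and>
     (\<forall>i\<in>verts Q. module.subspace (rep_scale M) (rep_space M i) \<and>
        (\<exists>A. finite A \<and> rep_space M i = module.span (rep_scale M) A)) \<and>
     (\<forall>a\<in>arcs Q.
        (\<forall>x\<in>rep_space M (tail Q a). rep_map M a x \<in> rep_space M (head Q a)) \<and>
        (\<forall>x\<in>rep_space M (tail Q a). \<forall>y\<in>rep_space M (tail Q a).
           rep_map M a (x + y) = rep_map M a x + rep_map M a y) \<and>
        (\<forall>c. \<forall>x\<in>rep_space M (tail Q a).
           rep_map M a (rep_scale M c x) = rep_scale M c (rep_map M a x)))"

definition rep_dim :: "('v, 'e, 'b::ab_group_add) quiver_rep \<Rightarrow> 'v \<Rightarrow> nat" where
  "rep_dim M i = vector_space.dim (rep_scale M) (rep_space M i)"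

definition supp_arcs :: "('v, 'e) pre_digraph \<Rightarrow> ('v, 'e, 'b::ab_group_add) quiver_rep \<Rightarrow> 'e set" where
  "supp_arcs Q M = {a \<in> arcs Q. \<exists>x\<in>rep_space M (tail Q a). rep_map M a x \<noteq> 0}"

subsection \<open>Quiver Grassmannians\<close>

text \<open>Points are families of subspaces, made \<^const>\<open>undefined\<close> outside \<open>verts Q\<close>.\<close>

definition prod_grassmannian ::
    "('v, 'e) pre_digraph \<Rightarrow> ('v, 'e, 'b::ab_group_add) quiver_rep \<Rightarrow> ('v \<Rightarrow> int) \<Rightarrow> ('v \<Rightarrow> 'b set) set" where
  "prod_grassmannian Q M e =
     (\<Pi>\<^sub>E i\<in>verts Q. {W. module.subspace (rep_scale M) W \<and> W \<subseteq> rep_space M i \<and>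
                        int (vector_space.dim (rep_scale M) W) = e i})"

definition quiver_grassmannian ::
    "('v, 'e) pre_digraph \<Rightarrow> ('v, 'e, 'b::ab_group_add) quiver_rep \<Rightarrow> ('v \<Rightarrow> int) \<Rightarrow> ('v \<Rightarrow> 'b set) set" where
  "quiver_grassmannian Q M e =
     {U \<in> prod_grassmannian Q M e. \<forall>a\<in>arcs Q. rep_map M a ` U (tail Q a) \<subseteq> U (head Q a)}"

text \<open>
  Both topologies on a product of Grassmannians are the quotient topologies along the map which
  sends a family of frames (an \<open>e i\<close>-tuple of linearly independent vectors in each
  \<open>rep_space M i\<close>) to the family of their spans.  This map is a principal bundle for a product of
  general linear groups, so the quotient topologies are the usual Zariski and classical topologies
  of the projective variety.  Linear independence in \<open>frames\<close> is expressed by the span having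
  dimension \<open>e i\<close>.
\<close>

definition frame_index :: "('v, 'e) pre_digraph \<Rightarrow> ('v \<Rightarrow> int) \<Rightarrow> ('v \<times> nat) set" where
  "frame_index Q e = (SIGMA i:verts Q. {1..nat (e i)})"

definition frame_point ::
    "('v, 'e) pre_digraph \<Rightarrow> ('v, 'e, 'b::ab_group_add) quiver_rep \<Rightarrow> ('v \<Rightarrow> int) \<Rightarrow>
     ('v \<times> nat \<Rightarrow> 'b) \<Rightarrow> 'v \<Rightarrow> 'b set" where
  "frame_point Q M e F =
     (\<lambda>i\<in>verts Q. module.span (rep_scale M) ((\<lambda>k. F (i, k)) ` {1..nat (e i)}))"

definition frames ::
    "('v, 'e) pre_digraph \<Rightarrow> ('v, 'e, 'b::ab_group_add) quiver_rep \<Rightarrow> ('v \<Rightarrow> int) \<Rightarrow>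
     ('v \<times> nat \<Rightarrow> 'b) set" where
  "frames Q M e =
     {F \<in> extensional (frame_index Q e). frame_point Q M e F \<in> prod_grassmannian Q M e}"

inductive_set polynomial_functions ::
    "(complex \<Rightarrow> 'b::ab_group_add \<Rightarrow> 'b) \<Rightarrow> 'i set \<Rightarrow> (('i \<Rightarrow> 'b) \<Rightarrow> complex) set"
  for sc :: "complex \<Rightarrow> 'b \<Rightarrow> 'b" and I :: "'i set" where
  const: "(\<lambda>_. c) \<in> polynomial_functions sc I"
| coord: "j \<in> I \<Longrightarrow> Vector_Spaces.linear sc (*) \<phi> \<Longrightarrow> (\<lambda>F. \<phi> (F j)) \<in> polynomial_functions sc I"
| add: "p \<in> polynomial_functions sc I \<Longrightarrow> q \<in> polynomial_functions sc I \<Longrightarrow>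
          (\<lambda>F. p F + q F) \<in> polynomial_functions sc I"
| mult: "p \<in> polynomial_functions sc I \<Longrightarrow> q \<in> polynomial_functions sc I \<Longrightarrow>
          (\<lambda>F. p F * q F) \<in> polynomial_functions sc I"

definition zariski_quiver_grassmannian ::
    "('v, 'e) pre_digraph \<Rightarrow> ('v, 'e, 'b::ab_group_add) quiver_rep \<Rightarrow> ('v \<Rightarrow> int) \<Rightarrow> ('v \<Rightarrow> 'b set) topology" where
  "zariski_quiver_grassmannian Q M e =
     subtopology
       (final_topology
         (zariski_topology (frames Q M e) (polynomial_functions (rep_scale M) (frame_index Q e)))
         (frame_point Q M e))
       (quiver_grassmannian Q M e)"

definition classical_quiver_grassmannian ::
    "('v, 'e) pre_digraph \<Rightarrow> ('v, 'e, 'b::ab_group_add) quiver_rep \<Rightarrow> ('v \<Rightarrow> int) \<Rightarrow> ('v \<Rightarrow> 'b set) topology" where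
  "classical_quiver_grassmannian Q M e =
     subtopology
       (final_topology
         (classical_topology (frames Q M e) (polynomial_functions (rep_scale M) (frame_index Q e)))
         (frame_point Q M e))
       (quiver_grassmannian Q M e)"


section \<open>Coefficient quivers\<close>

text \<open>
  The basis vector \<open>b i k\<close> (with \<open>i \<in> verts Q\<close> and \<open>1 \<le> k \<le> rep_dim M i\<close>) is represented as a vertex
  of the coefficient quiver by the pair \<open>(i, k)\<close>; an arrow \<open>((i, k), a, (j, l))\<close> lies over the
  arrow \<open>a\<close> of \<open>Q\<close>.
\<close>

type_synonym ('v, 'e) coeff_arc = "('v \<times> nat) \<times> 'e \<times> ('v \<times> nat)"
type_synonym ('v, 'e) coeff_digraph = "('v \<times> nat, ('v, 'e) coeff_arc) pre_digraph"

definition indexed_basis ::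
    "('v, 'e) pre_digraph \<Rightarrow> ('v, 'e, 'b::ab_group_add) quiver_rep \<Rightarrow> ('v \<Rightarrow> nat \<Rightarrow> 'b) \<Rightarrow> bool" where
  "indexed_basis Q M b \<longleftrightarrow>
     (\<forall>i\<in>verts Q. inj_on (b i) {1..rep_dim M i} \<and>
        \<not> module.dependent (rep_scale M) (b i ` {1..rep_dim M i}) \<and>
        module.span (rep_scale M) (b i ` {1..rep_dim M i}) = rep_space M i)"

definition basis_coeff ::
    "('v, 'e, 'b::ab_group_add) quiver_rep \<Rightarrow> ('v \<Rightarrow> nat \<Rightarrow> 'b) \<Rightarrow> 'v \<Rightarrow> 'b \<Rightarrow> nat \<Rightarrow> complex" where
  "basis_coeff M b i x k = module.representation (rep_scale M) (b i ` {1..rep_dim M i}) x (b i k)"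

definition coeff_quiver ::
    "('v, 'e) pre_digraph \<Rightarrow> ('v, 'e, 'b::ab_group_add) quiver_rep \<Rightarrow> ('v \<Rightarrow> nat \<Rightarrow> 'b) \<Rightarrow>
     ('v, 'e) coeff_digraph" where
  "coeff_quiver Q M b =
     \<lparr> verts = (SIGMA i:verts Q. {1..rep_dim M i}),
       arcs = {((i, k), a, (j, l)) |i k a j l.
                 a \<in> arcs Q \<and> i = tail Q a \<and> j = head Q a \<and>
                 k \<in> {1..rep_dim M i} \<and> l \<in> {1..rep_dim M j} \<and>
                 basis_coeff M b j (rep_map M a (b i k)) l \<noteq> 0},
       tail = fst,
       head = snd \<circ> snd \<rparr>"

definition underlying_arc :: "('v, 'e) coeff_arc \<Rightarrow> 'e" where
  "underlying_arc = fst \<circ> snd"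

definition components :: "('a, 'c) pre_digraph \<Rightarrow> ('a, 'c) pre_digraph set" where
  "components G = {H. pre_digraph.max_subgraph G Digraph_Component.connected H}"

definition component_of :: "('a, 'c) pre_digraph \<Rightarrow> 'a \<Rightarrow> ('a, 'c) pre_digraph" where
  "component_of G x = (THE H. H \<in> components G \<and> x \<in> verts H)"

definition equioriented_string :: "('a, 'c) pre_digraph \<Rightarrow> bool" where
  "equioriented_string H \<longleftrightarrow>
     (\<exists>u p v. pre_digraph.apath H u p v \<and>
        verts H = set (pre_digraph.awalk_verts H u p) \<and> arcs H = set p)"

definition straightening_basis ::
    "('v, 'e) pre_digraph \<Rightarrow> ('v, 'e, 'b::ab_group_add) quiver_rep \<Rightarrow> ('v \<Rightarrow> nat \<Rightarrow> 'b) \<Rightarrow> bool" where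
  "straightening_basis Q M b \<longleftrightarrow>
     indexed_basis Q M b \<and> (\<forall>H\<in>components (coeff_quiver Q M b). equioriented_string H)"

definition straight :: "('v, 'e) pre_digraph \<Rightarrow> ('v, 'e, 'b::ab_group_add) quiver_rep \<Rightarrow> bool" where
  "straight Q M \<longleftrightarrow> (\<exists>b. straightening_basis Q M b)"

definition normalized ::
    "('v, 'e) pre_digraph \<Rightarrow> ('v, 'e, 'b::ab_group_add) quiver_rep \<Rightarrow> ('v \<Rightarrow> nat \<Rightarrow> 'b) \<Rightarrow> bool" where
  "normalized Q M b \<longleftrightarrow>
     (\<forall>a\<in>arcs Q. \<forall>k\<in>{1..rep_dim M (tail Q a)}.
        rep_map M a (b (tail Q a) k) \<in> insert 0 (b (head Q a) ` {1..rep_dim M (head Q a)}))"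

definition preceding_segment :: "('a, 'c) pre_digraph \<Rightarrow> 'a \<Rightarrow> 'c list" where
  "preceding_segment G x =
     (THE p. \<exists>u. u \<in> verts G \<and> in_arcs G u = {} \<and> pre_digraph.apath G u p x)"

definition aligned ::
    "('v, 'e) pre_digraph \<Rightarrow> ('v, 'e, 'b::ab_group_add) quiver_rep \<Rightarrow> ('v \<Rightarrow> nat \<Rightarrow> 'b) \<Rightarrow> bool" where
  "aligned Q M b \<longleftrightarrow>
     (\<forall>a\<in>arcs Q. \<forall>k\<in>{1..rep_dim M (tail Q a)}. \<forall>l\<in>{1..rep_dim M (tail Q a)}.
        (rep_map M a (b (tail Q a) l) = 0 \<and> rep_map M a (b (tail Q a) k) \<noteq> 0 \<longrightarrow> l > k) \<and>
        (\<forall>k'\<in>{1..rep_dim M (head Q a)}. \<forall>l'\<in>{1..rep_dim M (head Q a)}.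
           rep_map M a (b (tail Q a) l) = b (head Q a) l' \<and>
           rep_map M a (b (tail Q a) k) = b (head Q a) k' \<and> l > k \<longrightarrow> l' > k'))"

definition attractive_grading ::
    "('v, 'e) pre_digraph \<Rightarrow> ('v, 'e) coeff_digraph \<Rightarrow> ('v \<times> nat \<Rightarrow> int) \<Rightarrow> bool" where
  "attractive_grading Q G wt \<longleftrightarrow>
     (\<forall>i k l. (i, k) \<in> verts G \<and> (i, l) \<in> verts G \<and> k > l \<longrightarrow> wt (i, k) > wt (i, l)) \<and>
     (\<forall>a\<in>arcs Q. \<exists>w. \<forall>x\<in>arcs G. underlying_arc x = a \<longrightarrow> wt (head G x) = wt (tail G x) + w)"

subsection \<open>Successor closed subquivers and mutations\<close>

text \<open>Successor closed subquivers are full, hence given by their sets of vertices.\<close>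

definition successor_closed :: "('a, 'c) pre_digraph \<Rightarrow> 'a set \<Rightarrow> bool" where
  "successor_closed G S \<longleftrightarrow>
     S \<subseteq> verts G \<and> (\<forall>x\<in>arcs G. tail G x \<in> S \<longrightarrow> head G x \<in> S)"

definition dimensional_subquivers ::
    "('v, 'e) pre_digraph \<Rightarrow> ('v, 'e) coeff_digraph \<Rightarrow> ('v \<Rightarrow> int) \<Rightarrow> ('v \<times> nat) set set" where
  "dimensional_subquivers Q G e =
     {S. successor_closed G S \<and> (\<forall>i\<in>verts Q. int (card {k. (i, k) \<in> S}) = e i)}"

definition subquiver_point ::
    "('v, 'e) pre_digraph \<Rightarrow> ('v, 'e, 'b::ab_group_add) quiver_rep \<Rightarrow> ('v \<Rightarrow> nat \<Rightarrow> 'b) \<Rightarrow>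
     ('v \<times> nat) set \<Rightarrow> 'v \<Rightarrow> 'b set" where
  "subquiver_point Q M b S = (\<lambda>i\<in>verts Q. module.span (rep_scale M) (b i ` {k. (i, k) \<in> S}))"

definition traced_by :: "('a, 'c) pre_digraph \<Rightarrow> 'a set \<Rightarrow> 'a \<Rightarrow> 'c list \<Rightarrow> bool" where
  "traced_by G L u p \<longleftrightarrow>
     (\<exists>v. pre_digraph.apath G u p v \<and> L = set (pre_digraph.awalk_verts G u p))"

text \<open>
  A mutation \<open>S \<rightarrow> S'\<close> is recorded as \<open>(S, (i, k, l), S')\<close>, where \<open>(i, k)\<close> and \<open>(i, l)\<close> are the starting
  vertices of \<open>L = S - S'\<close> and \<open>L' = S' - S\<close>.
\<close>

definition mutations ::
    "('v, 'e) pre_digraph \<Rightarrow> ('v, 'e) coeff_digraph \<Rightarrow> ('v \<Rightarrow> int) \<Rightarrow>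
     (('v \<times> nat) set \<times> ('v \<times> nat \<times> nat) \<times> ('v \<times> nat) set) set" where
  "mutations Q G e =
     {(S, (i, k, l), S') |S i k l S'.
        S \<in> dimensional_subquivers Q G e \<and> S' \<in> dimensional_subquivers Q G e \<and>
        Digraph_Component.connected (G \<restriction> (S - S')) \<and>
        Digraph_Component.connected (G \<restriction> (S' - S)) \<and>
        (\<exists>p p'. traced_by G (S - S') (i, k) p \<and> traced_by G (S' - S) (i, l) p' \<and>
                map underlying_arc p = map underlying_arc p')}"

definition fundamental_mutations ::
    "('v, 'e) pre_digraph \<Rightarrow> ('v, 'e) coeff_digraph \<Rightarrow> ('v \<Rightarrow> int) \<Rightarrow>
     (('v \<times> nat) set \<times> ('v \<times> nat \<times> nat) \<times> ('v \<times> nat) set) set" where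
  "fundamental_mutations Q G e = {(S, (i, k, l), S') \<in> mutations Q G e. k < l}"


section \<open>Tori, characters and cocharacters\<close>

definition torus :: "'i set \<Rightarrow> ('i \<Rightarrow> complex) set" where
  "torus I = (\<Pi>\<^sub>E j\<in>I. UNIV - {0})"

definition torus_mult :: "'i set \<Rightarrow> ('i \<Rightarrow> complex) \<Rightarrow> ('i \<Rightarrow> complex) \<Rightarrow> 'i \<Rightarrow> complex" where
  "torus_mult I s t = (\<lambda>j\<in>I. s j * t j)"

inductive_set torus_regular :: "'i set \<Rightarrow> (('i \<Rightarrow> complex) \<Rightarrow> complex) set" for I :: "'i set" where
  const: "(\<lambda>_. c) \<in> torus_regular I"
| coord: "j \<in> I \<Longrightarrow> (\<lambda>t. t j) \<in> torus_regular I"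
| inv_coord: "j \<in> I \<Longrightarrow> (\<lambda>t. inverse (t j)) \<in> torus_regular I"
| add: "f \<in> torus_regular I \<Longrightarrow> g \<in> torus_regular I \<Longrightarrow> (\<lambda>t. f t + g t) \<in> torus_regular I"
| mult: "f \<in> torus_regular I \<Longrightarrow> g \<in> torus_regular I \<Longrightarrow> (\<lambda>t. f t * g t) \<in> torus_regular I"

definition torus_characters :: "'i set \<Rightarrow> (('i \<Rightarrow> complex) \<Rightarrow> complex) set" where
  "torus_characters I =
     {\<alpha> \<in> torus I \<rightarrow>\<^sub>E UNIV - {0}.
        (\<forall>s\<in>torus I. \<forall>t\<in>torus I. \<alpha> (torus_mult I s t) = \<alpha> s * \<alpha> t) \<and>
        (\<exists>f\<in>torus_regular I. \<forall>t\<in>torus I. \<alpha> t = f t)}"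

text \<open>
  Cocharacters are only relevant on \<open>\<complex> - {0}\<close>; the regular functions there are the functions
  \<open>p(z) / z\<^sup>n\<close> with a polynomial \<open>p\<close>.
\<close>

definition torus_cocharacter :: "'i set \<Rightarrow> (complex \<Rightarrow> 'i \<Rightarrow> complex) \<Rightarrow> bool" where
  "torus_cocharacter I \<eta> \<longleftrightarrow>
     (\<forall>z. z \<noteq> 0 \<longrightarrow> \<eta> z \<in> torus I) \<and>
     (\<forall>z w. z \<noteq> 0 \<and> w \<noteq> 0 \<longrightarrow> \<eta> (z * w) = torus_mult I (\<eta> z) (\<eta> w)) \<and>
     (\<forall>j\<in>I. \<exists>p n. \<forall>z. z \<noteq> 0 \<longrightarrow> \<eta> z j = poly p z / z ^ n)"

text \<open>The group operations of the additively written character group.\<close>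

definition char_sum :: "'i set \<Rightarrow> (('i \<Rightarrow> complex) \<Rightarrow> complex) list \<Rightarrow> ('i \<Rightarrow> complex) \<Rightarrow> complex" where
  "char_sum I \<alpha>s = (\<lambda>t\<in>torus I. \<Prod>\<alpha>\<leftarrow>\<alpha>s. \<alpha> t)"

definition char_diff ::
    "'i set \<Rightarrow> (('i \<Rightarrow> complex) \<Rightarrow> complex) \<Rightarrow> (('i \<Rightarrow> complex) \<Rightarrow> complex) \<Rightarrow> ('i \<Rightarrow> complex) \<Rightarrow> complex" where
  "char_diff I \<alpha> \<beta> = (\<lambda>t\<in>torus I. \<alpha> t / \<beta> t)"

subsection \<open>The torus acting on a quiver Grassmannian\<close>

text \<open>
  The \<open>d + c\<close> coordinates of the torus are indexed by the \<open>d\<close> strings and the \<open>c\<close> arrows of the support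
  themselves instead of by numbers.
\<close>

type_synonym ('v, 'e) torus_index = "('v, 'e) coeff_digraph + 'e"

definition rep_torus_index ::
    "('v, 'e) pre_digraph \<Rightarrow> ('v, 'e, 'b::ab_group_add) quiver_rep \<Rightarrow> ('v \<Rightarrow> nat \<Rightarrow> 'b) \<Rightarrow>
     ('v, 'e) torus_index set" where
  "rep_torus_index Q M b = components (coeff_quiver Q M b) <+> supp_arcs Q M"

definition eps_char ::
    "('v, 'e) torus_index set \<Rightarrow> ('v, 'e) coeff_digraph \<Rightarrow> (('v, 'e) torus_index \<Rightarrow> complex) \<Rightarrow> complex" where
  "eps_char I q = (\<lambda>t\<in>torus I. t (Inl q))"

definition delta_char ::
    "('v, 'e) torus_index set \<Rightarrow> 'e \<Rightarrow> (('v, 'e) torus_index \<Rightarrow> complex) \<Rightarrow> complex" where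
  "delta_char I a = (\<lambda>t\<in>torus I. t (Inr a))"

definition scaling_factor ::
    "('v, 'e) coeff_digraph \<Rightarrow> (('v, 'e) torus_index \<Rightarrow> complex) \<Rightarrow> 'v \<times> nat \<Rightarrow> complex" where
  "scaling_factor G t x =
     t (Inl (component_of G x)) * (\<Prod>y\<leftarrow>preceding_segment G x. t (Inr (underlying_arc y)))"

definition vector_action ::
    "('v, 'e) pre_digraph \<Rightarrow> ('v, 'e, 'b::ab_group_add) quiver_rep \<Rightarrow> ('v \<Rightarrow> nat \<Rightarrow> 'b) \<Rightarrow>
     (('v, 'e) torus_index \<Rightarrow> complex) \<Rightarrow> 'v \<Rightarrow> 'b \<Rightarrow> 'b" where
  "vector_action Q M b t i x =
     (\<Sum>k=1..rep_dim M i.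
        rep_scale M (basis_coeff M b i x k * scaling_factor (coeff_quiver Q M b) t (i, k)) (b i k))"

definition point_action ::
    "('v, 'e) pre_digraph \<Rightarrow> ('v, 'e, 'b::ab_group_add) quiver_rep \<Rightarrow> ('v \<Rightarrow> nat \<Rightarrow> 'b) \<Rightarrow>
     (('v, 'e) torus_index \<Rightarrow> complex) \<Rightarrow> ('v \<Rightarrow> 'b set) \<Rightarrow> 'v \<Rightarrow> 'b set" where
  "point_action Q M b t U = (\<lambda>i\<in>verts Q. vector_action Q M b t i ` U i)"

definition attractive_compatible ::
    "('v, 'e) pre_digraph \<Rightarrow> ('v, 'e, 'b::ab_group_add) quiver_rep \<Rightarrow>
     (complex \<Rightarrow> ('v, 'e) torus_index \<Rightarrow> complex) \<Rightarrow> ('v \<Rightarrow> nat \<Rightarrow> 'b) \<Rightarrow> bool" where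
  "attractive_compatible Q M \<eta> b \<longleftrightarrow>
     straightening_basis Q M b \<and> normalized Q M b \<and> aligned Q M b \<and>
     (\<exists>wt. (\<forall>z. z \<noteq> 0 \<longrightarrow> (\<forall>(i, k)\<in>verts (coeff_quiver Q M b).
               vector_action Q M b (\<eta> z) i (b i k) = rep_scale M (z powi wt (i, k)) (b i k))) \<and>
           attractive_grading Q (coeff_quiver Q M b) wt)"


section \<open>Moment graphs\<close>

definition fixed_points :: "'t set \<Rightarrow> ('t \<Rightarrow> 'p \<Rightarrow> 'p) \<Rightarrow> 'p set \<Rightarrow> 'p set" where
  "fixed_points T act X = {x \<in> X. \<forall>t\<in>T. act t x = x}"

definition generic_cocharacter :: "'t set \<Rightarrow> ('t \<Rightarrow> 'p \<Rightarrow> 'p) \<Rightarrow> 'p set \<Rightarrow> (complex \<Rightarrow> 't) \<Rightarrow> bool" where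
  "generic_cocharacter T act X \<eta> \<longleftrightarrow> fixed_points T act X = fixed_points (\<eta> ` (UNIV - {0})) act X"

definition one_dim_orbits :: "'p topology \<Rightarrow> 't set \<Rightarrow> ('t \<Rightarrow> 'p \<Rightarrow> 'p) \<Rightarrow> 'p set set" where
  "one_dim_orbits Zar T act =
     {E. (\<exists>x\<in>topspace Zar. E = (\<lambda>t. act t x) ` T) \<and> krull_dim (subtopology Zar E) = 1}"

text \<open>
  A one-dimensional orbit \<open>E\<close> is isomorphic to \<open>\<complex> - {0}\<close> with the torus acting through a character
  \<open>\<alpha>\<close>.  As the kernel of \<open>\<alpha>\<close> is the stabilizer of the points of \<open>E\<close>, an equivariant bijection
  determines \<open>\<alpha>\<close> up to sign; it is an isomorphism of varieties since the characteristic is zero.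
\<close>

definition describes_action ::
    "'i set \<Rightarrow> (('i \<Rightarrow> complex) \<Rightarrow> 'p \<Rightarrow> 'p) \<Rightarrow> 'p set \<Rightarrow> (('i \<Rightarrow> complex) \<Rightarrow> complex) \<Rightarrow> bool" where
  "describes_action I act E \<alpha> \<longleftrightarrow>
     \<alpha> \<in> torus_characters I \<and>
     (\<exists>\<phi>. bij_betw \<phi> E (UNIV - {0}) \<and> (\<forall>t\<in>torus I. \<forall>x\<in>E. \<phi> (act t x) = \<alpha> t * \<phi> x))"

record ('p, 't) moment_graph = "('p, 'p set) pre_digraph" +
  label :: "'p set \<Rightarrow> 't \<Rightarrow> complex"

text \<open>
  The variety is given by its Zariski topology and its classical topology, the latter being used
  for the limits.  \<open>is_moment_graph\<close> determines \<open>\<G>\<close> up to the choice of the signs of the labels.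
\<close>

definition is_moment_graph ::
    "'p topology \<Rightarrow> 'p topology \<Rightarrow> 'i set \<Rightarrow> (('i \<Rightarrow> complex) \<Rightarrow> 'p \<Rightarrow> 'p) \<Rightarrow>
     (complex \<Rightarrow> 'i \<Rightarrow> complex) \<Rightarrow> ('p, 'i \<Rightarrow> complex) moment_graph \<Rightarrow> bool" where
  "is_moment_graph Zar Cls I act \<eta> \<G> \<longleftrightarrow>
     verts \<G> = fixed_points (torus I) act (topspace Zar) \<and>
     arcs \<G> = (\<lambda>E. Zar closure_of E) ` one_dim_orbits Zar (torus I) act \<and>
     (\<forall>E\<in>one_dim_orbits Zar (torus I) act. \<exists>x\<in>verts \<G>. \<exists>y\<in>verts \<G>.
        tail \<G> (Zar closure_of E) = x \<and> head \<G> (Zar closure_of E) = y \<and>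
        Zar closure_of E = E \<union> {x, y} \<and>
        (\<forall>p\<in>E. limitin Cls (\<lambda>z. act (\<eta> z) p) x (at 0)) \<and>
        describes_action I act E (label \<G> (Zar closure_of E)))"

end

theory Submission
  imports Defs "Jordan_Normal_Form.Determinant"
begin

text \<open>
  The torus acts on the coefficient of each basis vector by a character, and a cocharacter from an
  attractive grading separates the basis vectors over every vertex of the quiver, so the fixed points
  are the coordinate subrepresentations.  For an arbitrary point, write its subspaces in reduced
  echelon form with pivot set \<open>S\<close>; alignment makes \<open>S\<close> successor closed.  The torus scales the
  entry in row \<open>(i, k)\<close> and column \<open>(i, l)\<close> by the quotient of the characters of \<open>(i, l)\<close> and
  \<open>(i, k)\<close>.  If two non-zero entries have independent characters, then some one-parameter subgroup
  fixes one and moves the other, and the orbit has dimension at least two.  On a one-dimensional orbit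
  all non-zero entries therefore connect the same two strings in parallel positions, and being a
  subrepresentation forces them to be equal and to fill a segment: this is a fundamental mutation.
  Conversely, a mutation provides the curve of all \<open>\<langle>b\<^sub>k + c b\<^sub>l\<rangle>\<close>, whose limits for \<open>c \<rightarrow> 0\<close> and
  \<open>c \<rightarrow> \<infinity>\<close> are the two fixed points.
\<close>

section \<open>Components that are equioriented strings\<close>

text \<open>Both bounds on the dimension of an orbit come from explicit curves. A curve with
  polynomial frames satisfies a closed condition for finitely many parameters or for all, because a
  non-zero polynomial has finitely many roots. This yields irreducible sets, hence chains of length
  two in orbits that are too big, and the cofinite topology on the curve of a mutation. The closed
  sets needed are built from conditions that a subspace meets a given one non-trivially; on frames
  these are vanishing determinants. The combinatorics rests on an asymmetry: alignment copies arrows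
  from basis vectors of larger index to those of smaller index, so a string continues from the
  smaller index at least as far. This makes the pivots, taken at the smallest index, closed under
  successors, and it prevents two entries from joining the same two strings in opposite directions.
  To compare characters it suffices to give all arrows of Q the same weight, so that a vertex enters
  only through its string and its position there. Orientation and sign of the label both come from k
  < l, which gives the parameter of the curve a positive weight.\<close>

abbreviation connection :: "('a, 'c) pre_digraph \<Rightarrow> ('a \<times> 'a) set" where
  "connection H \<equiv> (symcl (arcs_ends H))\<^sup>*"

text \<open>\<open>rtrancl_on\<close> restricts walks to \<open>verts H\<close>. In a well-formed
  digraph no arc leaves this set, so the plain closure, which is easier to induct on, gives the same
  relation on vertices.\<close>

lemma connected_iff_connection:
  assumes "wf_digraph H"
  shows "Digraph_Component.connected H \<longleftrightarrow>
    verts H \<noteq> {} \<and> (\<forall>u\<in>verts H. \<forall>v\<in>verts H. (u, v) \<in> connection H)"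
proof -
  have "symcl (arcs_ends H) \<subseteq> verts H \<times> verts H"
    using assms by (auto simp: symcl_def arcs_ends_conv wf_digraph_def)
  then have "(u, v) \<in> rtrancl_on (verts H) (symcl (arcs_ends H)) \<longleftrightarrow> (u, v) \<in> connection H"
    if "u \<in> verts H" "v \<in> verts H" for u v
    using that by (auto dest: rtrancl_on_rtranclI intro!: rtrancl_consistent_rtrancl_on)
  then show ?thesis
    unfolding connected_conv by blast
qed

lemma connection_sym: "(u, v) \<in> connection H \<Longrightarrow> (v, u) \<in> connection H"
proof -
  have "sym (symcl (arcs_ends H))"
    by (auto simp: sym_def symcl_def)
  then show "(u, v) \<in> connection H \<Longrightarrow> (v, u) \<in> connection H"
    by (metis sym_rtrancl symE)
qed

lemma connection_mono: "arcs_ends H \<subseteq> arcs_ends K \<Longrightarrow> connection H \<subseteq> connection K"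
  by (rule rtrancl_mono) (auto simp: symcl_def)

context wf_digraph
begin

definition conn_class :: "'a \<Rightarrow> 'a set" where
  "conn_class x = connection G `` {x}"

lemma conn_class_refl: "x \<in> conn_class x"
  by (simp add: conn_class_def)

lemma conn_class_subset: "x \<in> verts G \<Longrightarrow> conn_class x \<subseteq> verts G"
proof
  fix y assume x: "x \<in> verts G" and "y \<in> conn_class x"
  then have "(x, y) \<in> connection G" by (simp add: conn_class_def)
  then show "y \<in> verts G"
    by (induction rule: rtrancl_induct) (use x in \<open>auto simp: symcl_def arcs_ends_conv\<close>)
qed

lemma conn_class_eq: "y \<in> conn_class x \<Longrightarrow> conn_class y = conn_class x"
  unfolding conn_class_def by (auto intro: rtrancl_trans dest: connection_sym)

lemma conn_class_arc: "a \<in> arcs G \<Longrightarrow> conn_class (head G a) = conn_class (tail G a)"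
  by (rule conn_class_eq) (auto simp: conn_class_def symcl_def arcs_ends_conv)

lemma connected_class: "x \<in> verts G \<Longrightarrow> Digraph_Component.connected (G \<restriction> conn_class x)"
proof -
  assume x: "x \<in> verts G"
  have *: "(x, y) \<in> connection (G \<restriction> conn_class x)" if "y \<in> conn_class x" for y
  proof -
    have "(x, y) \<in> connection G"
      using that by (simp add: conn_class_def)
    then show ?thesis
    proof (induction rule: rtrancl_induct)
      case (step y z)
      then have "y \<in> conn_class x" "z \<in> conn_class x"
        by (auto simp: conn_class_def)
      with step have "(y, z) \<in> symcl (arcs_ends (G \<restriction> conn_class x))"
        by (auto simp: symcl_def arcs_ends_conv image_iff)
      with step show ?case by (meson rtrancl.rtrancl_into_rtrancl)
    qed auto
  qed
  have "wf_digraph (G \<restriction> conn_class x)"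
    by (rule wellformed_induce_subgraph)
  then show ?thesis
    using conn_class_refl[of x] *
    by (subst connected_iff_connection) (auto intro: rtrancl_trans connection_sym)
qed

lemma connected_subgraph_le_class:
  assumes "subgraph H G" "Digraph_Component.connected H" "x \<in> verts H"
  shows "subgraph H (G \<restriction> conn_class x)"
proof -
  have "connection H \<subseteq> connection G"
    by (rule connection_mono) (use assms(1) in \<open>auto simp: arcs_ends_conv subgraph_def compatible_def\<close>)
  moreover have "\<forall>y\<in>verts H. (x, y) \<in> connection H"
    using assms by (subst (asm) connected_iff_connection) (auto simp: subgraph_def)
  ultimately have "verts H \<subseteq> conn_class x"
    by (auto simp: conn_class_def)
  then show ?thesis
    using assms(1) wellformed_induce_subgraph[of "conn_class x"]
    by (auto simp: subgraph_def compatible_def wf_digraph_def)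
qed

text \<open>A connected subgraph through \<open>x\<close> sits inside the full subgraph on the class
  of \<open>x\<close>, which is itself connected; so maximal connected subgraphs are full. This
  makes the \<open>THE\<close> in \<open>component_of\<close> computable.\<close>

lemma max_connected_iff:
  "max_subgraph Digraph_Component.connected H \<longleftrightarrow> (\<exists>x\<in>verts G. H = G \<restriction> conn_class x)"
proof
  assume H: "max_subgraph Digraph_Component.connected H"
  then have sub: "subgraph H G" and con: "Digraph_Component.connected H"
    by (auto simp: max_subgraph_def)
  then obtain x where x: "x \<in> verts H"
    by (auto simp: Digraph_Component.connected_def strongly_connected_def)
  then have xG: "x \<in> verts G"
    using sub by (auto simp: subgraph_def)
  have "subgraph (G \<restriction> conn_class x) G"
    by (rule subgraph_induce_subgraphI) (use conn_class_subset[OF xG] in auto)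
  with H connected_subgraph_le_class[OF sub con x] connected_class[OF xG] have "G \<restriction> conn_class x = H"
    unfolding max_subgraph_def by blast
  with xG show "\<exists>x\<in>verts G. H = G \<restriction> conn_class x" by auto
next
  assume "\<exists>x\<in>verts G. H = G \<restriction> conn_class x"
  then obtain x where x: "x \<in> verts G" and H: "H = G \<restriction> conn_class x" by blast
  have sub: "subgraph H G"
    unfolding H by (rule subgraph_induce_subgraphI) (use conn_class_subset[OF x] in auto)
  have "H' = H" if "subgraph H H'" "subgraph H' G" "Digraph_Component.connected H'" for H'
  proof -
    have "x \<in> verts H'"
      using that(1) conn_class_refl[of x] by (auto simp: subgraph_def H)
    from connected_subgraph_le_class[OF that(2,3) this] that(1) show ?thesis
      by (auto simp: H subgraph_def compatible_def intro!: pre_digraph.equality)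
  qed
  with sub connected_class[OF x] show "max_subgraph Digraph_Component.connected H"
    unfolding max_subgraph_def H by blast
qed

lemma components_eq: "components G = (\<lambda>x. G \<restriction> conn_class x) ` verts G"
  by (auto simp: components_def max_connected_iff)

lemma component_of_eq: "x \<in> verts G \<Longrightarrow> component_of G x = G \<restriction> conn_class x"
  unfolding component_of_def
proof (rule the_equality)
  fix H assume "x \<in> verts G" and "H \<in> components G \<and> x \<in> verts H"
  then show "H = G \<restriction> conn_class x"
    using conn_class_eq by (auto simp: components_eq)
qed (auto simp: components_eq conn_class_refl)

lemma component_of_in_components: "x \<in> verts G \<Longrightarrow> component_of G x \<in> components G"
  by (auto simp: components_eq component_of_eq)

lemma component_of_eq_iff:
  assumes "x \<in> verts G" "y \<in> verts G"
  shows "component_of G x = component_of G y \<longleftrightarrow> y \<in> conn_class x"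
proof -
  have "G \<restriction> conn_class x = G \<restriction> conn_class y \<longleftrightarrow> conn_class x = conn_class y"
    by (metis induce_subgraph_verts)
  then show ?thesis
    using assms conn_class_eq conn_class_refl by (auto simp: component_of_eq)
qed

lemma component_of_arc: "a \<in> arcs G \<Longrightarrow> component_of G (head G a) = component_of G (tail G a)"
  by (simp add: component_of_eq conn_class_arc)

lemma connected_awalk_verts:
  assumes "awalk u p v"
  shows "Digraph_Component.connected (G \<restriction> set (awalk_verts u p))"
proof -
  have *: "(u, z) \<in> connection (G \<restriction> S)"
    if "awalk u p v" "set (awalk_verts u p) \<subseteq> S" "z \<in> set (awalk_verts u p)" for u p S z
    using that
  proof (induction p arbitrary: u)
    case (Cons e p)
    then have e: "e \<in> arcs G" "u = tail G e" "awalk (head G e) p v" "tail G e \<in> S"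
      by (auto simp: awalk_Cons_iff)
    then have "head G e \<in> S"
      using Cons.prems(2) hd_in_awalk_verts(1)[OF e(3)] by auto
    with e have "(u, head G e) \<in> connection (G \<restriction> S)"
      by (auto simp: symcl_def arcs_ends_conv)
    moreover have "(head G e, z) \<in> connection (G \<restriction> S)" if "z \<in> set (awalk_verts (head G e) p)"
      using Cons.IH[OF e(3)] Cons.prems(2) that by auto
    ultimately show ?case
      using Cons.prems(3) e(2) by auto
  qed auto
  show ?thesis
    using *[OF assms order.refl] hd_in_awalk_verts(1)[OF assms]
    by (subst connected_iff_connection) (auto intro: rtrancl_trans connection_sym)
qed

end

section \<open>Positions and segments on equioriented strings\<close>

locale string_digraph = fin_digraph G for G :: "('a, 'c) pre_digraph" +
  assumes equioriented_components: "H \<in> components G \<Longrightarrow> equioriented_string H"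
begin

text \<open>The string is given as a walk in the component; as a component is a subgraph, it is also
  a path of \<open>G\<close>. Components are full, so every arc of \<open>G\<close> touching the
  class belongs to the component and hence to \<open>p\<close>.\<close>

lemma obtain_string:
  assumes "x \<in> verts G"
  obtains u p v where "apath u p v" "conn_class x = set (awalk_verts u p)"
    "\<And>a. a \<in> arcs G \<Longrightarrow> tail G a \<in> conn_class x \<or> head G a \<in> conn_class x \<Longrightarrow> a \<in> set p"
proof -
  let ?H = "G \<restriction> conn_class x"
  have sub: "subgraph ?H G"
    by (rule subgraph_induce_subgraphI) (use conn_class_subset[OF assms] in auto)
  have "equioriented_string ?H"
    using assms by (intro equioriented_components) (auto simp: components_eq)
  then obtain u p v where p: "pre_digraph.apath ?H u p v"
      "verts ?H = set (pre_digraph.awalk_verts ?H u p)" "arcs ?H = set p"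
    by (auto simp: equioriented_string_def)
  have "pre_digraph.awalk_verts ?H = awalk_verts"
    by (rule compatible_awalk_verts[OF compatible_induce_subgraph])
  moreover have "apath u p v"
    by (rule subgraph_apath_imp_apath[OF p(1) sub])
  moreover have "a \<in> set p"
    if "a \<in> arcs G" "tail G a \<in> conn_class x \<or> head G a \<in> conn_class x" for a
  proof -
    have "conn_class (tail G a) = conn_class x"
      using that conn_class_arc[OF that(1)] conn_class_eq by metis
    then have "tail G a \<in> conn_class x" "head G a \<in> conn_class x"
      using conn_class_arc[OF that(1)] conn_class_refl by metis+
    then show ?thesis
      using that(1) p(3) by auto
  qed
  ultimately show thesis
    using p(2) that by simp
qed

lemma distinct_ends:
  assumes "apath u p v"
  shows "distinct (map (tail G) p)" "distinct (u # map (head G) p)"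
proof -
  have d: "distinct (awalk_verts u p)" "cas u p v"
    using assms by (auto simp: apath_def awalk_def)
  show "distinct (map (tail G) p)"
    using d(1) by (auto simp: awalk_verts_conv split: if_splits)
  show "distinct (u # map (head G) p)"
    using d awalk_verts_conv'[OF d(2)] by (cases p) auto
qed

text \<open>Both arcs lie on the one path that exhausts their component, and the heads along a path
  without repetition are distinct.\<close>

lemma arc_head_unique:
  assumes "a \<in> arcs G" "a' \<in> arcs G" "head G a = head G a'"
  shows "a = a'"
proof -
  obtain u p v where p: "apath u p v" "conn_class (head G a) = set (awalk_verts u p)"
    "\<And>e. e \<in> arcs G \<Longrightarrow> tail G e \<in> conn_class (head G a) \<or> head G e \<in> conn_class (head G a) \<Longrightarrow> e \<in> set p"
    using obtain_string[OF head_in_verts[OF assms(1)]] by metis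
  have "a \<in> set p" "a' \<in> set p"
    using assms conn_class_refl[of "head G a"] by (auto intro!: p(3))
  then show ?thesis
    using distinct_ends(2)[OF p(1)] assms(3) by (auto simp: distinct_map inj_on_def)
qed

text \<open>Read backwards, the walk is forced at each step by \<open>arc_head_unique\<close>, and
  it can only stop at a vertex without incoming arcs.\<close>

lemma source_awalk_unique:
  assumes "awalk u p x" "in_arcs G u = {}" "awalk u' p' x" "in_arcs G u' = {}"
  shows "p = p'"
  using assms
proof (induction p arbitrary: x p' rule: rev_induct)
  case Nil
  then show ?case
    by (cases p' rule: rev_cases) (auto simp: awalk_simps in_arcs_def)
next
  case (snoc a p)
  from snoc.prems show ?case
  proof (cases p' rule: rev_cases)
    case Nil
    then show ?thesis
      using snoc.prems by (auto simp: awalk_simps in_arcs_def)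
  next
    case (snoc q a')
    have a: "a \<in> arcs G" "head G a = x" "awalk u p (tail G a)"
      using snoc.prems(1) by (auto simp: awalk_simps)
    have a': "a' \<in> arcs G" "head G a' = x" "awalk u' q (tail G a')"
      using snoc.prems(3) unfolding snoc by (auto simp: awalk_simps)
    have "a = a'"
      using a a' by (auto intro: arc_head_unique)
    moreover have "p = q"
      by (rule snoc.IH[OF a(3) snoc.prems(2) _ snoc.prems(4)]) (use a' calculation in simp)
    ultimately show ?thesis
      using snoc by simp
  qed
qed

text \<open>The path asked for by the \<open>THE\<close> exists as an initial piece of the string
  through \<open>x\<close>; uniqueness of walks from sources identifies it with any such walk
  \<open>p\<close>.\<close>

lemma preceding_segment_eqI:
  assumes "awalk u p x" "in_arcs G u = {}"
  shows "preceding_segment G x = p"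
proof -
  have x: "x \<in> verts G"
    using assms(1) by auto
  obtain w q v where q: "apath w q v" "conn_class x = set (awalk_verts w q)"
    "\<And>a. a \<in> arcs G \<Longrightarrow> tail G a \<in> conn_class x \<or> head G a \<in> conn_class x \<Longrightarrow> a \<in> set q"
    using obtain_string[OF x] by metis
  have "x \<in> set (awalk_verts w q)"
    using q(2) conn_class_refl[of x] by simp
  then obtain r s where "q = r @ s" "awalk w r x"
    using awalk_decomp[OF awalkI_apath[OF q(1)]] by blast
  then have r: "apath w r x"
    using q(1) by (auto simp: apath_append_iff)
  have "w \<in> conn_class x"
    using q(1,2) hd_in_awalk_verts by auto
  \<comment> \<open>An arc into \<open>w\<close> would touch the class and therefore lie on
    \<open>q\<close>, but \<open>w\<close> is not among the heads of \<open>q\<close>.\<close>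
  then have w: "in_arcs G w = {}" "w \<in> verts G"
    using distinct_ends(2)[OF q(1)] q(3) conn_class_subset[OF x] by (auto simp: in_arcs_def)
  have "p = r"
    by (rule source_awalk_unique[OF assms awalkI_apath[OF r] w(1)])
  show ?thesis
    unfolding preceding_segment_def
  proof (rule the_equality)
    show "\<exists>u. u \<in> verts G \<and> in_arcs G u = {} \<and> apath u p x"
      using r w \<open>p = r\<close> by blast
  qed (metis source_awalk_unique[OF assms] awalkI_apath)
qed

text \<open>The number of arrows preceding a vertex is its index in the vertex list of its string,
  so a component becomes an interval of natural numbers.\<close>

lemma obtain_string_position:
  assumes "x \<in> verts G"
  obtains u q v where "apath u q v" "conn_class x = set (awalk_verts u q)" "in_arcs G u = {}"
    "\<And>y. y \<in> conn_class x \<Longrightarrow> y = awalk_verts u q ! length (preceding_segment G y) \<and>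
       awalk u (preceding_segment G y) y"
proof -
  obtain w q v where q: "apath w q v" "conn_class x = set (awalk_verts w q)"
    "\<And>a. a \<in> arcs G \<Longrightarrow> tail G a \<in> conn_class x \<or> head G a \<in> conn_class x \<Longrightarrow> a \<in> set q"
    using obtain_string[OF assms] by metis
  have "w \<in> conn_class x"
    using q(1,2) hd_in_awalk_verts by auto
  have w: "in_arcs G w = {}"
    using \<open>w \<in> conn_class x\<close> distinct_ends(2)[OF q(1)] by (auto simp: in_arcs_def dest: q(3))
  have "y = awalk_verts w q ! length (preceding_segment G y) \<and> awalk w (preceding_segment G y) y"
    if "y \<in> conn_class x" for y
  proof -
    have "y \<in> set (awalk_verts w q)"
      using that q(2) by simp
    then obtain r s where rs: "q = r @ s" "awalk w r y"
      using awalk_decomp[OF awalkI_apath[OF q(1)]] by blast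
    have y: "last (awalk_verts w r) = y"
      using rs(2) by (rule awlast_of_awalk) (simp add: NOMATCH_def)
    have "awalk_verts w q = awalk_verts w r @ tl (awalk_verts y s)"
      using awalk_verts_append[OF awalkI_apath[OF q(1)[unfolded rs(1)]]] rs(1) y by simp
    moreover have "awalk_verts w r ! length r = y"
      using y by (simp add: last_conv_nth length_awalk_verts)
    ultimately have "awalk_verts w q ! length r = y"
      by (simp add: nth_append length_awalk_verts)
    with rs(2) show ?thesis
      by (simp add: preceding_segment_eqI[OF rs(2) w])
  qed
  then show thesis
    by (rule that[OF q(1,2) w])
qed

abbreviation position :: "'a \<Rightarrow> nat" where
  "position x \<equiv> length (preceding_segment G x)"

lemma preceding_segment_awalk:
  assumes "x \<in> verts G"
  obtains u where "awalk u (preceding_segment G x) x" "in_arcs G u = {}"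
  using obtain_string_position[OF assms] conn_class_refl[of x] by metis

lemma preceding_segment_arcs: "x \<in> verts G \<Longrightarrow> set (preceding_segment G x) \<subseteq> arcs G"
  by (erule preceding_segment_awalk) auto

lemma preceding_segment_head:
  assumes "a \<in> arcs G"
  shows "preceding_segment G (head G a) = preceding_segment G (tail G a) @ [a]"
proof -
  obtain u where "awalk u (preceding_segment G (tail G a)) (tail G a)" "in_arcs G u = {}"
    using preceding_segment_awalk[OF tail_in_verts[OF assms]] by metis
  with awalk_appendI[OF this(1) arc_implies_awalk[OF assms]] show ?thesis
    by (intro preceding_segment_eqI) auto
qed

text \<open>Component and position serve as coordinates on the vertices; later equalities of
  vertices are mostly obtained by comparing these two.\<close>

lemma string_position_unique:
  assumes "x \<in> verts G" "y \<in> verts G" "component_of G x = component_of G y" "position x = position y"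
  shows "x = y"
proof -
  have "y \<in> conn_class x"
    using assms by (simp add: component_of_eq_iff)
  then show ?thesis
    using obtain_string_position[OF assms(1)] conn_class_refl[of x] assms(4) by metis
qed

lemma obtain_in_arc:
  assumes "y \<in> verts G" "0 < position y"
  obtains a where "a \<in> arcs G" "head G a = y" "position (tail G a) = position y - 1"
    "component_of G (tail G a) = component_of G y"
proof -
  obtain u where u: "awalk u (preceding_segment G y) y"
    using preceding_segment_awalk[OF assms(1)] by metis
  obtain p a where "preceding_segment G y = p @ [a]"
    using assms(2) by (metis length_greater_0_conv rev_exhaust)
  with u have "a \<in> arcs G" "head G a = y"
    by (auto simp: awalk_simps)
  with that show thesis
    using preceding_segment_head[of a] component_of_arc[of a] by auto
qed

lemma obtain_awalk:
  assumes "x \<in> verts G" "y \<in> verts G" "component_of G x = component_of G y" "position x \<le> position y"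
  obtains p where "awalk x p y" "length p = position y - position x"
proof -
  have "\<exists>p. awalk x p y \<and> length p = n"
    if "n = position y - position x" for n
    using that assms
  proof (induction n arbitrary: y)
    case 0
    then have "x = y"
      by (intro string_position_unique) auto
    then show ?case
      using 0 by (intro exI[of _ "[]"]) (auto simp: awalk_Nil_iff)
  next
    case (Suc n)
    then obtain a where a: "a \<in> arcs G" "head G a = y" "position (tail G a) = position y - 1"
        "component_of G (tail G a) = component_of G y"
      using obtain_in_arc[of y] by (metis Zero_neq_Suc bot_nat_0.not_eq_extremum diff_0_eq_0)
    have "n = position (tail G a) - position x" "position x \<le> position (tail G a)"
      "component_of G x = component_of G (tail G a)"
      using Suc.prems a by auto
    then obtain p where p: "awalk x p (tail G a)" "length p = n"
      using Suc.IH[of "tail G a"] Suc.prems(2) tail_in_verts[OF a(1)] by metis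
    then show ?case
      using awalk_appendI[OF p(1) arc_implies_awalk[OF a(1)]] a(2)
      by (intro exI[of _ "p @ [a]"]) auto
  qed
  then show thesis
    using that by blast
qed

lemma obtain_out_arc:
  assumes "x \<in> verts G" "y \<in> verts G" "component_of G x = component_of G y" "position x < position y"
  obtains a where "a \<in> arcs G" "tail G a = x"
proof -
  obtain p where p: "awalk x p y" "length p = position y - position x"
    using obtain_awalk[OF assms(1-3)] assms(4) by auto
  then obtain a q where "p = a # q"
    using assms(4) by (cases p) auto
  with p(1) that show thesis
    by (auto simp: awalk_Cons_iff)
qed

text \<open>The two heads lie in the same string one position after the common tail, so they
  coincide, and arcs with the same head are equal.\<close>

lemma arc_tail_unique:
  assumes "a \<in> arcs G" "a' \<in> arcs G" "tail G a = tail G a'"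
  shows "a = a'"
proof (rule arc_head_unique[OF assms(1,2)])
  show "head G a = head G a'"
    using assms component_of_arc[of a] component_of_arc[of a']
    by (intro string_position_unique) (auto simp: preceding_segment_head)
qed

text \<open>If the string ends earlier, the segment is silently truncated. Whoever needs all
  \<open>h + 1\<close> vertices has to ensure that the last one exists.\<close>

definition string_segment :: "'a \<Rightarrow> nat \<Rightarrow> 'a set" where
  "string_segment x h = {z \<in> verts G. component_of G z = component_of G x \<and>
     position x \<le> position z \<and> position z \<le> position x + h}"

lemma preceding_segment_append: "awalk u p v \<Longrightarrow> preceding_segment G v = preceding_segment G u @ p"
  by (induction p arbitrary: v rule: rev_induct) (auto simp: awalk_simps preceding_segment_head)

lemma component_of_awalk: "awalk u p v \<Longrightarrow> component_of G v = component_of G u"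
  by (induction p arbitrary: v rule: rev_induct) (auto simp: awalk_simps component_of_arc)

text \<open>Each arrow raises the position by one, so a walk meets every position of an interval
  once. In particular every walk is a path, and \<open>apath\<close> can be replaced by
  \<open>awalk\<close>.\<close>

lemma awalk_verts_segment:
  "awalk u p v \<Longrightarrow> set (awalk_verts u p) = string_segment u (length p) \<and> distinct (awalk_verts u p)"
proof (induction p arbitrary: u)
  case Nil
  then show ?case
    by (auto simp: string_segment_def awalk_simps intro: string_position_unique)
next
  case (Cons a p)
  then have a: "a \<in> arcs G" "u = tail G a" "awalk (head G a) p v"
    by (auto simp: awalk_Cons_iff)
  have "string_segment u (length (a # p)) = insert u (string_segment (head G a) (length p))"
    using a(1,2) component_of_arc[OF a(1)] preceding_segment_head[OF a(1)] tail_in_verts[OF a(1)]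
      string_position_unique[of u]
    by (auto simp: string_segment_def not_less_eq_eq) (metis le_antisym not_less_eq_eq)
  moreover have "u \<notin> string_segment (head G a) (length p)"
    using a preceding_segment_head[OF a(1)] by (auto simp: string_segment_def)
  ultimately show ?case
    using Cons.IH[OF a(3)] a(2) by auto
qed

lemma apath_iff_awalk: "apath u p v \<longleftrightarrow> awalk u p v"
  using awalk_verts_segment by (auto simp: apath_def)

lemma successor_closed_string:
  assumes "successor_closed G S" "x \<in> S" "y \<in> verts G"
    "component_of G x = component_of G y" "position x \<le> position y"
  shows "y \<in> S"
proof -
  have "x \<in> verts G"
    using assms by (auto simp: successor_closed_def)
  then obtain p where "awalk x p y"
    using obtain_awalk assms by metis
  then show ?thesis
    using assms(1,2)
  proof (induction p arbitrary: x)
    case (Cons a p)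
    then show ?case
      by (metis awalk_Cons_iff successor_closed_def)
  qed (auto simp: awalk_Nil_iff)
qed

end

section \<open>Zariski topology and Krull dimension\<close>

lemma irreducible_closed_singleton:
  "closedin X {x} \<Longrightarrow> irreducible_closed X {x}"
  unfolding irreducible_closed_def
proof (intro conjI allI impI)
  fix A B assume "closedin X A \<and> closedin X B \<and> {x} = A \<union> B"
  then have "{x} = A \<union> B" by blast
  then show "{x} = A \<or> {x} = B"
    unfolding singleton_Un_iff by blast
qed auto

lemma irreducible_closedD:
  assumes "irreducible_closed X Z"
  shows "closedin X Z" "Z \<noteq> {}" "Z \<subseteq> topspace X"
  using assms closedin_subset unfolding irreducible_closed_def by metis+

lemma irreducible_closed_cases:
  assumes "irreducible_closed X Z" "closedin X A" "closedin X B" "Z = A \<union> B"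
  shows "Z = A \<or> Z = B"
proof -
  have "\<forall>A B. closedin X A \<and> closedin X B \<and> Z = A \<union> B \<longrightarrow> Z = A \<or> Z = B"
    using assms(1) unfolding irreducible_closed_def by (elim conjE)
  from this[rule_format, of A B] assms(2-4) show ?thesis by blast
qed

lemma krull_dim_le:
  assumes "\<And>n Z. \<forall>k\<le>n. irreducible_closed X (Z k) \<Longrightarrow> \<forall>k<n. Z k \<subset> Z (Suc k) \<Longrightarrow> n \<le> m"
  shows "krull_dim X \<le> enat m"
  unfolding krull_dim_def
proof (rule SUP_least)
  fix n assume "n \<in> {n. \<exists>Z. (\<forall>k\<le>n. irreducible_closed X (Z k)) \<and> (\<forall>k<n. Z k \<subset> Z (Suc k))}"
  then obtain Z where "(\<forall>k\<le>n. irreducible_closed X (Z k)) \<and> (\<forall>k<n. Z k \<subset> Z (Suc k))"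
    unfolding mem_Collect_eq by (rule exE)
  then have "n \<le> m"
    by (intro assms[of n Z]) (rule conjunct1 conjunct2, assumption)+
  then show "enat n \<le> enat m" by simp
qed

lemma krull_dim_ge:
  assumes "\<forall>k\<le>n. irreducible_closed X (Z k)" "\<forall>k<n. Z k \<subset> Z (Suc k)"
  shows "enat n \<le> krull_dim X"
  unfolding krull_dim_def by (rule SUP_upper, rule CollectI, rule exI[of _ Z]) (rule conjI; fact)

text \<open>This is the situation of a punctured line: splitting a point off a finite closed set
  shows that the irreducible proper closed sets are the points, so no chain is longer than point and
  whole space.\<close>

lemma krull_dim_cofinite:
  assumes inf: "infinite (topspace X)"
    and T1: "\<And>x. x \<in> topspace X \<Longrightarrow> closedin X {x}"
    and cofin: "\<And>A. closedin X A \<Longrightarrow> finite A \<or> A = topspace X"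
  shows "krull_dim X = 1"
proof -
  have irr: "irreducible_closed X (topspace X)"
    unfolding irreducible_closed_def
  proof (intro conjI allI impI)
    fix A B assume AB: "closedin X A \<and> closedin X B \<and> topspace X = A \<union> B"
    then have "infinite (A \<union> B)"
      using inf by metis
    then have "infinite A \<or> infinite B"
      by simp
    moreover have "finite A \<or> A = topspace X" "finite B \<or> B = topspace X"
      using cofin[OF AB[THEN conjunct1]] cofin[OF AB[THEN conjunct2, THEN conjunct1]] by simp_all
    ultimately show "topspace X = A \<or> topspace X = B"
      by metis
  qed (use inf in auto)
  have small: "\<exists>x. Z = {x}" if Z: "irreducible_closed X Z" "Z \<noteq> topspace X" for Z
  proof -
    note Z' = irreducible_closedD[OF Z(1)]
    have "finite Z"
      using cofin[OF Z'(1)] Z(2) by metis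
    obtain x where x: "x \<in> Z" using Z'(2) by blast
    have "closedin X (\<Union>y\<in>Z - {x}. {y})"
      using \<open>finite Z\<close> Z'(3) by (intro closedin_Union) (auto intro: T1)
    then have "closedin X (Z - {x})" by simp
    moreover have "closedin X {x}" "Z = {x} \<union> (Z - {x})"
      using x Z'(3) by (auto intro: T1)
    ultimately have "Z = {x} \<or> Z = Z - {x}"
      by (intro irreducible_closed_cases[OF Z(1)])
    moreover have "x \<notin> Z - {x}" by simp
    ultimately have "Z = {x}"
      using x by metis
    then show ?thesis ..
  qed
  have "krull_dim X \<le> enat 1"
  proof (rule krull_dim_le, rule ccontr)
    fix n Z assume Z: "\<forall>k\<le>n. irreducible_closed X (Z k)" "\<forall>k<n. Z k \<subset> Z (Suc k)" and n: "\<not> n \<le> 1"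
    have sub: "Z 0 \<subset> Z (Suc 0)" "Z (Suc 0) \<subset> Z (Suc (Suc 0))"
      using Z(2)[rule_format, of 0] Z(2)[rule_format, of "Suc 0"] n by simp_all
    have irr: "irreducible_closed X (Z 0)" "irreducible_closed X (Z (Suc 0))"
        "irreducible_closed X (Z (Suc (Suc 0)))"
      using Z(1)[rule_format, of 0] Z(1)[rule_format, of "Suc 0"] Z(1)[rule_format, of "Suc (Suc 0)"] n
      by linarith+
    have "Z (Suc 0) \<noteq> topspace X"
      using psubset_subset_trans[OF sub(2) irreducible_closedD(3)[OF irr(3)]] by (rule less_imp_neq)
    then obtain x where "Z (Suc 0) = {x}"
      using small[OF irr(2)] by metis
    with sub(1) have "Z 0 = {}"
      by (metis psubset_eq subset_singleton_iff)
    with irreducible_closedD(2)[OF irr(1)] show False ..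
  qed
  moreover have "enat 1 \<le> krull_dim X"
  proof -
    obtain x where x: "x \<in> topspace X"
      using inf by fastforce
    have "\<not> topspace X \<subseteq> {x}"
      using inf by (meson finite.emptyI finite_insert finite_subset)
    with x have "{x} \<subset> topspace X" by blast
    with irr irreducible_closed_singleton[OF T1[OF x]] show ?thesis
      by (intro krull_dim_ge[of 1 X "\<lambda>k. if k = 0 then {x} else topspace X"]) simp_all
  qed
  ultimately show ?thesis
    by (simp add: one_enat_def)
qed

lemma krull_dim_singleton:
  assumes "topspace X = {x}"
  shows "krull_dim X \<noteq> 1"
proof -
  have "krull_dim X \<le> enat 0"
  proof (rule krull_dim_le, rule ccontr)
    fix n Z assume Z: "\<forall>k\<le>n. irreducible_closed X (Z k)" "\<forall>k<n. Z k \<subset> Z (Suc k)" and n: "\<not> n \<le> 0"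
    have "Z 0 \<subset> Z (Suc 0)"
      using Z(2)[rule_format, of 0] n by simp
    moreover have irr: "irreducible_closed X (Z 0)" "irreducible_closed X (Z (Suc 0))"
      using Z(1)[rule_format, of 0] Z(1)[rule_format, of "Suc 0"] n by linarith+
    moreover note irreducible_closedD(2)[OF irr(1)] irreducible_closedD(3)[OF irr(2)]
    ultimately show False
      unfolding assms by blast
  qed
  then show ?thesis
    by (auto simp: one_enat_def)
qed

lemma krull_dim_chain:
  assumes "irreducible_closed X A" "irreducible_closed X B" "irreducible_closed X C" "A \<subset> B" "B \<subset> C"
  shows "krull_dim X \<noteq> 1"
proof -
  have "enat 2 \<le> krull_dim X"
    using assms
    by (intro krull_dim_ge[of 2 X "\<lambda>k. if k = 0 then A else if k = 1 then B else C"]) simp_all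
  then show ?thesis
    by (auto simp: one_enat_def)
qed

text \<open>Abstracts what a polynomial parametrization provides. The parameters range over any
  infinite set, so that finitely many bad values can be removed beforehand.\<close>

definition irreducible_curve :: "'a topology \<Rightarrow> 'c set \<Rightarrow> ('c \<Rightarrow> 'a) \<Rightarrow> bool" where
  "irreducible_curve X D g \<longleftrightarrow> infinite D \<and> g ` D \<subseteq> topspace X \<and>
     (\<forall>A. closedin X A \<longrightarrow> finite {z \<in> D. g z \<in> A} \<or> g ` D \<subseteq> A)"

lemma irreducible_curve_subtopology:
  "irreducible_curve X D g \<Longrightarrow> g ` D \<subseteq> S \<Longrightarrow> irreducible_curve (subtopology X S) D g"
  unfolding irreducible_curve_def
proof (intro conjI allI impI)
  assume g: "infinite D \<and> g ` D \<subseteq> topspace X \<and>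
    (\<forall>A. closedin X A \<longrightarrow> finite {z \<in> D. g z \<in> A} \<or> g ` D \<subseteq> A)" and S: "g ` D \<subseteq> S"
  then show "infinite D" "g ` D \<subseteq> topspace (subtopology X S)" by simp_all
  fix A assume "closedin (subtopology X S) A"
  then obtain B where B: "closedin X B" "A = B \<inter> S"
    by (auto simp: closedin_subtopology)
  then have "{z \<in> D. g z \<in> A} = {z \<in> D. g z \<in> B}"
    using S by auto
  then show "finite {z \<in> D. g z \<in> A} \<or> g ` D \<subseteq> A"
    using g S B by auto
qed

lemma irreducible_curveD:
  assumes "irreducible_curve X D g"
  shows "infinite D" "g ` D \<subseteq> topspace X"
    "\<And>A. closedin X A \<Longrightarrow> finite {z \<in> D. g z \<in> A} \<or> g ` D \<subseteq> A"
  using assms unfolding irreducible_curve_def by blast+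

lemma irreducible_curve_cases:
  assumes "irreducible_curve X D g" "closedin X A" "closedin X B" "g ` D \<subseteq> A \<union> B"
  shows "g ` D \<subseteq> A \<or> g ` D \<subseteq> B"
proof (rule ccontr)
  assume neg: "\<not> (g ` D \<subseteq> A \<or> g ` D \<subseteq> B)"
  have "finite {z \<in> D. g z \<in> A}"
    by (rule disjE[OF irreducible_curveD(3)[OF assms(1,2)]]) (use neg in simp_all)
  moreover have "finite {z \<in> D. g z \<in> B}"
    by (rule disjE[OF irreducible_curveD(3)[OF assms(1,3)]]) (use neg in simp_all)
  moreover have "D \<subseteq> {z \<in> D. g z \<in> A} \<union> {z \<in> D. g z \<in> B}"
    using assms(4) by auto
  ultimately have "finite D"
    by (meson finite_UnI finite_subset)
  with irreducible_curveD(1)[OF assms(1)] show False ..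
qed

lemma irreducible_closure_of_curve:
  assumes "irreducible_curve X D g"
  shows "irreducible_closed X (X closure_of (g ` D))"
  unfolding irreducible_closed_def
proof (intro conjI allI impI)
  have "g ` D \<noteq> {}" "g ` D \<subseteq> X closure_of (g ` D)"
    using irreducible_curveD(1,2)[OF assms] closure_of_subset by fastforce+
  then show "X closure_of (g ` D) \<noteq> {}" by blast
  fix A B assume AB: "closedin X A \<and> closedin X B \<and> X closure_of (g ` D) = A \<union> B"
  then have "g ` D \<subseteq> A \<or> g ` D \<subseteq> B"
    using \<open>g ` D \<subseteq> X closure_of (g ` D)\<close> by (intro irreducible_curve_cases[OF assms]) auto
  then show "X closure_of (g ` D) = A \<or> X closure_of (g ` D) = B"
    using AB closure_of_minimal[of "g ` D" A X] closure_of_minimal[of "g ` D" B X] by blast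
qed auto

text \<open>If two closed sets covered the space and both were proper, a curve joining a point
  outside the first to a point outside the second would have to lie in one of them.\<close>

lemma irreducible_of_curves:
  assumes "topspace X \<noteq> {}"
    and "\<And>x y. x \<in> topspace X \<Longrightarrow> y \<in> topspace X \<Longrightarrow>
      \<exists>D g. irreducible_curve X (D::'c set) g \<and> x \<in> g ` D \<and> y \<in> g ` D"
  shows "irreducible_closed X (topspace X)"
  unfolding irreducible_closed_def
proof (intro conjI allI impI)
  fix A B assume AB: "closedin X A \<and> closedin X B \<and> topspace X = A \<union> B"
  show "topspace X = A \<or> topspace X = B"
  proof (rule ccontr)
    assume "\<not> (topspace X = A \<or> topspace X = B)"
    then obtain x y where xy: "x \<in> topspace X" "x \<notin> A" "y \<in> topspace X" "y \<notin> B"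
      using AB by (metis closedin_subset subset_antisym subsetI)
    then obtain D :: "'c set" and g where g: "irreducible_curve X D g" "x \<in> g ` D" "y \<in> g ` D"
      using assms(2) by metis
    then have "g ` D \<subseteq> A \<or> g ` D \<subseteq> B"
      using AB irreducible_curveD(2)[OF g(1)] by (intro irreducible_curve_cases[OF g(1)]) blast+
    with g xy show False by blast
  qed
qed (use assms in auto)

lemma topspace_final_topology: "topspace (final_topology Y f) = f ` topspace Y"
proof
  have "{y \<in> topspace Y. f y \<in> f ` topspace Y} = topspace Y"
    by auto
  then have "openin (final_topology Y f) (f ` topspace Y)"
    by (simp add: openin_final_topology)
  then show "f ` topspace Y \<subseteq> topspace (final_topology Y f)"
    by (rule openin_subset)
qed (use openin_final_topology[of Y f "topspace (final_topology Y f)"] in auto)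

lemma openin_zariski_polynomial_functions:
  "openin (zariski_topology S (polynomial_functions sc I)) V \<longleftrightarrow>
     (\<exists>P\<subseteq>polynomial_functions sc I. V = {x \<in> S. \<exists>p\<in>P. p x \<noteq> 0})"
  by (rule openin_zariski_topology) (rule polynomial_functions.mult)

lemma topspace_zariski_polynomial_functions:
  "topspace (zariski_topology S (polynomial_functions sc I)) = S"
proof
  have "openin (zariski_topology S (polynomial_functions sc I)) S"
    unfolding openin_zariski_polynomial_functions
    by (rule exI[of _ "{\<lambda>_. 1}"]) (auto intro: polynomial_functions.const)
  then show "S \<subseteq> topspace (zariski_topology S (polynomial_functions sc I))"
    by (rule openin_subset)
qed (use openin_zariski_polynomial_functions[of S sc I "topspace (zariski_topology S (polynomial_functions sc I))"] in auto)

lemma topspace_classical_topology: "(\<lambda>_. c) \<in> A \<Longrightarrow> topspace (classical_topology S A) = S"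
  unfolding classical_topology_def topology_generated_by_topspace
  by (auto intro!: exI[of _ "{x \<in> S. c \<in> UNIV}"] exI[of _ "\<lambda>_. c"] exI[of _ UNIV])

text \<open>Convergence of all functions in \<open>A\<close> settles the generating sets; finite
  intersections and unions follow by induction over the generated topology.\<close>

lemma limitin_classical_topology:
  assumes "x \<in> S" "eventually (\<lambda>z. f z \<in> S) F"
    and lim: "\<And>p. p \<in> A \<Longrightarrow> ((\<lambda>z. p (f z)) \<longlongrightarrow> p x) F"
    and "openin (classical_topology S A) V" "x \<in> V"
  shows "eventually (\<lambda>z. f z \<in> V) F"
proof -
  have "generate_topology_on {{x \<in> S. p x \<in> W} |p W. p \<in> A \<and> open W} V"
    using assms(4) unfolding classical_topology_def by (rule openin_topology_generated_by)
  then show ?thesis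
    using assms(5)
  proof (induction rule: generate_topology_on.induct)
    case (Int a b)
    then show ?case by (auto elim: eventually_elim2)
  next
    case (UN K)
    then obtain k where "k \<in> K" "x \<in> k" by blast
    with UN.IH[of k] show ?case by (auto elim: eventually_mono)
  next
    case (Basis s)
    then obtain p W where s: "s = {x \<in> S. p x \<in> W}" "p \<in> A" "open W" by blast
    with Basis(2) lim[OF s(2)] have "eventually (\<lambda>z. p (f z) \<in> W) F"
      by (auto dest: topological_tendstoD)
    with assms(2) show ?case
      unfolding s(1) by eventually_elim auto
  qed auto
qed

lemma polynomial_functions_sum:
  "(\<And>a. a \<in> A \<Longrightarrow> f a \<in> polynomial_functions sc I) \<Longrightarrow>
     (\<lambda>F. \<Sum>a\<in>A. f a F) \<in> polynomial_functions sc I"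
  by (induction A rule: infinite_finite_induct) (auto intro: polynomial_functions.intros)

lemma polynomial_functions_prod:
  "(\<And>a. a \<in> A \<Longrightarrow> f a \<in> polynomial_functions sc I) \<Longrightarrow>
     (\<lambda>F. \<Prod>a\<in>A. f a F) \<in> polynomial_functions sc I"
  by (induction A rule: infinite_finite_induct) (auto intro: polynomial_functions.intros)

lemma polynomial_functions_det:
  assumes "\<And>a. a < n \<Longrightarrow> Vector_Spaces.linear sc (*) (f a)" "\<And>c. c < n \<Longrightarrow> j c \<in> I"
  shows "(\<lambda>F. Determinant.det (Matrix.mat n n (\<lambda>(a, c). f a (F (j c))))) \<in> polynomial_functions sc I"
proof -
  have p: "p a < n" if "p permutes {0..<n}" "a < n" for p a
    using permutes_in_image[OF that(1), of a] that(2) by simp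
  have "Determinant.det (Matrix.mat n n (\<lambda>(a, c). f a (F (j c)))) =
      (\<Sum>p | p permutes {0..<n}. signof p * (\<Prod>a = 0..<n. f a (F (j (p a)))))" for F
    unfolding Determinant.det_def by (auto simp: p intro!: sum.cong prod.cong)
  moreover have "(\<lambda>F. \<Sum>p | p permutes {0..<n}. signof p * (\<Prod>a = 0..<n. f a (F (j (p a)))))
      \<in> polynomial_functions sc I"
  proof (intro polynomial_functions_sum polynomial_functions.mult polynomial_functions_prod)
    fix p a assume "p \<in> {p. p permutes {0..<n}}" "a \<in> {0..<n}"
    then show "(\<lambda>F. f a (F (j (p a)))) \<in> polynomial_functions sc I"
      using assms p by (intro polynomial_functions.coord) auto
  qed (rule polynomial_functions.const)
  ultimately show ?thesis
    by presburger
qed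

section \<open>Quiver Grassmannians as quotients of spaces of frames\<close>

locale representation =
  fixes Q :: "('v, 'e) pre_digraph" and M :: "('v, 'e, 'b::ab_group_add) quiver_rep" and e :: "'v \<Rightarrow> int"
  assumes is_representation: "is_representation Q M"
begin

sublocale vector_space "rep_scale M"
  using is_representation by (simp add: is_representation_def)

abbreviation "X \<equiv> quiver_grassmannian Q M e"
abbreviation "Zar \<equiv> zariski_quiver_grassmannian Q M e"
abbreviation "Cls \<equiv> classical_quiver_grassmannian Q M e"

lemma grassmannian_basis:
  assumes "U \<in> prod_grassmannian Q M e" "i \<in> verts Q"
  obtains A where "finite A" "independent A" "span A = U i" "int (card A) = e i"
proof -
  obtain V where V: "finite V" "rep_space M i = span V"
    using is_representation assms(2) by (auto simp: is_representation_def)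
  have U: "subspace (U i)" "U i \<subseteq> span V" "int (dim (U i)) = e i"
    using assms V(2) by (auto simp: prod_grassmannian_def PiE_iff)
  obtain A where A: "A \<subseteq> U i" "independent A" "U i \<subseteq> span A" "card A = dim (U i)"
    using basis_exists by blast
  then have "finite A"
    using independent_span_bound[OF V(1) A(2)] U(2) by blast
  moreover have "span A = U i"
    using A(1,3) U(1) by (simp add: span_minimal subset_antisym)
  ultimately show thesis
    using that A U(3) by simp
qed

lemma frame_point_surj: "prod_grassmannian Q M e \<subseteq> frame_point Q M e ` frames Q M e"
proof
  fix U assume U: "U \<in> prod_grassmannian Q M e"
  have "\<exists>h. span (h ` {1..nat (e i)}) = U i" if i: "i \<in> verts Q" for i
  proof -
    obtain A where A: "finite A" "span A = U i" "int (card A) = e i"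
      using grassmannian_basis[OF U i] by metis
    obtain h where "bij_betw h {1..card A} A"
      using ex_bij_betw_nat_finite_1[OF A(1)] by metis
    moreover have "nat (e i) = card A"
      using A(3) by simp
    ultimately have "h ` {1..nat (e i)} = A"
      by (simp add: bij_betw_def)
    with A(2) show ?thesis
      by (intro exI[of _ h]) simp
  qed
  then obtain h where h: "\<And>i. i \<in> verts Q \<Longrightarrow> span (h i ` {1..nat (e i)}) = U i"
    by metis
  define F where "F = (\<lambda>(i, k) \<in> frame_index Q e. h i k)"
  have "frame_point Q M e F = U"
  proof
    fix i
    show "frame_point Q M e F i = U i"
    proof (cases "i \<in> verts Q")
      case True
      then have "(\<lambda>k. F (i, k)) ` {1..nat (e i)} = h i ` {1..nat (e i)}"
        by (intro image_cong) (simp_all add: F_def frame_index_def)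
      with h[OF True] True show ?thesis by (simp add: frame_point_def)
    next
      case False
      have "U i = undefined"
        using U False unfolding prod_grassmannian_def by (rule PiE_arb)
      with False show ?thesis
        by (simp add: frame_point_def)
    qed
  qed
  moreover have "F \<in> extensional (frame_index Q e)"
    by (simp add: F_def)
  ultimately show "U \<in> frame_point Q M e ` frames Q M e"
    using U by (intro image_eqI[of _ _ F]) (simp_all add: frames_def)
qed

lemma frame_point_image: "frame_point Q M e ` frames Q M e = prod_grassmannian Q M e"
  using frame_point_surj by (auto simp: frames_def)

lemma topspace_Zar: "topspace Zar = X"
  by (auto simp: zariski_quiver_grassmannian_def topspace_final_topology
      topspace_zariski_polynomial_functions frame_point_image quiver_grassmannian_def)

lemma topspace_Cls: "topspace Cls = X"
  by (auto simp: classical_quiver_grassmannian_def topspace_final_topology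
      topspace_classical_topology[OF polynomial_functions.const] frame_point_image quiver_grassmannian_def)

text \<open>In the quotient topology a set is closed when its preimage among the frames is; so a
  condition on points is closed once it becomes a system of polynomial equations on frames.\<close>

lemma closedin_Zar_zeros:
  assumes "P \<subseteq> polynomial_functions (rep_scale M) (frame_index Q e)"
    and "\<And>F. F \<in> frames Q M e \<Longrightarrow> C (frame_point Q M e F) \<longleftrightarrow> (\<forall>p\<in>P. p F = 0)"
  shows "closedin Zar {W \<in> X. C W}"
proof -
  let ?Y = "final_topology (zariski_topology (frames Q M e)
    (polynomial_functions (rep_scale M) (frame_index Q e))) (frame_point Q M e)"
  have top: "topspace ?Y = prod_grassmannian Q M e"
    by (simp add: topspace_final_topology topspace_zariski_polynomial_functions frame_point_image)
  have "openin ?Y (topspace ?Y - {W \<in> topspace ?Y. C W})"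
    unfolding openin_final_topology openin_zariski_polynomial_functions
      topspace_zariski_polynomial_functions
  proof (intro conjI exI[of _ P])
    show "topspace ?Y - {W \<in> topspace ?Y. C W} \<subseteq> frame_point Q M e ` frames Q M e"
      using top frame_point_image by auto
    show "{y \<in> frames Q M e. frame_point Q M e y \<in> topspace ?Y - {W \<in> topspace ?Y. C W}} =
        {x \<in> frames Q M e. \<exists>p\<in>P. p x \<noteq> 0}"
      using assms(2) unfolding top by (auto simp: frames_def)
  qed (rule assms)
  then have "closedin ?Y {W \<in> topspace ?Y. C W}"
    by (simp add: closedin_def)
  then have "closedin (subtopology ?Y X) (X \<inter> {W \<in> topspace ?Y. C W})"
    by (rule closedin_subtopology_Int_closed)
  moreover have "X \<inter> {W \<in> topspace ?Y. C W} = {W \<in> X. C W}"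
    unfolding top by (auto simp: quiver_grassmannian_def)
  ultimately show ?thesis
    by (simp add: zariski_quiver_grassmannian_def)
qed

text \<open>Along frames whose linear coordinates are polynomial in \<open>z\<close>, every
  polynomial function of the frame is a polynomial in \<open>z\<close>. An equation failing
  somewhere on the curve thus holds for finitely many \<open>z\<close> only.\<close>

lemma irreducible_curve_frames:
  assumes "infinite D"
    and "\<And>z. z \<in> D \<Longrightarrow> F z \<in> frames Q M e" "\<And>z. z \<in> D \<Longrightarrow> frame_point Q M e (F z) \<in> X"
    and poly: "\<And>j \<phi>. j \<in> frame_index Q e \<Longrightarrow> Vector_Spaces.linear (rep_scale M) (*) \<phi> \<Longrightarrow>
      \<exists>q. \<forall>z\<in>D. \<phi> (F z j) = poly q z"
  shows "irreducible_curve Zar D (\<lambda>z::complex. frame_point Q M e (F z))"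
  unfolding irreducible_curve_def
proof (intro conjI allI impI)
  have polyF: "\<exists>q. \<forall>z\<in>D. p (F z) = poly q z"
    if "p \<in> polynomial_functions (rep_scale M) (frame_index Q e)" for p
    using that
  proof induction
    case (const c)
    then show ?case by (intro exI[of _ "[:c:]"]) simp
  next
    case (add p q)
    then show ?case by (metis poly_add)
  next
    case (mult p q)
    then show ?case by (metis poly_mult)
  qed (rule poly)
  fix A assume A: "closedin Zar A"
  let ?Y = "final_topology (zariski_topology (frames Q M e)
    (polynomial_functions (rep_scale M) (frame_index Q e))) (frame_point Q M e)"
  from A obtain V where V: "closedin ?Y V" "A = V \<inter> X"
    by (auto simp: zariski_quiver_grassmannian_def closedin_subtopology)
  have top: "topspace ?Y = prod_grassmannian Q M e"
    by (simp add: topspace_final_topology topspace_zariski_polynomial_functions frame_point_image)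
  have "openin ?Y (topspace ?Y - V)"
    using V(1) by (simp add: closedin_def)
  then obtain P where P: "P \<subseteq> polynomial_functions (rep_scale M) (frame_index Q e)"
    "{y \<in> frames Q M e. frame_point Q M e y \<in> topspace ?Y - V} = {x \<in> frames Q M e. \<exists>p\<in>P. p x \<noteq> 0}"
    unfolding openin_final_topology openin_zariski_polynomial_functions
      topspace_zariski_polynomial_functions by blast
  have A_iff: "frame_point Q M e (F z) \<in> A \<longleftrightarrow> (\<forall>p\<in>P. p (F z) = 0)" if "z \<in> D" for z
  proof -
    have "frame_point Q M e (F z) \<in> prod_grassmannian Q M e"
      using assms(2)[OF that] by (simp add: frames_def)
    then have "frame_point Q M e (F z) \<in> topspace ?Y"
      by (simp only: top)
    then show ?thesis
      using P(2) assms(2,3)[OF that] unfolding V(2) by blast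
  qed
  show "finite {z \<in> D. frame_point Q M e (F z) \<in> A} \<or> (\<lambda>z. frame_point Q M e (F z)) ` D \<subseteq> A"
  proof (rule disjCI)
    assume "\<not> (\<lambda>z. frame_point Q M e (F z)) ` D \<subseteq> A"
    then obtain z0 p where p: "z0 \<in> D" "p \<in> P" "p (F z0) \<noteq> 0"
      using A_iff by blast
    obtain q where q: "\<forall>z\<in>D. p (F z) = poly q z"
      using polyF P(1) p(2) by blast
    with p have "q \<noteq> 0" by auto
    then have fin: "finite {z. poly q z = 0}"
      by (rule poly_roots_finite)
    have "poly q z = 0" if "z \<in> D" "frame_point Q M e (F z) \<in> A" for z
      using A_iff[OF that(1)] that p(2) q by metis
    then have "{z \<in> D. frame_point Q M e (F z) \<in> A} \<subseteq> {z. poly q z = 0}"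
      by blast
    with fin show "finite {z \<in> D. frame_point Q M e (F z) \<in> A}"
      by (rule rev_finite_subset)
  qed
qed (use assms topspace_Zar in auto)

text \<open>Taking spans is continuous by the choice of the quotient topology, so it is enough that
  the frames converge; linear functionals suffice as tests because they generate the polynomial
  functions.\<close>

lemma limitin_Cls_frames:
  assumes "F0 \<in> frames Q M e" "frame_point Q M e F0 \<in> X"
    and ev: "eventually (\<lambda>z. F z \<in> frames Q M e) K" "eventually (\<lambda>z. frame_point Q M e (F z) \<in> X) K"
    and lim: "\<And>j \<phi>. j \<in> frame_index Q e \<Longrightarrow> Vector_Spaces.linear (rep_scale M) (*) \<phi> \<Longrightarrow>
      ((\<lambda>z. \<phi> (F z j)) \<longlongrightarrow> \<phi> (F0 j)) K"
  shows "limitin Cls (\<lambda>z. frame_point Q M e (F z)) (frame_point Q M e F0) K"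
  unfolding limitin_def
proof (intro conjI allI impI)
  show "frame_point Q M e F0 \<in> topspace Cls"
    using assms by (simp add: topspace_Cls)
  let ?A = "polynomial_functions (rep_scale M) (frame_index Q e)"
  fix V assume V: "openin Cls V \<and> frame_point Q M e F0 \<in> V"
  then obtain V' where V': "openin (final_topology (classical_topology (frames Q M e) ?A) (frame_point Q M e)) V'"
      "V = V' \<inter> X"
    by (auto simp: classical_quiver_grassmannian_def openin_subtopology)
  have "openin (classical_topology (frames Q M e) ?A) {F \<in> frames Q M e. frame_point Q M e F \<in> V'}"
    using V'(1) by (simp add: openin_final_topology topspace_classical_topology[OF polynomial_functions.const])
  moreover have "((\<lambda>z. p (F z)) \<longlongrightarrow> p F0) K" if "p \<in> ?A" for p
    using that
  proof induction
    case (coord j \<phi>)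
    then show ?case by (rule lim)
  qed (auto intro: tendsto_add tendsto_mult)
  ultimately have "eventually (\<lambda>z. F z \<in> {F \<in> frames Q M e. frame_point Q M e F \<in> V'}) K"
    using assms(1) V V'(2) by (intro limitin_classical_topology[OF assms(1) ev(1), where A = ?A]) auto
  with ev(2) show "eventually (\<lambda>z. frame_point Q M e (F z) \<in> V) K"
    unfolding V'(2) by eventually_elim auto
qed

lemma independent_Un:
  assumes "independent A" "independent B" "span A \<inter> span B = {0}"
  shows "independent (A \<union> B)"
  unfolding dependent_explicit
proof clarify
  fix T u v assume T: "finite T" "T \<subseteq> A \<union> B" "(\<Sum>v\<in>T. rep_scale M (u v) v) = 0" "v \<in> T" "u v \<noteq> 0"
  have split: "(\<Sum>v\<in>T. rep_scale M (u v) v) =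
      (\<Sum>v\<in>T \<inter> A. rep_scale M (u v) v) + (\<Sum>v\<in>T - A. rep_scale M (u v) v)"
    using sum.Int_Diff[OF T(1)] by blast
  have A: "(\<Sum>v\<in>T \<inter> A. rep_scale M (u v) v) \<in> span A"
    by (intro span_sum span_scale span_base) auto
  moreover have B: "(\<Sum>v\<in>T - A. rep_scale M (u v) v) \<in> span B"
    using T(2) by (intro span_sum span_scale span_base) auto
  moreover have "(\<Sum>v\<in>T \<inter> A. rep_scale M (u v) v) = - (\<Sum>v\<in>T - A. rep_scale M (u v) v)"
    using T(3) split by (simp add: eq_neg_iff_add_eq_0)
  ultimately have "(\<Sum>v\<in>T \<inter> A. rep_scale M (u v) v) \<in> span A \<inter> span B"
    by (simp add: span_neg)
  with assms(3) have 0: "(\<Sum>v\<in>T \<inter> A. rep_scale M (u v) v) = 0" by blast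
  then have 1: "(\<Sum>v\<in>T - A. rep_scale M (u v) v) = 0"
    using T(3) split by simp
  show False
  proof (cases "v \<in> A")
    case True
    then show ?thesis
      using independentD[OF assms(1) _ _ 0, of v] T by auto
  next
    case False
    then show ?thesis
      using independentD[OF assms(2) _ _ 1, of v] T by auto
  qed
qed

text \<open>In \<open>frames\<close>, independence is encoded by the dimension of the span: a
  maximal independent subset already has \<open>e i\<close> elements, so no vector is redundant or
  repeated.\<close>

lemma frame_independent:
  assumes "F \<in> frames Q M e" "i \<in> verts Q"
  shows "inj_on (\<lambda>k. F (i, k)) {1..nat (e i)}" "independent ((\<lambda>k. F (i, k)) ` {1..nat (e i)})"
    "frame_point Q M e F i = span ((\<lambda>k. F (i, k)) ` {1..nat (e i)})"
proof -
  let ?A = "(\<lambda>k. F (i, k)) ` {1..nat (e i)}"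
  show *: "frame_point Q M e F i = span ?A"
    using assms(2) by (simp add: frame_point_def)
  have "int (dim (span ?A)) = e i"
    using assms * by (fastforce simp: frames_def prod_grassmannian_def PiE_iff)
  then have dim: "dim (span ?A) = nat (e i)" by simp
  obtain B where B: "B \<subseteq> ?A" "independent B" "?A \<subseteq> span B"
    using maximal_independent_subset by metis
  have "span B = span ?A"
    using B(1,3) by (meson span_minimal span_mono subset_antisym subspace_span)
  then have card: "card B = nat (e i)"
    using dim dim_span_eq_card_independent[OF B(2)] by simp
  have "card ?A \<le> nat (e i)"
    using card_image_le[of "{1..nat (e i)}" "\<lambda>k. F (i, k)"] by simp
  with B(1) card have "B = ?A"
    by (intro card_seteq) auto
  with B(2) card show "independent ?A" "inj_on (\<lambda>k. F (i, k)) {1..nat (e i)}"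
    by (auto intro: eq_card_imp_inj_on)
qed

text \<open>The source of all closed sets constructed later: points, prescribed entries of an
  echelon form, and the conditions that determine the closure of an edge are all reduced to
  it.\<close>

lemma closedin_meets_subspace:
  assumes P: "subspace P" and i: "i \<in> verts Q"
  shows "closedin Zar {W \<in> X. \<exists>w\<in>W i \<inter> P. w \<noteq> 0}"
proof -
  define n where "n = nat (e i)"
  \<comment> \<open>An element of \<open>\<Phi>\<close> is a linear map to n-space that kills
    \<open>P\<close>. The span of the frame meets \<open>P\<close> trivially exactly when some such
    map is injective on it, that is, has non-zero determinant on the frame.\<close>
  define \<Phi> where "\<Phi> = {f. \<forall>a<n. Vector_Spaces.linear (rep_scale M) (*) (f a) \<and> (\<forall>w\<in>P. f a w = 0)}"
  define A where "A f F = Matrix.mat n n (\<lambda>(a, c). f a (F (i, Suc c)))"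
    for f :: "nat \<Rightarrow> 'b \<Rightarrow> complex" and F :: "'v \<times> nat \<Rightarrow> 'b"
  have lin: "Vector_Spaces.linear (rep_scale M) (*) (f a)" if "f \<in> \<Phi>" "a < n" for f a
    using that unfolding \<Phi>_def mem_Collect_eq by (elim allE[of _ a] impE conjE)
  have index: "(i, Suc c) \<in> frame_index Q e" if "c < n" for c
    using i that unfolding n_def frame_index_def by simp
  show ?thesis
  proof (rule closedin_Zar_zeros)
    show "(\<lambda>f F. Determinant.det (A f F)) ` \<Phi> \<subseteq> polynomial_functions (rep_scale M) (frame_index Q e)"
    proof (rule image_subsetI)
      fix f assume f: "f \<in> \<Phi>"
      show "(\<lambda>F. Determinant.det (A f F)) \<in> polynomial_functions (rep_scale M) (frame_index Q e)"
        unfolding A_def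
        by (rule polynomial_functions_det[where f = f and j = "\<lambda>c. (i, Suc c)"])
           (erule lin[OF f], erule index)
    qed
    fix F assume F: "F \<in> frames Q M e"
    let ?B = "(\<lambda>k. F (i, k)) ` {1..n}"
    have inj: "inj_on (\<lambda>k. F (i, k)) {1..n}" and ind: "independent ?B" and
      pt: "frame_point Q M e F i = span ?B"
      using frame_independent[OF F i] by (auto simp: n_def)
    have "(\<exists>w\<in>span ?B \<inter> P. w \<noteq> 0) \<longleftrightarrow> (\<forall>f\<in>\<Phi>. Determinant.det (A f F) = 0)"
    proof (intro iffI ballI)
      fix f assume f: "f \<in> \<Phi>" and "\<exists>w\<in>span ?B \<inter> P. w \<noteq> 0"
      then obtain w where w: "w \<in> span ?B" "w \<in> P" "w \<noteq> 0" by blast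
      obtain u where "w = (\<Sum>v\<in>?B. rep_scale M (u v) v)"
        using w(1) span_finite[of ?B] by auto
      then have w_eq: "w = (\<Sum>k\<in>{1..n}. rep_scale M (u (F (i, k))) (F (i, k)))"
        by (simp only: sum.reindex[OF inj] o_def)
      also have "\<dots> = (\<Sum>c<n. rep_scale M (u (F (i, Suc c))) (F (i, Suc c)))"
        by (rule sum.reindex_bij_witness[of _ Suc "\<lambda>k. k - 1"]) auto
      finally have w_eq: "w = (\<Sum>c<n. rep_scale M (u (F (i, Suc c))) (F (i, Suc c)))" .
      define v where "v = Matrix.vec n (\<lambda>c. u (F (i, Suc c)))"
      have "v \<noteq> 0\<^sub>v n"
      proof
        assume "v = 0\<^sub>v n"
        then have "u (F (i, Suc c)) = 0" if "c < n" for c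
          using that by (metis index_vec index_zero_vec(1) v_def)
        with w_eq w(3) show False by simp
      qed
      moreover have "A f F *\<^sub>v v = 0\<^sub>v n"
      proof (rule Matrix.eq_vecI)
        fix a assume "a < dim_vec (0\<^sub>v n :: complex Matrix.vec)"
        then have a: "a < n" by simp
        then interpret f: Vector_Spaces.linear "rep_scale M" "(*)" "f a"
          using f lin by metis
        have "Matrix.vec_index (A f F *\<^sub>v v) a = (\<Sum>c<n. f a (F (i, Suc c)) * u (F (i, Suc c)))"
          using a by (simp add: A_def v_def scalar_prod_def atLeast0LessThan)
        also have "\<dots> = f a w"
          unfolding w_eq f.sum f.scale by (simp add: mult.commute)
        also have "\<dots> = 0"
          using f a w(2) unfolding \<Phi>_def by blast
        finally show "Matrix.vec_index (A f F *\<^sub>v v) a = Matrix.vec_index (0\<^sub>v n) a"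
          using a by simp
      qed (simp add: A_def)
      moreover have "v \<in> carrier_vec n" "A f F \<in> carrier_mat n n"
        by (auto simp: v_def A_def)
      ultimately show "Determinant.det (A f F) = 0"
        using det_0_iff_vec_prod_zero by blast
    next
      assume det: "\<forall>f\<in>\<Phi>. Determinant.det (A f F) = 0"
      show "\<exists>w\<in>span ?B \<inter> P. w \<noteq> 0"
      proof (rule ccontr)
        assume "\<not> (\<exists>w\<in>span ?B \<inter> P. w \<noteq> 0)"
        then have "\<forall>w\<in>span ?B \<inter> P. w = 0" by blast
        then have "span ?B \<inter> P = {0}"
          using span_zero subspace_0[OF P] by fast
        moreover obtain C where C: "C \<subseteq> P" "independent C" "P \<subseteq> span C"
          using maximal_independent_subset by metis
        moreover have "span C = P"
          using C P by (simp add: span_minimal subset_antisym)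
        ultimately have BC: "independent (?B \<union> C)"
          by (intro independent_Un ind) auto
        \<comment> \<open>\<open>C\<close> is a basis of \<open>P\<close>. In a basis containing
          both the frame and \<open>C\<close>, the coordinates along the frame vectors vanish on
          \<open>P\<close> and give the identity matrix on the frame.\<close>
        define E where "E = extend_basis (?B \<union> C)"
        have E: "?B \<union> C \<subseteq> E" "independent E" "span E = UNIV"
          unfolding E_def
          using extend_basis_superset[OF BC] independent_extend_basis[OF BC] span_extend_basis[OF BC]
          by simp_all
        define f where "f a v = representation E v (F (i, Suc a))" for a v
        have lin: "Vector_Spaces.linear (rep_scale M) (*) (f a)" for a
          unfolding f_def by (rule linear_representation[OF E(2,3)])
        have rep: "f a v = (if F (i, Suc a) = v then 1 else 0)" if "v \<in> E" for a v
          using representation_basis[OF E(2) that] by (simp add: f_def)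
        have disj: "F (i, Suc a) \<notin> C" if "a < n" for a
        proof
          assume "F (i, Suc a) \<in> C"
          moreover have "F (i, Suc a) \<in> ?B"
            using that by auto
          ultimately have "F (i, Suc a) \<in> span ?B \<inter> P"
            using C(1) by (auto intro: span_base)
          then have "F (i, Suc a) = 0"
            using \<open>span ?B \<inter> P = {0}\<close> by blast
          with \<open>F (i, Suc a) \<in> ?B\<close> ind show False
            using dependent_zero by metis
        qed
        have "f a w = 0" if "w \<in> P" "a < n" for a w
        proof -
          interpret f: Vector_Spaces.linear "rep_scale M" "(*)" "f a"
            by (rule lin)
          have "w \<in> span C"
            using C that by auto
          then show ?thesis
            by (rule f.eq_0_on_span[rotated]) (use E(1) disj[OF that(2)] rep in auto)
        qed
        then have "f \<in> \<Phi>"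
          using lin unfolding \<Phi>_def by blast
        moreover have "A f F = 1\<^sub>m n"
        proof (rule Matrix.eq_matI)
          fix a c assume "a < dim_row (1\<^sub>m n :: complex mat)" "c < dim_col (1\<^sub>m n :: complex mat)"
          then have ac: "a < n" "c < n" by auto
          then have "F (i, Suc c) \<in> E"
            using E(1) by auto
          with ac rep[of "F (i, Suc c)" a] inj_onD[OF inj, of "Suc a" "Suc c"]
          show "A f F $$ (a, c) = 1\<^sub>m n $$ (a, c)"
            by (auto simp: A_def)
        qed (auto simp: A_def)
        ultimately show False
          using det by fastforce
      qed
    qed
    then show "(\<exists>w\<in>frame_point Q M e F i \<inter> P. w \<noteq> 0) \<longleftrightarrow>
        (\<forall>p\<in>(\<lambda>f F. Determinant.det (A f F)) ` \<Phi>. p F = 0)"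
      by (simp add: pt)
  qed
qed

end

section \<open>The coefficient quiver of an aligned straightening basis\<close>

declare One_nat_def [simp del]

locale straight_representation = representation Q M e
  for Q :: "('v, 'e) pre_digraph" and M :: "('v, 'e, 'b::ab_group_add) quiver_rep" and e :: "'v \<Rightarrow> int" +
  fixes b :: "'v \<Rightarrow> nat \<Rightarrow> 'b"
  assumes fin_digraph_Q: "fin_digraph Q"
    and straightening: "straightening_basis Q M b"
    and normalized: "normalized Q M b"
    and aligned: "aligned Q M b"
begin

abbreviation "G \<equiv> coeff_quiver Q M b"
abbreviation "range_of i \<equiv> {1..rep_dim M i}"
abbreviation "coord \<equiv> basis_coeff M b"

definition lincomb :: "'v \<Rightarrow> (nat \<Rightarrow> complex) \<Rightarrow> 'b" where
  "lincomb i c = (\<Sum>k\<in>range_of i. rep_scale M (c k) (b i k))"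

lemma basis:
  assumes "i \<in> verts Q"
  shows "inj_on (b i) (range_of i)" "independent (b i ` range_of i)"
    "span (b i ` range_of i) = rep_space M i"
  using straightening assms by (auto simp: straightening_basis_def indexed_basis_def)

lemma basis_in_space: "i \<in> verts Q \<Longrightarrow> k \<in> range_of i \<Longrightarrow> b i k \<in> rep_space M i"
  using basis(3) span_base[OF imageI, of k "range_of i" "b i"] by simp

lemma subspace_space: "i \<in> verts Q \<Longrightarrow> subspace (rep_space M i)"
  using basis(3) subspace_span by metis

lemma basis_nonzero: "i \<in> verts Q \<Longrightarrow> k \<in> range_of i \<Longrightarrow> b i k \<noteq> 0"
  using basis(2) dependent_zero by (metis image_eqI)

lemma coord_basis:
  assumes "i \<in> verts Q" "k \<in> range_of i" "l \<in> range_of i"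
  shows "coord i (b i k) l = (if k = l then 1 else 0)"
  using representation_basis[OF basis(2)[OF assms(1)] imageI[OF assms(2)]]
    inj_on_eq_iff[OF basis(1)[OF assms(1)] assms(3,2)]
  by (auto simp: basis_coeff_def)

lemma coord_add:
  "i \<in> verts Q \<Longrightarrow> v \<in> rep_space M i \<Longrightarrow> w \<in> rep_space M i \<Longrightarrow> coord i (v + w) l = coord i v l + coord i w l"
  by (simp add: basis_coeff_def representation_add basis)

lemma coord_diff:
  "i \<in> verts Q \<Longrightarrow> v \<in> rep_space M i \<Longrightarrow> w \<in> rep_space M i \<Longrightarrow> coord i (v - w) l = coord i v l - coord i w l"
  by (simp add: basis_coeff_def representation_diff basis)

lemma coord_scale:
  "i \<in> verts Q \<Longrightarrow> v \<in> rep_space M i \<Longrightarrow> coord i (rep_scale M c v) l = c * coord i v l"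
  by (simp add: basis_coeff_def representation_scale basis)

lemma coord_zero: "coord i 0 l = 0"
  by (simp add: basis_coeff_def representation_zero)

lemma coord_sum:
  "i \<in> verts Q \<Longrightarrow> (\<And>a. a \<in> A \<Longrightarrow> f a \<in> rep_space M i) \<Longrightarrow>
    coord i (\<Sum>a\<in>A. f a) l = (\<Sum>a\<in>A. coord i (f a) l)"
  by (simp add: basis_coeff_def representation_sum basis)

lemma lincomb_in_space: "i \<in> verts Q \<Longrightarrow> lincomb i c \<in> rep_space M i"
  unfolding lincomb_def
  by (intro subspace_sum subspace_scale subspace_space basis_in_space)

lemma coord_lincomb:
  assumes "i \<in> verts Q" "l \<in> range_of i"
  shows "coord i (lincomb i c) l = c l"
proof -
  have "coord i (lincomb i c) l = (\<Sum>k\<in>range_of i. c k * coord i (b i k) l)"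
    unfolding lincomb_def using assms(1)
    by (simp add: coord_sum coord_scale basis_in_space subspace_scale subspace_space del: atLeastAtMost_iff)
  also have "\<dots> = (\<Sum>k\<in>range_of i. if k = l then c l else 0)"
    using assms by (intro sum.cong) (simp_all add: coord_basis)
  finally show ?thesis
    using assms(2) by simp
qed

lemma lincomb_coord:
  assumes "i \<in> verts Q" "v \<in> rep_space M i"
  shows "lincomb i (coord i v) = v"
proof -
  have "v = (\<Sum>w\<in>b i ` range_of i. rep_scale M (representation (b i ` range_of i) v w) w)"
    using assms basis[OF assms(1)] by (subst sum_representation_eq) auto
  also have "\<dots> = lincomb i (coord i v)"
    by (simp add: lincomb_def sum.reindex[OF basis(1)[OF assms(1)]] basis_coeff_def)
  finally show ?thesis by simp
qed

lemma lincomb_cong: "(\<And>l. l \<in> range_of i \<Longrightarrow> c l = c' l) \<Longrightarrow> lincomb i c = lincomb i c'"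
  unfolding lincomb_def by (rule sum.cong) simp_all

lemma coord_eqI:
  assumes "i \<in> verts Q" "v \<in> rep_space M i" "w \<in> rep_space M i"
    "\<And>l. l \<in> range_of i \<Longrightarrow> coord i v l = coord i w l"
  shows "v = w"
proof -
  have "lincomb i (coord i v) = lincomb i (coord i w)"
    by (rule lincomb_cong) (rule assms(4))
  then show ?thesis
    using lincomb_coord[OF assms(1,2)] lincomb_coord[OF assms(1,3)] by metis
qed

lemma lincomb_add: "lincomb i c + lincomb i c' = lincomb i (\<lambda>l. c l + c' l)"
  by (simp add: lincomb_def scale_left_distrib sum.distrib)

lemma scale_lincomb: "rep_scale M a (lincomb i c) = lincomb i (\<lambda>l. a * c l)"
  by (simp add: lincomb_def scale_sum_right)

lemma lincomb_sum: "(\<Sum>a\<in>A. lincomb i (f a)) = lincomb i (\<lambda>l. \<Sum>a\<in>A. f a l)"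
  unfolding lincomb_def by (subst sum.swap) (simp add: scale_sum_left)

lemma lincomb_delta: "k \<in> range_of i \<Longrightarrow> lincomb i (\<lambda>l. if l = k then 1 else 0) = b i k"
proof -
  assume k: "k \<in> range_of i"
  have "lincomb i (\<lambda>l. if l = k then 1 else 0) = (\<Sum>l\<in>range_of i. if l = k then b i k else 0)"
    unfolding lincomb_def by (rule sum.cong) simp_all
  with k show ?thesis by simp
qed

lemma rep_map_space: "a \<in> arcs Q \<Longrightarrow> v \<in> rep_space M (tail Q a) \<Longrightarrow> rep_map M a v \<in> rep_space M (head Q a)"
  using is_representation by (simp add: is_representation_def)

lemma rep_map_add:
  "a \<in> arcs Q \<Longrightarrow> v \<in> rep_space M (tail Q a) \<Longrightarrow> w \<in> rep_space M (tail Q a) \<Longrightarrow>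
    rep_map M a (v + w) = rep_map M a v + rep_map M a w"
  using is_representation by (simp add: is_representation_def)

lemma rep_map_scale:
  "a \<in> arcs Q \<Longrightarrow> v \<in> rep_space M (tail Q a) \<Longrightarrow> rep_map M a (rep_scale M c v) = rep_scale M c (rep_map M a v)"
  using is_representation by (simp add: is_representation_def)

lemma ends_Q: "a \<in> arcs Q \<Longrightarrow> tail Q a \<in> verts Q" "a \<in> arcs Q \<Longrightarrow> head Q a \<in> verts Q"
  using fin_digraph_Q wf_digraph.tail_in_verts wf_digraph.head_in_verts fin_digraph.axioms(1) by metis+

text \<open>\<open>rep_map M a\<close> is linear only on the space at the tail of \<open>a\<close>,
  hence the induction over subsets, which carries membership along.\<close>

lemma rep_map_lincomb:
  assumes a: "a \<in> arcs Q"
  shows "rep_map M a (lincomb (tail Q a) c) =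
    (\<Sum>k\<in>range_of (tail Q a). rep_scale M (c k) (rep_map M a (b (tail Q a) k)))"
proof -
  let ?i = "tail Q a"
  have i: "?i \<in> verts Q" by (rule ends_Q(1)[OF a])
  have zero: "rep_map M a 0 = 0"
    using rep_map_scale[OF a subspace_0[OF subspace_space[OF i]], of 0] by simp
  have "rep_map M a (\<Sum>k\<in>A. rep_scale M (c k) (b ?i k)) =
      (\<Sum>k\<in>A. rep_scale M (c k) (rep_map M a (b ?i k)))" if "A \<subseteq> range_of ?i" for A
  proof -
    have "finite A" using that finite_subset by blast
    then show ?thesis
      using that
    proof induction
      case (insert x A)
      have A: "b ?i k \<in> rep_space M ?i" if "k \<in> insert x A" for k
        using insert.prems that basis_in_space[OF i] by blast
      have "(\<Sum>k\<in>A. rep_scale M (c k) (b ?i k)) \<in> rep_space M ?i"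
        by (intro subspace_sum subspace_scale subspace_space[OF i] A) simp
      moreover have "rep_scale M (c x) (b ?i x) \<in> rep_space M ?i"
        by (intro subspace_scale subspace_space[OF i] A) simp
      ultimately show ?case
        using insert A by (simp add: rep_map_add[OF a] rep_map_scale[OF a])
    qed (simp add: zero)
  qed
  then show ?thesis
    by (simp add: lincomb_def)
qed

lemma verts_G: "verts G = (SIGMA i:verts Q. range_of i)"
  by (simp add: coeff_quiver_def)

lemma in_verts_G: "(i, k) \<in> verts G \<longleftrightarrow> i \<in> verts Q \<and> k \<in> range_of i"
  by (auto simp: verts_G)

lemma ends_G: "tail G = fst" "head G = snd \<circ> snd"
  by (auto simp: coeff_quiver_def)

text \<open>By normalization the image of a basis vector is zero or a basis vector, so a non-zero
  coefficient already means equality with that basis vector.\<close>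

lemma in_arcs_G:
  "(x, a, y) \<in> arcs G \<longleftrightarrow> a \<in> arcs Q \<and> fst x = tail Q a \<and> fst y = head Q a \<and>
     snd x \<in> range_of (tail Q a) \<and> snd y \<in> range_of (head Q a) \<and>
     rep_map M a (b (tail Q a) (snd x)) = b (head Q a) (snd y)"
proof -
  have "basis_coeff M b (head Q a) (rep_map M a (b (tail Q a) k)) l \<noteq> 0 \<longleftrightarrow>
      rep_map M a (b (tail Q a) k) = b (head Q a) l"
    if a: "a \<in> arcs Q" and k: "k \<in> range_of (tail Q a)" and l: "l \<in> range_of (head Q a)" for k l
  proof -
    have "rep_map M a (b (tail Q a) k) \<in> insert 0 (b (head Q a) ` range_of (head Q a))"
      using normalized a k unfolding normalized_def by blast
    then consider "rep_map M a (b (tail Q a) k) = 0"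
      | m where "m \<in> range_of (head Q a)" "rep_map M a (b (tail Q a) k) = b (head Q a) m"
      by blast
    then show ?thesis
    proof cases
      case 1
      with basis_nonzero[OF ends_Q(2)[OF a] l] show ?thesis
        by (simp add: coord_zero)
    next
      case 2
      then show ?thesis
        using coord_basis[OF ends_Q(2)[OF a] 2(1) l] inj_on_eq_iff[OF basis(1)[OF ends_Q(2)[OF a]] 2(1) l]
        by simp
    qed
  qed
  then show ?thesis
    by (cases x; cases y) (auto simp: coeff_quiver_def)
qed

lemma rep_map_basis_cases:
  assumes "a \<in> arcs Q" "k \<in> range_of (tail Q a)"
  obtains "rep_map M a (b (tail Q a) k) = 0"
  | l where "((tail Q a, k), a, (head Q a, l)) \<in> arcs G" "l \<in> range_of (head Q a)"
      "rep_map M a (b (tail Q a) k) = b (head Q a) l"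
proof -
  have "rep_map M a (b (tail Q a) k) \<in> insert 0 (b (head Q a) ` range_of (head Q a))"
    using normalized assms unfolding normalized_def by blast
  then show thesis
    using assms that by (auto simp: in_arcs_G)
qed

sublocale string_digraph G
proof
  fix a assume a: "a \<in> arcs G"
  obtain x c y where "a = (x, c, y)" using prod_cases3 by blast
  with a show "tail G a \<in> verts G" "head G a \<in> verts G"
    using ends_Q by (cases x; cases y; auto simp: in_arcs_G in_verts_G ends_G)+
next
  have fin: "finite (verts Q)" "finite (arcs Q)"
    using fin_digraph_Q by (auto simp: fin_digraph_def fin_digraph_axioms_def)
  then show *: "finite (verts G)"
    by (simp add: verts_G)
  have "arcs G \<subseteq> verts G \<times> arcs Q \<times> verts G"
  proof
    fix a assume a: "a \<in> arcs G"
    obtain x c y where "a = (x, c, y)" using prod_cases3 by blast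
    with a show "a \<in> verts G \<times> arcs Q \<times> verts G"
      using ends_Q by (cases x; cases y) (auto simp: in_arcs_G in_verts_G)
  qed
  with * fin(2) show "finite (arcs G)"
    by (meson finite_SigmaI finite_subset)
next
  fix H assume "H \<in> components G"
  then show "equioriented_string H"
    using straightening by (simp add: straightening_basis_def)
qed

text \<open>The form in which alignment is used: its first clause forbids that the arrow kills the
  vector of smaller index but not the one of larger index, and its second clause keeps the order of
  the images.\<close>

lemma copy_arc:
  assumes "((i, l), a, y) \<in> arcs G" "(i, k) \<in> verts G" "k < l"
  obtains k' where "((i, k), a, (fst y, k')) \<in> arcs G" "k' < snd y"
proof -
  have a: "a \<in> arcs Q" "i = tail Q a" "fst y = head Q a" "l \<in> range_of (tail Q a)" "snd y \<in> range_of (head Q a)"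
      "rep_map M a (b (tail Q a) l) = b (head Q a) (snd y)"
    using assms(1) by (auto simp: in_arcs_G)
  have k: "k \<in> range_of (tail Q a)"
    using assms(2) a(2) by (auto simp: in_verts_G)
  have nz: "rep_map M a (b (tail Q a) l) \<noteq> 0"
    using a basis_nonzero[OF ends_Q(2)[OF a(1)] a(5)] by metis
  have al: "(rep_map M a (b (tail Q a) k) = 0 \<and> rep_map M a (b (tail Q a) l) \<noteq> 0 \<longrightarrow> k > l)"
     "\<And>k' l'. k' \<in> range_of (head Q a) \<Longrightarrow> l' \<in> range_of (head Q a) \<Longrightarrow>
        rep_map M a (b (tail Q a) l) = b (head Q a) l' \<Longrightarrow>
        rep_map M a (b (tail Q a) k) = b (head Q a) k' \<Longrightarrow> l > k \<Longrightarrow> l' > k'"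
    using aligned a(1,4) k unfolding aligned_def by blast+
  from a(1) k show thesis
  proof (cases rule: rep_map_basis_cases)
    case 1
    with al(1) nz assms(3) show thesis by simp
  next
    case (2 k')
    then have "k' < snd y"
      using al(2)[of k' "snd y"] a(5,6) assms(3) by simp
    with 2 that a(2,3) show thesis by simp
  qed
qed

lemma copy_awalk:
  assumes "awalk (i, l) p y" "(i, k) \<in> verts G" "k < l"
  obtains p' k' where "awalk (i, k) p' (fst y, k')" "map underlying_arc p' = map underlying_arc p" "k' < snd y"
proof -
  have "\<exists>p' k'. awalk (i, k) p' (fst y, k') \<and> map underlying_arc p' = map underlying_arc p \<and> k' < snd y"
    using assms
  proof (induction p arbitrary: i k l)
    case Nil
    then show ?case
      by (intro exI[of _ "[]"] exI[of _ k]) (auto simp: awalk_Nil_iff)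
  next
    case (Cons a p)
    then have a: "a \<in> arcs G" "(i, l) = tail G a" "awalk (head G a) p y"
      by (auto simp: awalk_Cons_iff)
    obtain c j l' where c: "a = ((i, l), c, (j, l'))"
      using a(2) by (cases a) (auto simp: ends_G)
    obtain k' where k': "((i, k), c, (j, k')) \<in> arcs G" "k' < l'"
      using copy_arc[OF a(1)[unfolded c] Cons.prems(2,3)] by auto
    moreover have "(j, k') \<in> verts G"
      using head_in_verts[OF k'(1)] by (simp add: ends_G)
    moreover have "awalk (j, l') p y"
      using a(3) by (simp add: c ends_G)
    ultimately obtain p' k'' where "awalk (j, k') p' (fst y, k'')"
        "map underlying_arc p' = map underlying_arc p" "k'' < snd y"
      using Cons.IH[of j l' k'] by blast
    with k' show ?case
      by (intro exI[of _ "((i, k), c, (j, k')) # p'"] exI[of _ k''])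
         (simp add: awalk_Cons_iff ends_G c underlying_arc_def comp_def)
  qed
  then show thesis
    using that by blast
qed

abbreviation "same_string x y \<equiv> component_of G x = component_of G y"

text \<open>Copying the walk from \<open>(i, l)\<close> to \<open>y\<close> arrow by arrow.
  Consequently the string through the smaller index \<open>k\<close> continues at least as far as
  the one through \<open>l\<close>.\<close>

lemma copy_vertex:
  assumes "(i, k) \<in> verts G" "(i, l) \<in> verts G" "k < l"
    "y \<in> verts G" "same_string (i, l) y" "position (i, l) \<le> position y"
  obtains k' where "(fst y, k') \<in> verts G" "k' < snd y" "same_string (i, k) (fst y, k')"
    "position (fst y, k') = position (i, k) + (position y - position (i, l))"
proof -
  obtain p where p: "awalk (i, l) p y" "length p = position y - position (i, l)"
    using obtain_awalk[OF assms(2,4,5,6)] by metis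
  obtain p' k' where p': "awalk (i, k) p' (fst y, k')" "map underlying_arc p' = map underlying_arc p" "k' < snd y"
    using copy_awalk[OF p(1) assms(1,3)] by metis
  have "length p' = length p"
    using p'(2) by (metis length_map)
  with p'(1,3) show thesis
    using that[of k'] component_of_awalk[OF p'(1)] preceding_segment_append[OF p'(1)] p(2)
      awalk_last_in_verts[OF p'(1)] by simp
qed

lemma obtain_last_vertex:
  assumes "x \<in> verts G"
  obtains y where "y \<in> verts G" "same_string x y" "\<And>z. z \<in> verts G \<Longrightarrow> same_string x z \<Longrightarrow> position z \<le> position y"
proof -
  have "finite {z \<in> verts G. same_string x z}" "{z \<in> verts G. same_string x z} \<noteq> {}"
    using assms finite_verts by (auto intro!: exI[of _ "fst x"] exI[of _ "snd x"])
  from Max_in[of "position ` {z \<in> verts G. same_string x z}"]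
    Max_ge[of "position ` {z \<in> verts G. same_string x z}"] this
  obtain y where "y \<in> {z \<in> verts G. same_string x z}"
      "position y = Max (position ` {z \<in> verts G. same_string x z})"
    by (metis (no_types, lifting) finite_imageI image_iff image_is_empty)
  with that[of y] Max_ge[of "position ` {z \<in> verts G. same_string x z}"]
    \<open>finite {z \<in> verts G. same_string x z}\<close>
  show thesis by simp
qed

text \<open>If \<open>(i, l)\<close> came before \<open>(i, k)\<close>, then its string, copied to \<open>(i, k)\<close>, would run past its own end.\<close>

lemma same_string_position_less:
  assumes "(i, k) \<in> verts G" "(i, l) \<in> verts G" "k < l" "same_string (i, k) (i, l)"
  shows "position (i, k) < position (i, l)"
proof (rule ccontr)
  assume neg: "\<not> position (i, k) < position (i, l)"
  obtain y where y: "y \<in> verts G" "same_string (i, l) y"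
      "\<And>z. z \<in> verts G \<Longrightarrow> same_string (i, l) z \<Longrightarrow> position z \<le> position y"
    using obtain_last_vertex[OF assms(2)] by metis
  obtain k' where k': "(fst y, k') \<in> verts G" "k' < snd y" "same_string (i, k) (fst y, k')"
    "position (fst y, k') = position (i, k) + (position y - position (i, l))"
    using copy_vertex[OF assms(1-3) y(1,2) y(3)[OF assms(2) refl]] by metis
  have "position (fst y, k') \<le> position y"
    using y(3)[OF k'(1)] k'(3) assms(4) by simp
  with k'(4) neg y(3)[OF assms(2) refl] have "position (fst y, k') = position y"
    by linarith
  then have "(fst y, k') = y"
    using string_position_unique[OF k'(1) y(1)] k'(3) assms(4) y(2) by simp
  with k'(2) show False by (metis less_irrefl snd_conv)
qed

text \<open>Let A be the string through \<open>(i, k)\<close> and \<open>(j, l')\<close>, and B the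
  one through \<open>(i, l)\<close> and \<open>(j, k')\<close>. By copying, A continues from
  \<open>(i, k)\<close> at least as far as B from \<open>(i, l)\<close>, and B from
  \<open>(j, k')\<close> at least as far as A from \<open>(j, l')\<close>. With the assumed
  positions, A would continue strictly further from \<open>(j, l')\<close> than it does.\<close>

lemma no_crossed_strings:
  assumes "(i, k) \<in> verts G" "(i, l) \<in> verts G" "k < l"
    and "(j, k') \<in> verts G" "(j, l') \<in> verts G" "k' < l'"
    and "same_string (i, k) (j, l')" "same_string (i, l) (j, k')"
    and "position (j, l') < position (i, k)" "position (i, l) < position (j, k')"
  shows False
proof -
  obtain y where y: "y \<in> verts G" "same_string (i, l) y"
      "\<And>z. z \<in> verts G \<Longrightarrow> same_string (i, l) z \<Longrightarrow> position z \<le> position y"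
    using obtain_last_vertex[OF assms(2)] by metis
  obtain y' where y': "y' \<in> verts G" "same_string (j, l') y'"
      "\<And>z. z \<in> verts G \<Longrightarrow> same_string (j, l') z \<Longrightarrow> position z \<le> position y'"
    using obtain_last_vertex[OF assms(5)] by metis
  obtain m where m: "(fst y, m) \<in> verts G" "same_string (i, k) (fst y, m)"
    "position (fst y, m) = position (i, k) + (position y - position (i, l))"
    using copy_vertex[OF assms(1-3) y(1,2) y(3)[OF assms(2) refl]] by metis
  obtain m' where m': "(fst y', m') \<in> verts G" "same_string (j, k') (fst y', m')"
    "position (fst y', m') = position (j, k') + (position y' - position (j, l'))"
    using copy_vertex[OF assms(4-6) y'(1,2) y'(3)[OF assms(5) refl]] by metis
  have "position (fst y, m) \<le> position y'"
    using y'(3)[OF m(1)] m(2) assms(7) by simp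
  moreover have "position (fst y', m') \<le> position y"
    using y(3)[OF m'(1)] m'(2) assms(8) by simp
  ultimately show False
    using m(3) m'(3) assms(9,10) y(3)[OF assms(2) refl] y'(3)[OF assms(5) refl] by linarith
qed

section \<open>Echelon forms\<close>

lemma coord_rep_map_lincomb:
  assumes "a \<in> arcs Q"
  shows "coord (head Q a) (rep_map M a (lincomb (tail Q a) c)) m =
    (\<Sum>k\<in>range_of (tail Q a). c k * coord (head Q a) (rep_map M a (b (tail Q a) k)) m)"
proof -
  have *: "rep_map M a (b (tail Q a) k) \<in> rep_space M (head Q a)" if "k \<in> range_of (tail Q a)" for k
    by (rule rep_map_space[OF assms basis_in_space[OF ends_Q(1)[OF assms] that]])
  have "coord (head Q a) (rep_map M a (lincomb (tail Q a) c)) m =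
      (\<Sum>k\<in>range_of (tail Q a). coord (head Q a) (rep_scale M (c k) (rep_map M a (b (tail Q a) k))) m)"
    unfolding rep_map_lincomb[OF assms]
    by (intro coord_sum ends_Q assms subspace_scale subspace_space *)
  also have "\<dots> = (\<Sum>k\<in>range_of (tail Q a). c k * coord (head Q a) (rep_map M a (b (tail Q a) k)) m)"
    by (intro sum.cong refl coord_scale ends_Q assms *)
  finally show ?thesis .
qed

text \<open>\<open>C\<close> is a matrix whose row at \<open>(i, k)\<close> holds the coordinates of
  one spanning vector over \<open>i\<close>. Points, orbits and curves are all handled through such
  matrices over a fixed \<open>S\<close>.\<close>

definition span_family :: "('v \<times> nat) set \<Rightarrow> ('v \<times> nat \<Rightarrow> nat \<Rightarrow> complex) \<Rightarrow> 'v \<Rightarrow> 'b set" where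
  "span_family S C = (\<lambda>i\<in>verts Q. span ((\<lambda>k. lincomb i (C (i, k))) ` {k. (i, k) \<in> S}))"

text \<open>Constrains the pivot columns only. Vanishing to the left of the pivot is kept apart,
  because the chart \<open>rev_coeff\<close> at the upper end of an edge has entries there.\<close>

definition reduced :: "('v \<times> nat) set \<Rightarrow> ('v \<times> nat \<Rightarrow> nat \<Rightarrow> complex) \<Rightarrow> bool" where
  "reduced S C \<longleftrightarrow> (\<forall>i k l. (i, k) \<in> S \<longrightarrow> (i, l) \<in> S \<longrightarrow> C (i, k) l = (if l = k then 1 else 0))"

lemma reducedD: "reduced S C \<Longrightarrow> (i, k) \<in> S \<Longrightarrow> (i, l) \<in> S \<Longrightarrow> C (i, k) l = (if l = k then 1 else 0)"
  by (simp add: reduced_def)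

lemma finite_fibre: "S \<subseteq> verts G \<Longrightarrow> finite {k. (i, k) \<in> S}"
  by (rule finite_subset[of _ "range_of i"]) (auto simp: in_verts_G)

lemma sum_fibre_delta:
  assumes "S \<subseteq> verts G" "(i, l) \<in> S"
  shows "(\<Sum>k | (i, k) \<in> S. c k * (if l = k then 1 else 0 :: complex)) = c l"
proof -
  have "(\<Sum>k | (i, k) \<in> S. c k * (if l = k then 1 else 0)) = (\<Sum>k | (i, k) \<in> S. if l = k then c k else 0)"
    by (intro sum.cong) simp_all
  also have "\<dots> = c l"
    using finite_fibre[OF assms(1)] assms(2) by simp
  finally show ?thesis .
qed

text \<open>As the pivot columns form an identity matrix, the coefficients of a vector with respect
  to the rows must be its own pivot coordinates. Membership thus becomes a system of linear
  equations.\<close>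

lemma mem_span_family:
  assumes S: "S \<subseteq> verts G" and red: "reduced S C" and i: "i \<in> verts Q"
  shows "v \<in> span_family S C i \<longleftrightarrow>
    v \<in> rep_space M i \<and> (\<forall>l\<in>range_of i. coord i v l = (\<Sum>k | (i, k) \<in> S. coord i v k * C (i, k) l))"
    (is "_ \<longleftrightarrow> ?P v")
proof
  have sub: "subspace {v. ?P v}"
  proof (rule subspaceI)
    show "0 \<in> {v. ?P v}"
      using subspace_0[OF subspace_space[OF i]] by (simp add: coord_zero)
  next
    fix v w assume "v \<in> {v. ?P v}" "w \<in> {v. ?P v}"
    then have vw: "v \<in> rep_space M i" "w \<in> rep_space M i"
        "\<And>l. l \<in> range_of i \<Longrightarrow> coord i v l = (\<Sum>k | (i, k) \<in> S. coord i v k * C (i, k) l)"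
        "\<And>l. l \<in> range_of i \<Longrightarrow> coord i w l = (\<Sum>k | (i, k) \<in> S. coord i w k * C (i, k) l)"
      by simp_all
    then show "v + w \<in> {v. ?P v}"
      using subspace_add[OF subspace_space[OF i] vw(1,2)]
      by (simp add: coord_add[OF i vw(1,2)] distrib_right sum.distrib vw(3,4)[symmetric])
  next
    fix c v assume "v \<in> {v. ?P v}"
    then have v: "v \<in> rep_space M i"
        "\<And>l. l \<in> range_of i \<Longrightarrow> coord i v l = (\<Sum>k | (i, k) \<in> S. coord i v k * C (i, k) l)"
      by simp_all
    then show "rep_scale M c v \<in> {v. ?P v}"
      using subspace_scale[OF subspace_space[OF i] v(1)]
      by (simp add: coord_scale[OF i v(1)] mult.assoc sum_distrib_left[symmetric] v(2)[symmetric])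
  qed
  assume "v \<in> span_family S C i"
  then have v: "v \<in> span ((\<lambda>k. lincomb i (C (i, k))) ` {k. (i, k) \<in> S})"
    using i by (simp add: span_family_def)
  have "lincomb i (C (i, k)) \<in> {v. ?P v}" if k: "(i, k) \<in> S" for k
  proof -
    have "coord i (lincomb i (C (i, k))) l =
        (\<Sum>m | (i, m) \<in> S. coord i (lincomb i (C (i, k))) m * C (i, m) l)" if l: "l \<in> range_of i" for l
    proof -
      have "(\<Sum>m | (i, m) \<in> S. coord i (lincomb i (C (i, k))) m * C (i, m) l) =
          (\<Sum>m | (i, m) \<in> S. C (i, m) l * (if k = m then 1 else 0))"
      proof (rule sum.cong)
        fix m assume "m \<in> {m. (i, m) \<in> S}"
        then have m: "(i, m) \<in> S" "m \<in> range_of i"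
          using S by (auto simp: in_verts_G)
        show "coord i (lincomb i (C (i, k))) m * C (i, m) l = C (i, m) l * (if k = m then 1 else 0)"
          using coord_lincomb[OF i m(2)] reducedD[OF red k m(1)] by simp
      qed simp
      also have "\<dots> = C (i, k) l"
        by (rule sum_fibre_delta[OF S k])
      finally show ?thesis
        using coord_lincomb[OF i l] by simp
    qed
    then show ?thesis
      using lincomb_in_space[OF i] by simp
  qed
  then have "span ((\<lambda>k. lincomb i (C (i, k))) ` {k. (i, k) \<in> S}) \<subseteq> {v. ?P v}"
    by (intro span_minimal sub image_subsetI) simp
  with v show "?P v" by blast
next
  assume P: "?P v"
  have "v = lincomb i (\<lambda>l. \<Sum>k | (i, k) \<in> S. coord i v k * C (i, k) l)"
  proof -
    have "lincomb i (coord i v) = lincomb i (\<lambda>l. \<Sum>k | (i, k) \<in> S. coord i v k * C (i, k) l)"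
      by (rule lincomb_cong) (use P in blast)
    then show ?thesis
      using lincomb_coord[OF i P[THEN conjunct1]] by (rule trans[OF sym, rotated])
  qed
  also have "\<dots> = (\<Sum>k | (i, k) \<in> S. rep_scale M (coord i v k) (lincomb i (C (i, k))))"
    by (simp add: scale_lincomb lincomb_sum)
  also have "\<dots> \<in> span ((\<lambda>k. lincomb i (C (i, k))) ` {k. (i, k) \<in> S})"
    by (intro span_sum span_scale span_base) simp
  finally show "v \<in> span_family S C i"
    using i by (simp add: span_family_def)
qed

lemma lincomb_in_span_family:
  "i \<in> verts Q \<Longrightarrow> (i, k) \<in> S \<Longrightarrow> lincomb i (C (i, k)) \<in> span_family S C i"
  by (auto simp: span_family_def intro!: span_base)

lemma span_family_subspace: "i \<in> verts Q \<Longrightarrow> subspace (span_family S C i)"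
  by (simp add: span_family_def)

lemma span_family_space: "i \<in> verts Q \<Longrightarrow> span_family S C i \<subseteq> rep_space M i"
  unfolding span_family_def
  by (simp, intro span_minimal subspace_space image_subsetI lincomb_in_space)

text \<open>A row of one matrix lies in the span of the other, and its coefficients there are its
  pivot coordinates, a unit vector. So the entries are invariants of the point.\<close>

lemma span_family_eq_imp:
  assumes "S \<subseteq> verts G" "reduced S C" "reduced S C'" "span_family S C i = span_family S C' i"
    "(i, k) \<in> S" "l \<in> range_of i"
  shows "C (i, k) l = C' (i, k) l"
proof -
  have i: "i \<in> verts Q"
    using assms(1,5) by (auto simp: in_verts_G)
  have "lincomb i (C (i, k)) \<in> span_family S C' i"
    using lincomb_in_span_family[OF i assms(5), of C] assms(4) by simp
  from mem_span_family[OF assms(1,3) i, THEN iffD1, OF this]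
  have "coord i (lincomb i (C (i, k))) l = (\<Sum>m | (i, m) \<in> S. coord i (lincomb i (C (i, k))) m * C' (i, m) l)"
    using assms(6) by blast
  then have "C (i, k) l = (\<Sum>m | (i, m) \<in> S. coord i (lincomb i (C (i, k))) m * C' (i, m) l)"
    by (simp only: coord_lincomb[OF i assms(6)])
  also have "\<dots> = (\<Sum>m | (i, m) \<in> S. C' (i, m) l * (if k = m then 1 else 0))"
  proof (rule sum.cong)
    fix m assume "m \<in> {m. (i, m) \<in> S}"
    then have m: "(i, m) \<in> S" "m \<in> range_of i"
      using assms(1) by (auto simp: in_verts_G)
    show "coord i (lincomb i (C (i, k))) m * C' (i, m) l = C' (i, m) l * (if k = m then 1 else 0)"
      using coord_lincomb[OF i m(2)] reducedD[OF assms(2,5) m(1)] by simp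
  qed simp
  also have "\<dots> = C' (i, k) l"
    by (rule sum_fibre_delta[OF assms(1,5)])
  finally show ?thesis .
qed

lemma dim_span_family:
  assumes S: "S \<subseteq> verts G" and red: "reduced S C" and i: "i \<in> verts Q"
  shows "dim (span_family S C i) = card {k. (i, k) \<in> S}"
proof -
  let ?f = "\<lambda>k. lincomb i (C (i, k))" and ?K = "{k. (i, k) \<in> S}"
  have coord_f: "coord i (?f k) l = (if l = k then 1 else 0)" if "k \<in> ?K" "l \<in> ?K" for k l
    using coord_lincomb[OF i, of l "C (i, k)"] reducedD[OF red, of i k l] that S
    by (auto simp: in_verts_G)
  have inj: "inj_on ?f ?K"
  proof (rule inj_onI)
    fix k l assume "k \<in> ?K" "l \<in> ?K" "?f k = ?f l"
    then show "k = l"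
      using coord_f[of k k] coord_f[of l k] by (metis zero_neq_one)
  qed
  have "independent (?f ` ?K)"
  proof (rule independent_if_scalars_zero)
    show "finite (?f ` ?K)"
      using finite_fibre[OF S] by simp
    fix g x assume "(\<Sum>x\<in>?f ` ?K. rep_scale M (g x) x) = 0" and x: "x \<in> ?f ` ?K"
    then have "(\<Sum>k\<in>?K. rep_scale M (g (?f k)) (?f k)) = 0"
      by (simp only: sum.reindex[OF inj] o_def)
    then have "coord i (\<Sum>k\<in>?K. rep_scale M (g (?f k)) (?f k)) l = 0" for l
      by (simp add: coord_zero)
    moreover obtain l where l: "l \<in> ?K" "x = ?f l" using x by blast
    moreover have "coord i (\<Sum>k\<in>?K. rep_scale M (g (?f k)) (?f k)) l =
        (\<Sum>k\<in>?K. g (?f k) * (if l = k then 1 else 0))"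
    proof -
      have "coord i (\<Sum>k\<in>?K. rep_scale M (g (?f k)) (?f k)) l =
          (\<Sum>k\<in>?K. coord i (rep_scale M (g (?f k)) (?f k)) l)"
        by (intro coord_sum i subspace_scale subspace_space lincomb_in_space)
      also have "\<dots> = (\<Sum>k\<in>?K. g (?f k) * (if l = k then 1 else 0))"
        using coord_f l(1) by (intro sum.cong) (simp_all add: coord_scale[OF i lincomb_in_space[OF i]])
      finally show ?thesis .
    qed
    ultimately show "g x = 0"
      using sum_fibre_delta[OF S, of i l "\<lambda>k. g (?f k)"] by simp
  qed
  then have "dim (span (?f ` ?K)) = card (?f ` ?K)"
    by (rule dim_span_eq_card_independent)
  then show ?thesis
    using i by (simp add: span_family_def card_image[OF inj])
qed

definition dimensional :: "('v \<times> nat) set \<Rightarrow> bool" where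
  "dimensional S \<longleftrightarrow> S \<subseteq> verts G \<and> (\<forall>i\<in>verts Q. int (card {k. (i, k) \<in> S}) = e i)"

lemma dimensional_subquivers_iff:
  "S \<in> dimensional_subquivers Q G e \<longleftrightarrow> dimensional S \<and> successor_closed G S"
  by (auto simp: dimensional_subquivers_def dimensional_def successor_closed_def)

lemma span_family_in_prod:
  assumes "dimensional S" "reduced S C"
  shows "span_family S C \<in> prod_grassmannian Q M e"
proof -
  have "subspace (span_family S C i) \<and> span_family S C i \<subseteq> rep_space M i \<and> int (dim (span_family S C i)) = e i"
    if "i \<in> verts Q" for i
    using that assms span_family_subspace span_family_space dim_span_family[OF _ assms(2)]
    by (simp add: dimensional_def)
  moreover have "span_family S C i = undefined" if "i \<notin> verts Q" for i
    using that by (simp add: span_family_def)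
  ultimately show ?thesis
    unfolding prod_grassmannian_def by (intro PiE_I) simp_all
qed

lemma span_family_in_X:
  assumes "dimensional S" "reduced S C"
    and "\<And>a k. a \<in> arcs Q \<Longrightarrow> (tail Q a, k) \<in> S \<Longrightarrow>
      rep_map M a (lincomb (tail Q a) (C (tail Q a, k))) \<in> span_family S C (head Q a)"
  shows "span_family S C \<in> X"
proof -
  have "rep_map M a ` span_family S C (tail Q a) \<subseteq> span_family S C (head Q a)" if a: "a \<in> arcs Q" for a
  proof -
    let ?i = "tail Q a" and ?W = "span_family S C (head Q a)"
    have W: "subspace ?W"
      by (rule span_family_subspace[OF ends_Q(2)[OF a]])
    have zero: "rep_map M a 0 = 0"
      using rep_map_scale[OF a subspace_0[OF subspace_space[OF ends_Q(1)[OF a]]], of 0] by simp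
    have "span ((\<lambda>k. lincomb ?i (C (?i, k))) ` {k. (?i, k) \<in> S}) \<subseteq>
        {v \<in> rep_space M ?i. rep_map M a v \<in> ?W}"
    proof (rule span_minimal)
      show "subspace {v \<in> rep_space M ?i. rep_map M a v \<in> ?W}"
        using subspace_space[OF ends_Q(1)[OF a]] W
        by (auto simp: rep_map_add[OF a] rep_map_scale[OF a] zero
            intro!: subspaceI intro: subspace_0 subspace_add subspace_scale)
      show "(\<lambda>k. lincomb ?i (C (?i, k))) ` {k. (?i, k) \<in> S} \<subseteq> {v \<in> rep_space M ?i. rep_map M a v \<in> ?W}"
        using assms(3)[OF a] lincomb_in_space[OF ends_Q(1)[OF a]] by (intro image_subsetI) simp
    qed
    then show ?thesis
      using ends_Q(1)[OF a] by (auto simp: span_family_def)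
  qed
  with span_family_in_prod[OF assms(1,2)] show ?thesis
    by (simp add: quiver_grassmannian_def)
qed

lemma span_family_cong:
  assumes "\<And>i k l. (i, k) \<in> S \<Longrightarrow> l \<in> range_of i \<Longrightarrow> C (i, k) l = C' (i, k) l"
  shows "span_family S C = span_family S C'"
proof -
  have "(\<lambda>k. lincomb i (C (i, k))) ` {k. (i, k) \<in> S} = (\<lambda>k. lincomb i (C' (i, k))) ` {k. (i, k) \<in> S}" for i
    using assms by (intro image_cong lincomb_cong) simp_all
  then show ?thesis
    by (simp add: span_family_def)
qed

lemma span_family_scale:
  assumes S: "S \<subseteq> verts G" and r: "\<And>x. x \<in> S \<Longrightarrow> r x \<noteq> 0"
  shows "span_family S (\<lambda>x l. r x * C x l) = span_family S C"
proof -
  have "span ((\<lambda>k. lincomb i (\<lambda>l. r (i, k) * C (i, k) l)) ` {k. (i, k) \<in> S}) =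
      span ((\<lambda>k. lincomb i (C (i, k))) ` {k. (i, k) \<in> S})" (is "span ?A = span ?B") for i
  proof
    have "rep_scale M (r (i, k)) (lincomb i (C (i, k))) \<in> span ?B" if "(i, k) \<in> S" for k
      using that by (intro span_scale span_base imageI) simp
    then show "span ?A \<subseteq> span ?B"
      by (intro span_minimal subspace_span image_subsetI) (simp add: scale_lincomb)
    have "lincomb i (C (i, k)) = rep_scale M (inverse (r (i, k))) (lincomb i (\<lambda>l. r (i, k) * C (i, k) l))"
      if "(i, k) \<in> S" for k
      using r[OF that] by (simp add: scale_lincomb mult.assoc[symmetric])
    then have "lincomb i (C (i, k)) \<in> span ?A" if "(i, k) \<in> S" for k
      using that span_scale[OF span_base[OF imageI[of k "{k. (i, k) \<in> S}"]]] by fastforce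
    then show "span ?B \<subseteq> span ?A"
      by (intro span_minimal subspace_span image_subsetI) simp
  qed
  then show ?thesis
    by (simp add: span_family_def)
qed

abbreviation "pt \<equiv> subquiver_point Q M b"

abbreviation delta :: "'v \<times> nat \<Rightarrow> nat \<Rightarrow> complex" where
  "delta x l \<equiv> (if l = snd x then 1 else 0)"

lemma pt_eq_span_family: "S \<subseteq> verts G \<Longrightarrow> pt S = span_family S delta"
proof -
  assume S: "S \<subseteq> verts G"
  have "b i ` {k. (i, k) \<in> S} = (\<lambda>k. lincomb i (delta (i, k))) ` {k. (i, k) \<in> S}" for i
    using S by (intro image_cong) (auto simp: lincomb_delta in_verts_G)
  then show ?thesis
    by (simp add: subquiver_point_def span_family_def)
qed

lemma reduced_delta: "reduced S delta"
  by (simp add: reduced_def)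

section \<open>Pivots and the reduced echelon form of a point\<close>

definition leading :: "'v \<Rightarrow> 'b set \<Rightarrow> nat set" where
  "leading i W = {k \<in> range_of i. \<exists>w\<in>W. coord i w k = 1 \<and> (\<forall>m\<in>range_of i. m < k \<longrightarrow> coord i w m = 0)}"

text \<open>The leftmost non-zero coordinate of a non-zero vector would be a pivot after
  scaling.\<close>

lemma leading_zero:
  assumes i: "i \<in> verts Q" and W: "subspace W" "W \<subseteq> rep_space M i" and w: "w \<in> W"
    and 0: "\<And>k. k \<in> leading i W \<Longrightarrow> coord i w k = 0"
  shows "w = 0"
proof (rule ccontr)
  assume "w \<noteq> 0"
  have "\<exists>k\<in>range_of i. coord i w k \<noteq> 0"
  proof (rule ccontr)
    assume "\<not> (\<exists>k\<in>range_of i. coord i w k \<noteq> 0)"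
    then have "w = 0"
      using W w subspace_0[OF subspace_space[OF i]] by (intro coord_eqI[OF i]) (auto simp: coord_zero)
    with \<open>w \<noteq> 0\<close> show False ..
  qed
  then obtain k where k: "k \<in> range_of i \<and> coord i w k \<noteq> 0"
      "\<And>m. m < k \<Longrightarrow> \<not> (m \<in> range_of i \<and> coord i w m \<noteq> 0)"
    using exists_least_iff[of "\<lambda>k. k \<in> range_of i \<and> coord i w k \<noteq> 0"] by blast
  have wV: "w \<in> rep_space M i"
    using W w by blast
  have "rep_scale M (inverse (coord i w k)) w \<in> W"
    by (rule subspace_scale[OF W(1) w])
  moreover have "coord i (rep_scale M (inverse (coord i w k)) w) k = 1"
    using k(1) by (simp add: coord_scale[OF i wV])
  moreover have "coord i (rep_scale M (inverse (coord i w k)) w) m = 0" if "m \<in> range_of i" "m < k" for m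
    using k(2)[OF that(2)] that(1) by (simp add: coord_scale[OF i wV])
  ultimately have "k \<in> leading i W"
    using k(1) unfolding leading_def by blast
  with 0 k(1) show False by blast
qed

lemma leading_normal_form:
  assumes i: "i \<in> verts Q" and W: "subspace W" "W \<subseteq> rep_space M i" and k: "k \<in> leading i W"
  obtains u where "u \<in> W" "coord i u k = 1" "\<And>m. m \<in> range_of i \<Longrightarrow> m < k \<Longrightarrow> coord i u m = 0"
    "\<And>m. m \<in> leading i W \<Longrightarrow> m \<noteq> k \<Longrightarrow> coord i u m = 0"
proof -
  define P where "P n u \<longleftrightarrow> u \<in> W \<and> coord i u k = 1 \<and> (\<forall>m\<in>range_of i. m < k \<longrightarrow> coord i u m = 0) \<and>
      (\<forall>m\<in>leading i W. m \<noteq> k \<longrightarrow> m < n \<longrightarrow> coord i u m = 0)" for n u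
  have "\<exists>u. P n u" for n
  proof (induction n)
    case 0
    then show ?case
      using k unfolding leading_def P_def by auto
  next
    case (Suc n)
    then obtain u where "P n u" ..
    then have u: "u \<in> W" "coord i u k = 1" "\<And>m. m \<in> range_of i \<Longrightarrow> m < k \<Longrightarrow> coord i u m = 0"
      "\<And>m. m \<in> leading i W \<Longrightarrow> m \<noteq> k \<Longrightarrow> m < n \<Longrightarrow> coord i u m = 0"
      by (simp_all add: P_def)
    show ?case
    \<comment> \<open>Only a pivot column to the right of \<open>k\<close> has to be cleared, since
      the columns left of \<open>k\<close> vanish already. Subtracting a multiple of a vector with
      pivot \<open>n\<close> leaves all columns before \<open>n\<close> untouched.\<close>
    proof (cases "n \<in> leading i W \<and> n \<noteq> k \<and> k < n")
      case True
      then obtain w where w: "w \<in> W" "coord i w n = 1" "\<And>m. m \<in> range_of i \<Longrightarrow> m < n \<Longrightarrow> coord i w m = 0"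
        by (auto simp: leading_def)
      define u' where "u' = u - rep_scale M (coord i u n) w"
      have sw: "rep_scale M (coord i u n) w \<in> W"
        by (rule subspace_scale[OF W(1) w(1)])
      then have co: "coord i u' m = coord i u m - coord i u n * coord i w m" for m
      proof -
        have "u \<in> rep_space M i" "w \<in> rep_space M i" "rep_scale M (coord i u n) w \<in> rep_space M i"
          using u(1) w(1) sw W(2) by blast+
        then show ?thesis
          by (simp add: u'_def coord_diff[OF i] coord_scale[OF i])
      qed
      have rng: "m \<in> range_of i" if "m \<in> leading i W" for m
        using that by (simp add: leading_def)
      have krng: "k \<in> range_of i"
        using rng[OF k] .
      show ?thesis
        unfolding P_def
      proof (intro exI[of _ u'] conjI ballI impI)
        show "u' \<in> W"
          unfolding u'_def by (rule subspace_diff[OF W(1) u(1) sw])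
        show "coord i u' k = 1"
          using u(2) w(3)[OF krng] True by (simp add: co)
        show "coord i u' m = 0" if "m \<in> range_of i" "m < k" for m
          using u(3)[OF that] w(3)[OF that(1)] that(2) True by (simp add: co)
        show "coord i u' m = 0" if "m \<in> leading i W" "m \<noteq> k" "m < Suc n" for m
        proof (cases "m = n")
          case True
          then show ?thesis using w(2) by (simp add: co)
        next
          case False
          then show ?thesis
            using u(4)[OF that(1,2)] w(3)[OF rng[OF that(1)]] that(3) by (simp add: co)
        qed
      qed
    next
      case False
      have rng: "m \<in> range_of i" if "m \<in> leading i W" for m
        using that by (simp add: leading_def)
      have "coord i u m = 0" if "m \<in> leading i W" "m \<noteq> k" "m < Suc n" for m
        using u(3)[OF rng[OF that(1)]] u(4)[OF that(1,2)] that False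
        by (metis less_antisym linorder_neqE_nat)
      with u(1-3) have "P (Suc n) u"
        by (simp add: P_def)
      then show ?thesis ..
    qed
  qed
  \<comment> \<open>\<open>P n\<close> clears columns strictly below \<open>n\<close>, and the last
    column is \<open>rep_dim M i\<close>.\<close>
  from this[of "Suc (rep_dim M i)"] obtain u where "P (Suc (rep_dim M i)) u" ..
  then show thesis
    by (intro that[of u]) (simp_all add: P_def leading_def)
qed

definition leading_set :: "('v \<Rightarrow> 'b set) \<Rightarrow> ('v \<times> nat) set" where
  "leading_set U = (SIGMA i:verts Q. leading i (U i))"

lemma echelon_form:
  assumes U: "U \<in> prod_grassmannian Q M e"
  obtains C where "reduced (leading_set U) C" "span_family (leading_set U) C = U"
    "\<And>i k m. (i, k) \<in> leading_set U \<Longrightarrow> m \<in> range_of i \<Longrightarrow> m < k \<Longrightarrow> C (i, k) m = 0"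
    "dimensional (leading_set U)"
proof -
  have Ui: "subspace (U i)" "U i \<subseteq> rep_space M i" "int (dim (U i)) = e i" if "i \<in> verts Q" for i
    using U that by (auto simp: prod_grassmannian_def PiE_iff)
  have "\<exists>u. u \<in> U i \<and> coord i u k = 1 \<and> (\<forall>m\<in>range_of i. m < k \<longrightarrow> coord i u m = 0) \<and>
      (\<forall>m\<in>leading i (U i). m \<noteq> k \<longrightarrow> coord i u m = 0)" if "i \<in> verts Q" "k \<in> leading i (U i)" for i k
    using leading_normal_form[OF that(1) Ui(1,2)[OF that(1)] that(2)] by metis
  then obtain u where u: "\<And>i k. i \<in> verts Q \<Longrightarrow> k \<in> leading i (U i) \<Longrightarrow> u i k \<in> U i \<and> coord i (u i k) k = 1 \<and>
      (\<forall>m\<in>range_of i. m < k \<longrightarrow> coord i (u i k) m = 0) \<and>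
      (\<forall>m\<in>leading i (U i). m \<noteq> k \<longrightarrow> coord i (u i k) m = 0)"
    by metis
  define C where "C x l = coord (fst x) (u (fst x) (snd x)) l" for x l
  let ?S = "leading_set U"
  have S: "?S \<subseteq> verts G"
    by (auto simp: leading_set_def leading_def in_verts_G)
  have red: "reduced ?S C"
    unfolding reduced_def C_def leading_set_def using u by simp
  have uC: "lincomb i (C (i, k)) = u i k" if "(i, k) \<in> ?S" for i k
    using that u[of i k] Ui(2)[of i] lincomb_coord[of i "u i k"] unfolding C_def leading_set_def by auto
  have fam: "span_family ?S C = U"
  proof
    fix i
    show "span_family ?S C i = U i"
    proof (cases "i \<in> verts Q")
      case i: True
      show ?thesis
      proof
        have "(\<lambda>k. lincomb i (C (i, k))) ` {k. (i, k) \<in> ?S} \<subseteq> U i"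
          using uC u i by (intro image_subsetI) (simp add: leading_set_def)
        then show "span_family ?S C i \<subseteq> U i"
          using i Ui(1)[OF i] by (simp add: span_family_def span_minimal)
        show "U i \<subseteq> span_family ?S C i"
        proof
          fix w assume w: "w \<in> U i"
          \<comment> \<open>\<open>w'\<close> is rebuilt from the pivot coordinates of
            \<open>w\<close>; the difference lies in \<open>U i\<close> and has no pivot coordinates
            left, so \<open>leading_zero\<close> kills it.\<close>
          define w' where "w' = (\<Sum>k | (i, k) \<in> ?S. rep_scale M (coord i w k) (u i k))"
          have w': "w' \<in> span_family ?S C i"
            unfolding w'_def using lincomb_in_span_family[OF i, of _ ?S C]
            by (intro subspace_sum[OF span_family_subspace[OF i]] subspace_scale[OF span_family_subspace[OF i]])
               (metis mem_Collect_eq uC)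
          have w'U: "w' \<in> U i"
            using w' \<open>span_family ?S C i \<subseteq> U i\<close> by blast
          have "coord i w' k = coord i w k" if "(i, k) \<in> ?S" for k
          proof -
            have uV: "u i m \<in> rep_space M i" if "(i, m) \<in> ?S" for m
              using u[OF i, of m] Ui(2)[OF i] that by (auto simp: leading_set_def)
            have "coord i w' k = (\<Sum>m | (i, m) \<in> ?S. coord i (rep_scale M (coord i w m) (u i m)) k)"
              unfolding w'_def by (rule coord_sum[OF i]) (simp add: subspace_scale[OF subspace_space[OF i]] uV)
            also have "\<dots> = (\<Sum>m | (i, m) \<in> ?S. coord i w m * (if k = m then 1 else 0))"
            proof (rule sum.cong)
              fix m assume "m \<in> {m. (i, m) \<in> ?S}"
              then show "coord i (rep_scale M (coord i w m) (u i m)) k = coord i w m * (if k = m then 1 else 0)"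
                using coord_scale[OF i uV] reducedD[OF red, of i m k] that by (simp add: C_def)
            qed simp
            also have "\<dots> = coord i w k"
              by (rule sum_fibre_delta[OF S that])
            finally show ?thesis .
          qed
          then have "coord i (w - w') k = 0" if "k \<in> leading i (U i)" for k
          proof -
            have "w \<in> rep_space M i" "w' \<in> rep_space M i" "(i, k) \<in> ?S"
              using w w'U Ui(2)[OF i] that i by (auto simp: leading_set_def)
            with \<open>\<And>k. (i, k) \<in> ?S \<Longrightarrow> coord i w' k = coord i w k\<close> show ?thesis
              by (simp add: coord_diff[OF i])
          qed
          then have "w - w' = 0"
            by (intro leading_zero[OF i Ui(1,2)[OF i] subspace_diff[OF Ui(1)[OF i] w w'U]])
          with w' show "w \<in> span_family ?S C i" by simp
        qed
      qed
    next
      case False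
      have "U i = undefined"
        using U False unfolding prod_grassmannian_def by (rule PiE_arb)
      with False show ?thesis by (simp add: span_family_def)
    qed
  qed
  have dim: "dimensional ?S"
    unfolding dimensional_def
  proof (intro conjI S ballI)
    fix i assume i: "i \<in> verts Q"
    show "int (card {k. (i, k) \<in> ?S}) = e i"
      using dim_span_family[OF S red i] Ui(3)[OF i] by (simp add: fam)
  qed
  have low: "C (i, k) m = 0" if "(i, k) \<in> ?S" "m \<in> range_of i" "m < k" for i k m
    using u[of i k] that by (simp add: C_def leading_set_def)
  from that[OF red fam low dim] show thesis by blast
qed

text \<open>Apply the arrow to a vector with pivot \<open>k\<close>. By alignment every later basis
  vector is killed or sent beyond \<open>k'\<close>, so the image has its leftmost coordinate at
  \<open>k'\<close>, with value 1.\<close>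

lemma leading_set_successor_closed:
  assumes U: "U \<in> X"
  shows "successor_closed G (leading_set U)"
  unfolding successor_closed_def
proof (intro conjI ballI impI)
  show "leading_set U \<subseteq> verts G"
    by (auto simp: leading_set_def leading_def in_verts_G)
  fix x assume x: "x \<in> arcs G" "tail G x \<in> leading_set U"
  obtain i k a j k' where xe: "x = ((i, k), a, (j, k'))"
    by (metis prod_cases3 surj_pair)
  have a: "a \<in> arcs Q" "i = tail Q a" "j = head Q a" "k \<in> range_of i" "k' \<in> range_of j"
      "rep_map M a (b i k) = b j k'"
    using x(1) by (auto simp: xe in_arcs_G)
  have i: "i \<in> verts Q" and j: "j \<in> verts Q"
    using ends_Q[OF a(1)] a(2,3) by auto
  have "(i, k) \<in> leading_set U"
    using x(2) by (simp add: xe ends_G)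
  then obtain u where u: "u \<in> U i" "coord i u k = 1" "\<And>m. m \<in> range_of i \<Longrightarrow> m < k \<Longrightarrow> coord i u m = 0"
    by (auto simp: leading_set_def leading_def)
  have "U i \<subseteq> rep_space M i"
    using U i by (auto simp: quiver_grassmannian_def prod_grassmannian_def PiE_iff)
  then have ui: "u = lincomb i (coord i u)"
    using u(1) lincomb_coord[OF i] by auto
  have "coord j (rep_map M a u) m = (if m = k' then 1 else 0)" if m: "m \<in> range_of j" "m \<le> k'" for m
  proof -
    have summand: "coord i u l * coord j (rep_map M a (b i l)) m = (if l = k then if m = k' then 1 else 0 else 0)"
      if l: "l \<in> range_of i" for l
    proof -
      consider "l < k" | "l = k" | "l > k" by linarith
      then show ?thesis
      proof cases
        case 1
        with u(3)[OF l] show ?thesis by simp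
      next
        case 2
        with u(2) a(6) coord_basis[OF j a(5) m(1)] show ?thesis by simp
      next
        case 3
        from a(1) l[unfolded a(2)] show ?thesis
        proof (cases rule: rep_map_basis_cases)
          case 1
          with 3 show ?thesis by (simp add: a(2,3) coord_zero)
        next
          case (2 l')
          obtain k'' where k'': "((i, k), a, (j, k'')) \<in> arcs G" "k'' < l'"
            using copy_arc[OF 2(1), of k] 3 i a(2-4) by (auto simp: in_verts_G)
          then have "((i, k), a, (j, k'')) = x"
            by (intro arc_tail_unique x(1)) (simp_all add: xe ends_G)
          then have "m \<noteq> l'"
            using k''(2) m(2) by (simp add: xe)
          with 3 2 coord_basis[OF j, of l' m] m(1) show ?thesis
            by (simp add: a(2,3))
        qed
      qed
    qed
    have "coord j (rep_map M a u) m = (\<Sum>l\<in>range_of i. coord i u l * coord j (rep_map M a (b i l)) m)"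
      by (subst ui) (simp add: a(2,3) coord_rep_map_lincomb[OF a(1)])
    also have "\<dots> = (\<Sum>l\<in>range_of i. if l = k then if m = k' then 1 else 0 else 0)"
      by (rule sum.cong) (simp_all only: summand)
    also have "\<dots> = (if m = k' then 1 else 0)"
      using a(4) by simp
    finally show ?thesis .
  qed
  moreover have "rep_map M a u \<in> U j"
    using U u(1) a(1-3) by (auto simp: quiver_grassmannian_def)
  ultimately have "k' \<in> leading j (U j)"
    using a(5) unfolding leading_def by (intro CollectI conjI bexI[of _ "rep_map M a u"]) simp_all
  then show "head G x \<in> leading_set U"
    using j by (simp add: xe ends_G leading_set_def)
qed

end

section \<open>Torus action and fixed points\<close>

locale torus_representation = straight_representation Q M e b
  for Q :: "('v, 'e) pre_digraph" and M :: "('v, 'e, 'b::ab_group_add) quiver_rep" and e :: "'v \<Rightarrow> int"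
    and b :: "'v \<Rightarrow> nat \<Rightarrow> 'b" +
  fixes \<eta> :: "complex \<Rightarrow> ('v, 'e) torus_index \<Rightarrow> complex" and wt :: "'v \<times> nat \<Rightarrow> int"
  assumes \<eta>_torus: "z \<noteq> 0 \<Longrightarrow> \<eta> z \<in> torus (rep_torus_index Q M b)"
    and \<eta>_wt: "z \<noteq> 0 \<Longrightarrow> (i, k) \<in> verts (coeff_quiver Q M b) \<Longrightarrow>
      vector_action Q M b (\<eta> z) i (b i k) = rep_scale M (z powi wt (i, k)) (b i k)"
    and wt_less: "(i, k) \<in> verts (coeff_quiver Q M b) \<Longrightarrow> (i, l) \<in> verts (coeff_quiver Q M b) \<Longrightarrow>
      k < l \<Longrightarrow> wt (i, k) < wt (i, l)"
begin

abbreviation "I \<equiv> rep_torus_index Q M b"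
abbreviation "scal \<equiv> scaling_factor G"
abbreviation "act \<equiv> point_action Q M b"

lemma Inl_in_I: "x \<in> verts G \<Longrightarrow> Inl (component_of G x) \<in> I"
  using component_of_in_components[of x] by (simp add: rep_torus_index_def InlI)

lemma underlying_arc_supp: "a \<in> arcs G \<Longrightarrow> underlying_arc a \<in> supp_arcs Q M"
proof -
  assume "a \<in> arcs G"
  moreover obtain x c y where a: "a = (x, c, y)" using prod_cases3 by blast
  ultimately have c: "c \<in> arcs Q" "snd x \<in> range_of (tail Q c)" "snd y \<in> range_of (head Q c)"
      "rep_map M c (b (tail Q c) (snd x)) = b (head Q c) (snd y)"
    by (auto simp: in_arcs_G)
  then have "rep_map M c (b (tail Q c) (snd x)) \<noteq> 0"
    using basis_nonzero[OF ends_Q(2)[OF c(1)] c(3)] by simp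
  then show ?thesis
    using c(1) basis_in_space[OF ends_Q(1)[OF c(1)] c(2)] by (auto simp: supp_arcs_def a underlying_arc_def)
qed

lemma Inr_in_I: "a \<in> arcs G \<Longrightarrow> Inr (underlying_arc a) \<in> I"
  using underlying_arc_supp[of a] by (simp add: rep_torus_index_def InrI)

lemma torus_nonzero: "t \<in> torus I \<Longrightarrow> j \<in> I \<Longrightarrow> t j \<noteq> 0"
  by (auto simp: torus_def PiE_iff)

lemma scal_nonzero:
  assumes "t \<in> torus I" "x \<in> verts G"
  shows "scal t x \<noteq> 0"
proof -
  have "\<forall>y\<in>set (preceding_segment G x). t (Inr (underlying_arc y)) \<noteq> 0"
    using preceding_segment_arcs[OF assms(2)] torus_nonzero[OF assms(1) Inr_in_I] by blast
  then have "(\<Prod>y\<leftarrow>preceding_segment G x. t (Inr (underlying_arc y))) \<noteq> 0"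
    by (auto simp: prod_list_zero_iff)
  then show ?thesis
    using torus_nonzero[OF assms(1) Inl_in_I[OF assms(2)]] by (simp add: scaling_factor_def)
qed

lemma scal_head:
  "a \<in> arcs G \<Longrightarrow> scal t (head G a) = scal t (tail G a) * t (Inr (underlying_arc a))"
  by (simp add: scaling_factor_def preceding_segment_head component_of_arc)

lemma vector_action_eq: "vector_action Q M b t i v = lincomb i (\<lambda>l. coord i v l * scal t (i, l))"
  by (simp add: vector_action_def lincomb_def)

lemma vector_action_add:
  "i \<in> verts Q \<Longrightarrow> v \<in> rep_space M i \<Longrightarrow> w \<in> rep_space M i \<Longrightarrow>
    vector_action Q M b t i (v + w) = vector_action Q M b t i v + vector_action Q M b t i w"
  by (simp add: vector_action_eq lincomb_add coord_add distrib_right)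

lemma vector_action_scale:
  "i \<in> verts Q \<Longrightarrow> v \<in> rep_space M i \<Longrightarrow>
    vector_action Q M b t i (rep_scale M c v) = rep_scale M c (vector_action Q M b t i v)"
  by (simp add: vector_action_eq scale_lincomb coord_scale mult.assoc)

lemma vector_action_zero: "vector_action Q M b t i 0 = 0"
  by (simp add: vector_action_def coord_zero)

lemma vector_action_lincomb:
  "i \<in> verts Q \<Longrightarrow> vector_action Q M b t i (lincomb i c) = lincomb i (\<lambda>l. c l * scal t (i, l))"
  unfolding vector_action_eq by (rule lincomb_cong) (simp add: coord_lincomb)

lemma vector_action_span:
  assumes i: "i \<in> verts Q" and A: "A \<subseteq> rep_space M i"
  shows "vector_action Q M b t i ` span A = span (vector_action Q M b t i ` A)"
proof -
  let ?f = "vector_action Q M b t i"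
  have sA: "span A \<subseteq> rep_space M i"
    by (rule span_minimal[OF A subspace_space[OF i]])
  show ?thesis
  proof
    have "subspace {v \<in> rep_space M i. ?f v \<in> span (?f ` A)}"
      using subspace_space[OF i]
      by (auto simp: vector_action_add[OF i] vector_action_scale[OF i] vector_action_zero span_zero
          intro!: subspaceI intro: subspace_0 subspace_add subspace_scale span_add span_scale)
    then have "span A \<subseteq> {v \<in> rep_space M i. ?f v \<in> span (?f ` A)}"
      using A by (intro span_minimal) (auto intro: span_base)
    then show "?f ` span A \<subseteq> span (?f ` A)" by blast
    have "subspace (?f ` span A)"
    proof (rule subspaceI)
      show "0 \<in> ?f ` span A"
        using span_zero[of A] vector_action_zero[of t i] by (metis image_eqI)
    next
      fix v w assume "v \<in> ?f ` span A" "w \<in> ?f ` span A"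
      then obtain v' w' where "v = ?f v'" "v' \<in> span A" "w = ?f w'" "w' \<in> span A" by blast
      then show "v + w \<in> ?f ` span A"
        using vector_action_add[OF i, of v' w'] sA span_add[of v' A w'] by (metis image_eqI subsetD)
    next
      fix c v assume "v \<in> ?f ` span A"
      then obtain v' where "v = ?f v'" "v' \<in> span A" by blast
      then show "rep_scale M c v \<in> ?f ` span A"
        using vector_action_scale[OF i, of v' t c] sA span_scale[of v' A c] by (metis image_eqI subsetD)
    qed
    then show "span (?f ` A) \<subseteq> ?f ` span A"
      by (intro span_minimal image_mono) (auto intro: span_base)
  qed
qed

lemma act_span_family:
  "act t (span_family S C) = span_family S (\<lambda>x l. C x l * scal t (fst x, l))"
proof
  fix i
  show "act t (span_family S C) i = span_family S (\<lambda>x l. C x l * scal t (fst x, l)) i"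
  proof (cases "i \<in> verts Q")
    case i: True
    have "vector_action Q M b t i ` span ((\<lambda>k. lincomb i (C (i, k))) ` {k. (i, k) \<in> S}) =
        span (vector_action Q M b t i ` (\<lambda>k. lincomb i (C (i, k))) ` {k. (i, k) \<in> S})"
      by (rule vector_action_span[OF i]) (auto simp: lincomb_in_space[OF i])
    also have "vector_action Q M b t i ` (\<lambda>k. lincomb i (C (i, k))) ` {k. (i, k) \<in> S} =
        (\<lambda>k. lincomb i (\<lambda>l. C (i, k) l * scal t (i, l))) ` {k. (i, k) \<in> S}"
      by (simp add: image_image vector_action_lincomb[OF i])
    finally show ?thesis
      using i by (simp add: point_action_def span_family_def)
  qed (simp add: point_action_def span_family_def)
qed

text \<open>Dividing each row by the factor of its pivot restores the 1 there, so a translated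
  matrix is again reduced and can be compared with the original entry by entry.\<close>

definition translate :: "(('v, 'e) torus_index \<Rightarrow> complex) \<Rightarrow> ('v \<times> nat \<Rightarrow> nat \<Rightarrow> complex) \<Rightarrow>
    'v \<times> nat \<Rightarrow> nat \<Rightarrow> complex" where
  "translate t C x l = C x l * scal t (fst x, l) / scal t x"

lemma act_span_family_translate:
  assumes "t \<in> torus I" "S \<subseteq> verts G"
  shows "act t (span_family S C) = span_family S (translate t C)"
proof -
  have "span_family S (translate t C) = span_family S (\<lambda>x l. inverse (scal t x) * (C x l * scal t (fst x, l)))"
    by (simp add: translate_def[abs_def] field_simps)
  also have "\<dots> = span_family S (\<lambda>x l. C x l * scal t (fst x, l))"
    by (rule span_family_scale[OF assms(2)]) (use scal_nonzero[OF assms(1)] assms(2) in auto)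
  finally show ?thesis
    by (simp add: act_span_family)
qed

lemma reduced_translate:
  assumes "t \<in> torus I" "S \<subseteq> verts G" "reduced S C"
  shows "reduced S (translate t C)"
  unfolding reduced_def translate_def
proof (intro allI impI)
  fix i k l assume kl: "(i, k) \<in> S" "(i, l) \<in> S"
  show "C (i, k) l * scal t (fst (i, k), l) / scal t (i, k) = (if l = k then 1 else 0)"
    using reducedD[OF assms(3) kl] scal_nonzero[OF assms(1), of "(i, k)"] assms(2) kl by auto
qed

lemma X_reduced:
  assumes "U \<in> X"
  obtains S C where "dimensional S" "successor_closed G S" "S \<subseteq> verts G" "reduced S C" "U = span_family S C"
    "\<And>i k m. (i, k) \<in> S \<Longrightarrow> m \<in> range_of i \<Longrightarrow> m < k \<Longrightarrow> C (i, k) m = 0"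
proof -
  have "U \<in> prod_grassmannian Q M e"
    using assms by (simp add: quiver_grassmannian_def)
  from echelon_form[OF this] obtain C where "reduced (leading_set U) C" "span_family (leading_set U) C = U"
    "\<And>i k m. (i, k) \<in> leading_set U \<Longrightarrow> m \<in> range_of i \<Longrightarrow> m < k \<Longrightarrow> C (i, k) m = 0"
    "dimensional (leading_set U)" by metis
  with leading_set_successor_closed[OF assms] that show thesis
    by (metis dimensional_def)
qed

lemma rep_map_vector_action:
  assumes a: "a \<in> arcs Q" and t: "t \<in> torus I" and v: "v \<in> rep_space M (tail Q a)"
  obtains c where "rep_map M a (vector_action Q M b t (tail Q a) v) =
    rep_scale M c (vector_action Q M b t (head Q a) (rep_map M a v))"
proof -
  let ?i = "tail Q a" and ?j = "head Q a"
  have i: "?i \<in> verts Q" and j: "?j \<in> verts Q"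
    using ends_Q[OF a] by auto
  \<comment> \<open>The arrow map commutes with the action up to this scalar. If \<open>a\<close> is
    outside the support, \<open>t (Inr a)\<close> is no coordinate of the torus, but then all images
    vanish and the value does not matter.\<close>
  define c where "c = inverse (t (Inr a))"
  have Mb: "rep_map M a (b ?i k) \<in> rep_space M ?j" if "k \<in> range_of ?i" for k
    by (rule rep_map_space[OF a basis_in_space[OF i that]])
  have summand: "rep_scale M (coord ?i v k * scal t (?i, k)) (rep_map M a (b ?i k)) =
      rep_scale M (c * coord ?i v k) (vector_action Q M b t ?j (rep_map M a (b ?i k)))"
    if k: "k \<in> range_of ?i" for k
    using a k
  proof (cases rule: rep_map_basis_cases)
    case 1
    then show ?thesis by (simp add: vector_action_zero)
  next
    case (2 l)
    have "t (Inr a) \<noteq> 0"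
      using torus_nonzero[OF t Inr_in_I[OF 2(1)]] by (simp add: underlying_arc_def)
    have "vector_action Q M b t ?j (b ?j l) = rep_scale M (scal t (?j, l)) (b ?j l)"
      using vector_action_lincomb[OF j, of t "\<lambda>m. if m = l then 1 else 0"]
        lincomb_cong[of ?j "\<lambda>m. (if m = l then 1 else 0) * scal t (?j, m)" "\<lambda>m. scal t (?j, l) * (if m = l then 1 else 0)"]
      by (simp add: lincomb_delta[OF 2(2)] flip: scale_lincomb)
    moreover have "scal t (?j, l) = scal t (?i, k) * t (Inr a)"
      using scal_head[OF 2(1), of t] by (simp add: ends_G underlying_arc_def)
    ultimately show ?thesis
      using \<open>t (Inr a) \<noteq> 0\<close> by (simp add: 2(3) c_def)
  qed
  have "rep_map M a (vector_action Q M b t ?i v) =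
      (\<Sum>k\<in>range_of ?i. rep_scale M (coord ?i v k * scal t (?i, k)) (rep_map M a (b ?i k)))"
    by (simp add: vector_action_eq rep_map_lincomb[OF a])
  also have "\<dots> = (\<Sum>k\<in>range_of ?i. rep_scale M (c * coord ?i v k) (vector_action Q M b t ?j (rep_map M a (b ?i k))))"
    by (rule sum.cong) (simp_all only: summand)
  also have "\<dots> = rep_scale M c (\<Sum>k\<in>range_of ?i. rep_scale M (coord ?i v k) (vector_action Q M b t ?j (rep_map M a (b ?i k))))"
    by (simp add: scale_sum_right)
  also have "(\<Sum>k\<in>A. rep_scale M (coord ?i v k) (vector_action Q M b t ?j (rep_map M a (b ?i k)))) =
      vector_action Q M b t ?j (\<Sum>k\<in>A. rep_scale M (coord ?i v k) (rep_map M a (b ?i k)))"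
    if "A \<subseteq> range_of ?i" for A
  proof -
    have "finite A" using that finite_subset by blast
    then show ?thesis
      using that
    proof induction
      case (insert x A)
      have "rep_scale M (coord ?i v x) (rep_map M a (b ?i x)) \<in> rep_space M ?j"
        using insert.prems by (intro subspace_scale[OF subspace_space[OF j]] Mb) simp
      moreover have "(\<Sum>k\<in>A. rep_scale M (coord ?i v k) (rep_map M a (b ?i k))) \<in> rep_space M ?j"
        using insert.prems by (intro subspace_sum[OF subspace_space[OF j]] subspace_scale[OF subspace_space[OF j]] Mb) auto
      ultimately show ?case
        using insert Mb by (simp add: vector_action_add[OF j] vector_action_scale[OF j])
    qed (simp add: vector_action_zero)
  qed
  finally have "rep_map M a (vector_action Q M b t ?i v) = rep_scale M c (vector_action Q M b t ?j
      (\<Sum>k\<in>range_of ?i. rep_scale M (coord ?i v k) (rep_map M a (b ?i k))))" by simp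
  also have "(\<Sum>k\<in>range_of ?i. rep_scale M (coord ?i v k) (rep_map M a (b ?i k))) = rep_map M a v"
    using rep_map_lincomb[OF a, of "coord ?i v"] lincomb_coord[OF i v] by simp
  finally show thesis by (rule that)
qed

lemma act_in_X:
  assumes U: "U \<in> X" and t: "t \<in> torus I"
  shows "act t U \<in> X"
proof -
  obtain S C where SC: "dimensional S" "S \<subseteq> verts G" "reduced S C" "U = span_family S C"
    using X_reduced[OF U] by metis
  have "act t U \<in> prod_grassmannian Q M e"
    unfolding SC(4) act_span_family_translate[OF t SC(2)]
    by (rule span_family_in_prod[OF SC(1) reduced_translate[OF t SC(2,3)]])
  moreover have "rep_map M a ` act t U (tail Q a) \<subseteq> act t U (head Q a)" if a: "a \<in> arcs Q" for a
  proof
    fix w assume "w \<in> rep_map M a ` act t U (tail Q a)"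
    then obtain v where v: "v \<in> U (tail Q a)" "w = rep_map M a (vector_action Q M b t (tail Q a) v)"
      using ends_Q(1)[OF a] by (auto simp: point_action_def)
    have "v \<in> rep_space M (tail Q a)" "subspace (U (head Q a))" "U (head Q a) \<subseteq> rep_space M (head Q a)"
      using v(1) span_family_space[OF ends_Q(1)[OF a]] span_family_space[OF ends_Q(2)[OF a]]
        span_family_subspace[OF ends_Q(2)[OF a]] SC(4) by auto
    moreover obtain c where "w = rep_scale M c (vector_action Q M b t (head Q a) (rep_map M a v))"
      using rep_map_vector_action[OF a t calculation(1)] v(2) by metis
    moreover have "rep_map M a v \<in> U (head Q a)"
      using U v(1) a by (auto simp: quiver_grassmannian_def)
    ultimately have "w = vector_action Q M b t (head Q a) (rep_scale M c (rep_map M a v))"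
        "rep_scale M c (rep_map M a v) \<in> U (head Q a)"
      using vector_action_scale[OF ends_Q(2)[OF a]] by (auto intro: subspace_scale)
    then show "w \<in> act t U (head Q a)"
      using ends_Q(2)[OF a] by (simp add: point_action_def)
  qed
  ultimately show ?thesis
    by (simp add: quiver_grassmannian_def)
qed

lemma scal_\<eta>:
  assumes "z \<noteq> 0" "(i, k) \<in> verts G"
  shows "scal (\<eta> z) (i, k) = z powi wt (i, k)"
proof -
  have i: "i \<in> verts Q" and k: "k \<in> range_of i"
    using assms(2) by (auto simp: in_verts_G)
  have "coord i (vector_action Q M b (\<eta> z) i (b i k)) k = scal (\<eta> z) (i, k)"
    by (simp only: vector_action_eq coord_lincomb[OF i k]) (simp add: coord_basis[OF i k k])
  moreover have "coord i (vector_action Q M b (\<eta> z) i (b i k)) k = z powi wt (i, k)"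
    using \<eta>_wt[OF assms] coord_scale[OF i basis_in_space[OF i k]] coord_basis[OF i k k] by simp
  ultimately show ?thesis by simp
qed

text \<open>The cocharacter at 2 gives powers of 2 with different exponents, as \<open>wt\<close> is
  strictly monotone over each vertex of Q; taking norms makes them comparable as reals.\<close>

lemma scal_distinct:
  assumes "(i, k) \<in> verts G" "(i, l) \<in> verts G" "k \<noteq> l"
  obtains t where "t \<in> torus I" "scal t (i, k) \<noteq> scal t (i, l)"
proof -
  have "wt (i, k) < wt (i, l) \<or> wt (i, l) < wt (i, k)"
    using wt_less[OF assms(1,2)] wt_less[OF assms(2,1)] assms(3) by (metis linorder_neqE_nat)
  then have "(2 :: real) powi wt (i, k) \<noteq> 2 powi wt (i, l)"
    using power_int_strict_increasing[of _ _ "2 :: real"] by (metis less_irrefl one_less_numeral_iff semiring_norm(76))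
  then have "norm ((2 :: complex) powi wt (i, k)) \<noteq> norm ((2 :: complex) powi wt (i, l))"
    by (simp add: norm_power_int)
  then have "(2 :: complex) powi wt (i, k) \<noteq> 2 powi wt (i, l)"
    by (rule contrapos_nn) (rule arg_cong)
  with scal_\<eta>[of 2] assms(1,2) \<eta>_torus[of 2] that[of "\<eta> 2"] show thesis by simp
qed

lemma pt_in_X:
  assumes "S \<in> dimensional_subquivers Q G e"
  shows "pt S \<in> X"
proof -
  have S: "dimensional S" "successor_closed G S" "S \<subseteq> verts G"
    using assms by (auto simp: dimensional_subquivers_iff dimensional_def)
  show ?thesis
    unfolding pt_eq_span_family[OF S(3)]
  proof (rule span_family_in_X[OF S(1) reduced_delta])
    fix a k assume a: "a \<in> arcs Q" and k: "(tail Q a, k) \<in> S"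
    then have kr: "k \<in> range_of (tail Q a)"
      using S(3) by (auto simp: in_verts_G)
    have del: "lincomb i (delta (i, m)) = b i m" if "m \<in> range_of i" for i m
      using lincomb_delta[OF that] by simp
    from a kr have "rep_map M a (b (tail Q a) k) \<in> span_family S delta (head Q a)"
    proof (cases rule: rep_map_basis_cases)
      case 1
      then show ?thesis
        using subspace_0[OF span_family_subspace[OF ends_Q(2)[OF a]]] by simp
    next
      case (2 l)
      then have "(head Q a, l) \<in> S"
        using S(2) k by (force simp: successor_closed_def ends_G)
      then show ?thesis
        using lincomb_in_span_family[OF ends_Q(2)[OF a], of l S delta] del[OF 2(2)] 2(3) by simp
    qed
    then show "rep_map M a (lincomb (tail Q a) (delta (tail Q a, k))) \<in> span_family S delta (head Q a)"
      by (simp only: del[OF kr])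
  qed
qed

lemma basis_in_pt:
  assumes "S \<subseteq> verts G" "(i, k) \<in> verts G"
  shows "b i k \<in> pt S i \<longleftrightarrow> (i, k) \<in> S"
proof
  have i: "i \<in> verts Q" and k: "k \<in> range_of i"
    using assms(2) by (auto simp: in_verts_G)
  show "b i k \<in> pt S i" if "(i, k) \<in> S"
    using that i by (auto simp: subquiver_point_def intro!: span_base)
  assume "b i k \<in> pt S i"
  then have "b i k \<in> span_family S delta i"
    by (simp add: pt_eq_span_family[OF assms(1)])
  then have "coord i (b i k) k = (\<Sum>m | (i, m) \<in> S. coord i (b i k) m * (if k = m then 1 else 0))"
    using mem_span_family[OF assms(1) reduced_delta i, THEN iffD1, THEN conjunct2, rule_format, OF _ k] by simp
  then have "(\<Sum>m | (i, m) \<in> S. coord i (b i k) m * (if k = m then 1 else 0)) \<noteq> 0"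
    using coord_basis[OF i k k] by simp
  then obtain m where "m \<in> {m. (i, m) \<in> S}" "coord i (b i k) m * (if k = m then 1 else 0) \<noteq> 0"
    by (rule sum.not_neutral_contains_not_neutral)
  then have "(i, m) \<in> S" "k = m"
    by (simp_all split: if_splits)
  then show "(i, k) \<in> S" by simp
qed

lemma pt_inj:
  assumes "S \<subseteq> verts G" "S' \<subseteq> verts G" "pt S = pt S'"
  shows "S = S'"
proof (rule Set.set_eqI)
  fix x :: "'v \<times> nat"
  obtain i k where x: "x = (i, k)" by (cases x)
  show "x \<in> S \<longleftrightarrow> x \<in> S'"
  proof (cases "(i, k) \<in> verts G")
    case True
    then show ?thesis
      unfolding x using basis_in_pt[OF assms(1)] basis_in_pt[OF assms(2)] assms(3) by simp
  qed (use x assms(1,2) in auto)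
qed

text \<open>Uniqueness of the reduced form turns invariance of the point into invariance of every
  entry; off the diagonal an entry is multiplied by a quotient of two different characters and must
  vanish.\<close>

lemma fixed_span_family:
  assumes S: "S \<subseteq> verts G" and red: "reduced S C"
    and fixed: "\<And>t. t \<in> torus I \<Longrightarrow> act t (span_family S C) = span_family S C"
  shows "span_family S C = pt S"
  unfolding pt_eq_span_family[OF S]
proof (rule span_family_cong)
  fix i k l assume k: "(i, k) \<in> S" and l: "l \<in> range_of i"
  have kG: "(i, k) \<in> verts G" and lG: "(i, l) \<in> verts G"
    using S k l by (auto simp: in_verts_G)
  show "C (i, k) l = delta (i, k) l"
  proof (cases "l = k")
    case True
    then show ?thesis using reducedD[OF red k k] by simp
  next
    case False
    then obtain t where t: "t \<in> torus I" "scal t (i, k) \<noteq> scal t (i, l)"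
      using scal_distinct[OF kG lG] by metis
    have "span_family S (translate t C) i = span_family S C i"
      using fixed[OF t(1)] act_span_family_translate[OF t(1) S] by simp
    then have "translate t C (i, k) l = C (i, k) l"
      by (rule span_family_eq_imp[OF S reduced_translate[OF t(1) S red] red _ k l])
    then have "C (i, k) l * scal t (i, l) = C (i, k) l * scal t (i, k)"
      using scal_nonzero[OF t(1) kG] by (simp add: translate_def field_simps)
    with t(2) have "C (i, k) l = 0" by auto
    with False show ?thesis by simp
  qed
qed

lemma fixed_points_eq: "fixed_points (torus I) act X = pt ` dimensional_subquivers Q G e"
proof
  show "pt ` dimensional_subquivers Q G e \<subseteq> fixed_points (torus I) act X"
  proof
    fix U assume "U \<in> pt ` dimensional_subquivers Q G e"
    then obtain S where S: "S \<in> dimensional_subquivers Q G e" "U = pt S" by blast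
    then have SG: "S \<subseteq> verts G"
      by (auto simp: dimensional_subquivers_iff dimensional_def)
    have "act t U = U" if t: "t \<in> torus I" for t
      unfolding S(2) pt_eq_span_family[OF SG] act_span_family_translate[OF t SG]
    proof (rule span_family_cong)
      fix i k l assume "(i, k) \<in> S"
      then show "translate t delta (i, k) l = delta (i, k) l"
        using scal_nonzero[OF t, of "(i, k)"] SG by (auto simp: translate_def)
    qed
    then show "U \<in> fixed_points (torus I) act X"
      using pt_in_X[OF S(1)] S(2) by (simp add: fixed_points_def)
  qed
  show "fixed_points (torus I) act X \<subseteq> pt ` dimensional_subquivers Q G e"
  proof
    fix U assume "U \<in> fixed_points (torus I) act X"
    then have U: "U \<in> X" "\<And>t. t \<in> torus I \<Longrightarrow> act t U = U"
      by (auto simp: fixed_points_def)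
    obtain S C where SC: "dimensional S" "successor_closed G S" "S \<subseteq> verts G" "reduced S C" "U = span_family S C"
      using X_reduced[OF U(1)] by metis
    have "U = pt S"
      using fixed_span_family[OF SC(3,4)] U(2) SC(5) by simp
    then show "U \<in> pt ` dimensional_subquivers Q G e"
      using SC(1,2) by (auto simp: dimensional_subquivers_iff)
  qed
qed

text \<open>The enumeration \<open>h\<close> of the pivots depends on \<open>S\<close> alone, so a
  curve of matrices over a fixed \<open>S\<close> lifts entry by entry to a curve of frames.\<close>

lemma frame_of_family:
  assumes "dimensional S"
  obtains h where "\<And>i m. (i, m) \<in> frame_index Q e \<Longrightarrow> (i, h i m) \<in> S"
    "\<And>C. frame_point Q M e (\<lambda>(i, m)\<in>frame_index Q e. lincomb i (C (i, h i m))) = span_family S C"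
proof -
  have "\<exists>h. bij_betw h {1..nat (e i)} {k. (i, k) \<in> S}" if i: "i \<in> verts Q" for i
  proof -
    have "int (card {k. (i, k) \<in> S}) = e i" "finite {k. (i, k) \<in> S}"
      using assms i finite_fibre by (auto simp: dimensional_def)
    then show ?thesis
      using ex_bij_betw_nat_finite_1[of "{k. (i, k) \<in> S}"] by (metis nat_int)
  qed
  then obtain h where h: "\<And>i. i \<in> verts Q \<Longrightarrow> bij_betw (h i) {1..nat (e i)} {k. (i, k) \<in> S}"
    by metis
  have "frame_point Q M e (\<lambda>(i, m)\<in>frame_index Q e. lincomb i (C (i, h i m))) = span_family S C" for C
  proof
    fix i
    show "frame_point Q M e (\<lambda>(i, m)\<in>frame_index Q e. lincomb i (C (i, h i m))) i = span_family S C i"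
    proof (cases "i \<in> verts Q")
      case True
      have "(\<lambda>m. (\<lambda>(i, m)\<in>frame_index Q e. lincomb i (C (i, h i m))) (i, m)) ` {1..nat (e i)} =
          (\<lambda>m. lincomb i (C (i, h i m))) ` {1..nat (e i)}"
        using True by (intro image_cong) (simp_all add: frame_index_def)
      also have "\<dots> = (\<lambda>k. lincomb i (C (i, k))) ` h i ` {1..nat (e i)}"
        by (simp add: image_image)
      also have "h i ` {1..nat (e i)} = {k. (i, k) \<in> S}"
        using h[OF True] by (simp add: bij_betw_def)
      finally show ?thesis
        using True by (simp add: frame_point_def span_family_def)
    qed (simp add: frame_point_def span_family_def)
  qed
  moreover have "(i, h i m) \<in> S" if "(i, m) \<in> frame_index Q e" for i m
    using that h[of i] bij_betw_apply[of "h i"] by (fastforce simp: frame_index_def)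
  ultimately show thesis
    using that by blast
qed

lemma linear_lincomb:
  assumes "Vector_Spaces.linear (rep_scale M) (*) \<phi>"
  shows "\<phi> (lincomb i c) = (\<Sum>l\<in>range_of i. c l * \<phi> (b i l))"
proof -
  interpret phi: Vector_Spaces.linear "rep_scale M" "(*)" \<phi> by (rule assms)
  show ?thesis
    by (simp add: lincomb_def phi.sum phi.scale)
qed

lemma irreducible_curve_family:
  assumes D: "infinite D" and S: "dimensional S"
    and poly: "\<And>i k l. (i, k) \<in> S \<Longrightarrow> l \<in> range_of i \<Longrightarrow> \<exists>q. \<forall>z\<in>D. C z (i, k) l = poly q z"
    and X: "\<And>z. z \<in> D \<Longrightarrow> span_family S (C z) \<in> X"
  shows "irreducible_curve Zar D (\<lambda>z. span_family S (C z))"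
proof -
  obtain h where h: "\<And>i m. (i, m) \<in> frame_index Q e \<Longrightarrow> (i, h i m) \<in> S"
    "\<And>C. frame_point Q M e (\<lambda>(i, m)\<in>frame_index Q e. lincomb i (C (i, h i m))) = span_family S C"
    by (rule frame_of_family[OF S]) (rule that)
  define F where "F z = (\<lambda>(i, m)\<in>frame_index Q e. lincomb i (C z (i, h i m)))" for z
  have pt: "frame_point Q M e (F z) = span_family S (C z)" for z
    unfolding F_def by (rule h(2))
  have "irreducible_curve Zar D (\<lambda>z. frame_point Q M e (F z))"
  proof (rule irreducible_curve_frames[OF D])
    fix z assume "z \<in> D"
    then show "frame_point Q M e (F z) \<in> X"
      unfolding pt by (rule X)
    then show "F z \<in> frames Q M e"
      by (simp add: frames_def quiver_grassmannian_def F_def)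
  next
    fix j \<phi> assume j: "j \<in> frame_index Q e" and lin: "Vector_Spaces.linear (rep_scale M) (*) \<phi>"
    obtain i m where im: "j = (i, m)" by (cases j)
    have "\<forall>l\<in>range_of i. \<exists>q. \<forall>z\<in>D. C z (i, h i m) l = poly q z"
      using poly[OF h(1)[OF j[unfolded im]]] by simp
    then obtain q where q: "\<forall>l\<in>range_of i. \<forall>z\<in>D. C z (i, h i m) l = poly (q l) z"
      by (metis (no_types))
    have "\<phi> (F z j) = poly (\<Sum>l\<in>range_of i. Polynomial.smult (\<phi> (b i l)) (q l)) z" if "z \<in> D" for z
    proof -
      have "\<phi> (F z j) = (\<Sum>l\<in>range_of i. C z (i, h i m) l * \<phi> (b i l))"
        using j by (simp add: F_def im linear_lincomb[OF lin])
      also have "\<dots> = (\<Sum>l\<in>range_of i. poly (Polynomial.smult (\<phi> (b i l)) (q l)) z)"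
        using q that by (intro sum.cong) simp_all
      finally show ?thesis by (simp only: poly_sum)
    qed
    then show "\<exists>q. \<forall>z\<in>D. \<phi> (F z j) = poly q z" by blast
  qed
  then show ?thesis
    by (simp only: pt)
qed

lemma limitin_family:
  assumes S: "dimensional S"
    and lim: "\<And>i k l. (i, k) \<in> S \<Longrightarrow> l \<in> range_of i \<Longrightarrow> ((\<lambda>z. C z (i, k) l) \<longlongrightarrow> C0 (i, k) l) K"
    and X: "span_family S C0 \<in> X" "eventually (\<lambda>z. span_family S (C z) \<in> X) K"
  shows "limitin Cls (\<lambda>z. span_family S (C z)) (span_family S C0) K"
proof -
  obtain h where h: "\<And>i m. (i, m) \<in> frame_index Q e \<Longrightarrow> (i, h i m) \<in> S"
    "\<And>C. frame_point Q M e (\<lambda>(i, m)\<in>frame_index Q e. lincomb i (C (i, h i m))) = span_family S C"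
    by (rule frame_of_family[OF S]) (rule that)
  define F where "F C = (\<lambda>(i, m)\<in>frame_index Q e. lincomb i (C (i, h i m)))" for C
  have pt: "frame_point Q M e (F C) = span_family S C" for C
    unfolding F_def by (rule h(2))
  have frames: "F C \<in> frames Q M e" if "span_family S C \<in> X" for C
    using that pt[of C] by (simp add: frames_def quiver_grassmannian_def) (simp add: F_def)
  have "limitin Cls (\<lambda>z. frame_point Q M e (F (C z))) (frame_point Q M e (F C0)) K"
  proof (rule limitin_Cls_frames)
    show "F C0 \<in> frames Q M e" "frame_point Q M e (F C0) \<in> X"
      using X(1) frames pt by auto
    show "eventually (\<lambda>z. F (C z) \<in> frames Q M e) K" "eventually (\<lambda>z. frame_point Q M e (F (C z)) \<in> X) K"
      using X(2) by (auto elim!: eventually_mono simp: frames pt)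
    fix j \<phi> assume j: "j \<in> frame_index Q e" and lin: "Vector_Spaces.linear (rep_scale M) (*) \<phi>"
    obtain i m where im: "j = (i, m)" by (cases j)
    have F: "\<phi> (F C j) = (\<Sum>l\<in>range_of i. C (i, h i m) l * \<phi> (b i l))" for C
      using j by (simp add: F_def im linear_lincomb[OF lin])
    have "((\<lambda>z. \<Sum>l\<in>range_of i. C z (i, h i m) l * \<phi> (b i l)) \<longlongrightarrow> (\<Sum>l\<in>range_of i. C0 (i, h i m) l * \<phi> (b i l))) K"
      by (intro tendsto_sum tendsto_mult tendsto_const lim h(1) j[unfolded im])
    then show "((\<lambda>z. \<phi> (F (C z) j)) \<longlongrightarrow> \<phi> (F C0 j)) K"
      by (simp only: F)
  qed
  then show ?thesis
    by (simp only: pt)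
qed

section \<open>Orbit closures and dimension\<close>

lemma finite_I: "finite I"
proof -
  have "supp_arcs Q M \<subseteq> arcs Q"
    by (auto simp: supp_arcs_def)
  moreover have "finite (arcs Q)"
    using fin_digraph_Q by (simp add: fin_digraph_def fin_digraph_axioms_def)
  moreover have "finite (components G)"
    unfolding components_eq using finite_verts by simp
  ultimately show ?thesis
    by (simp add: rep_torus_index_def finite_subset)
qed

lemma poly_scal:
  assumes "\<And>j. j \<in> I \<Longrightarrow> \<exists>q. \<forall>z\<in>D. \<gamma> z j = poly q z" "x \<in> verts G"
  shows "\<exists>q. \<forall>z\<in>D. scal (\<gamma> z) x = poly q (z :: complex)"
proof -
  have "\<exists>q. \<forall>z\<in>D. (\<Prod>y\<leftarrow>p. \<gamma> z (Inr (underlying_arc y))) = poly q z" if "set p \<subseteq> arcs G" for p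
    using that
  proof (induction p)
    case Nil
    then show ?case by (intro exI[of _ 1]) simp
  next
    case (Cons y p)
    then obtain q where q: "\<forall>z\<in>D. (\<Prod>y\<leftarrow>p. \<gamma> z (Inr (underlying_arc y))) = poly q z" by auto
    obtain q' where "\<forall>z\<in>D. \<gamma> z (Inr (underlying_arc y)) = poly q' z"
      using assms(1)[OF Inr_in_I[of y]] Cons.prems by auto
    with q show ?case
      by (intro exI[of _ "q' * q"]) simp
  qed
  from this[OF preceding_segment_arcs[OF assms(2)]] obtain q
    where q: "\<forall>z\<in>D. (\<Prod>y\<leftarrow>preceding_segment G x. \<gamma> z (Inr (underlying_arc y))) = poly q z" ..
  obtain q' where "\<forall>z\<in>D. \<gamma> z (Inl (component_of G x)) = poly q' z"
    using assms(1)[OF Inl_in_I[OF assms(2)]] ..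
  with q show ?thesis
    by (intro exI[of _ "q' * q"]) (simp add: scaling_factor_def)
qed

text \<open>The rows are left unnormalized, as in \<open>act_span_family\<close>: dividing by the
  pivot factors, as \<open>translate\<close> does, would introduce denominators.\<close>

lemma irreducible_curve_act:
  assumes U: "U \<in> X" and D: "infinite D"
    and poly: "\<And>j. j \<in> I \<Longrightarrow> \<exists>q. \<forall>z\<in>D. \<gamma> z j = poly q z"
    and torus: "\<And>z. z \<in> D \<Longrightarrow> \<gamma> z \<in> torus I"
  shows "irreducible_curve Zar D (\<lambda>z. act (\<gamma> z) U)"
proof -
  obtain S C where SC: "dimensional S" "S \<subseteq> verts G" "U = span_family S C"
    using X_reduced[OF U] by metis
  have "irreducible_curve Zar D (\<lambda>z. span_family S (\<lambda>x l. C x l * scal (\<gamma> z) (fst x, l)))"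
  proof (rule irreducible_curve_family[OF D SC(1)])
    fix i k l assume "(i, k) \<in> S" "l \<in> range_of i"
    then have "(i, l) \<in> verts G"
      using SC(2) by (auto simp: in_verts_G)
    then obtain q where "\<forall>z\<in>D. scal (\<gamma> z) (i, l) = poly q z"
      using poly_scal[of D \<gamma>, OF poly] by metis
    then show "\<exists>q. \<forall>z\<in>D. C (i, k) l * scal (\<gamma> z) (fst (i, k), l) = poly q z"
      by (intro exI[of _ "Polynomial.smult (C (i, k) l) q"]) simp
  next
    fix z assume "z \<in> D"
    then show "span_family S (\<lambda>x l. C x l * scal (\<gamma> z) (fst x, l)) \<in> X"
      using act_in_X[OF U torus] SC(3) by (simp add: act_span_family)
  qed
  then show ?thesis
    by (simp only: SC(3) act_span_family)
qed

abbreviation "orbit U \<equiv> (\<lambda>t. act t U) ` torus I"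

lemma orbit_subset: "U \<in> X \<Longrightarrow> orbit U \<subseteq> X"
  using act_in_X by blast

lemma topspace_orbit: "U \<in> X \<Longrightarrow> topspace (subtopology Zar (orbit U)) = orbit U"
  using orbit_subset[of U] by (auto simp: topspace_Zar)

lemma one_in_torus: "(\<lambda>j\<in>I. 1) \<in> torus I"
  by (simp add: torus_def)

lemma act_one:
  assumes "U \<in> X"
  shows "act (\<lambda>j\<in>I. 1) U = U"
proof -
  obtain S C where SC: "S \<subseteq> verts G" "U = span_family S C"
    using X_reduced[OF assms] by metis
  have "scal (\<lambda>j\<in>I. 1) x = 1" if x: "x \<in> verts G" for x
  proof -
    have "map (\<lambda>y. (\<lambda>j\<in>I. 1 :: complex) (Inr (underlying_arc y))) (preceding_segment G x) =
        map (\<lambda>y. 1) (preceding_segment G x)"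
      using preceding_segment_arcs[OF x] Inr_in_I by (intro map_cong) auto
    then show ?thesis
      using Inl_in_I[OF x] by (simp add: scaling_factor_def map_replicate_const)
  qed
  then have "span_family S (\<lambda>x l. C x l * scal (\<lambda>j\<in>I. 1) (fst x, l)) = span_family S C"
    using SC(1) by (intro span_family_cong) (auto simp: in_verts_G)
  then show ?thesis
    by (simp add: SC(2) act_span_family)
qed

text \<open>The torus is irreducible since any two of its points are joined by the line through them.\<close>

lemma irreducible_orbit:
  assumes U: "U \<in> X"
  shows "irreducible_closed (subtopology Zar (orbit U)) (orbit U)"
proof -
  let ?Y = "subtopology Zar (orbit U)"
  have "irreducible_closed ?Y (topspace ?Y)"
  proof (rule irreducible_of_curves)
    show "topspace ?Y \<noteq> {}"
      unfolding topspace_orbit[OF U] using one_in_torus by blast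
    fix V W assume "V \<in> topspace ?Y" "W \<in> topspace ?Y"
    then obtain s t where st: "s \<in> torus I" "t \<in> torus I" "V = act s U" "W = act t U"
      unfolding topspace_orbit[OF U] by blast
    define \<gamma> where "\<gamma> z = (\<lambda>j\<in>I. s j + z * (t j - s j))" for z
    \<comment> \<open>The line leaves the torus where a coordinate vanishes. This happens for
      finitely many \<open>z\<close>, because \<open>s j\<close> is non-zero, and not at 0 or
      1.\<close>
    define D where "D = {z. \<forall>j\<in>I. s j + z * (t j - s j) \<noteq> 0}"
    have "finite {z. s j + z * (t j - s j) = 0}" if "j \<in> I" for j
    proof -
      have "finite {z. poly [:s j, t j - s j:] z = 0}"
        using torus_nonzero[OF st(1) that] by (intro poly_roots_finite) simp
      then show ?thesis by simp
    qed
    then have "finite (\<Union>j\<in>I. {z. s j + z * (t j - s j) = 0})"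
      using finite_I by blast
    moreover have "UNIV - D = (\<Union>j\<in>I. {z. s j + z * (t j - s j) = 0})"
      by (auto simp: D_def)
    ultimately have D: "infinite D"
      by (metis finite_Diff2 infinite_UNIV_char_0)
    have torus: "\<gamma> z \<in> torus I" if "z \<in> D" for z
      using that by (simp add: \<gamma>_def D_def torus_def)
    have "irreducible_curve Zar D (\<lambda>z. act (\<gamma> z) U)"
    proof (rule irreducible_curve_act[OF U D _ torus])
      fix j assume "j \<in> I"
      then show "\<exists>q. \<forall>z\<in>D. \<gamma> z j = poly q z"
        by (intro exI[of _ "[:s j, t j - s j:]"]) (simp add: \<gamma>_def)
    qed
    then have "irreducible_curve ?Y D (\<lambda>z. act (\<gamma> z) U)"
      by (rule irreducible_curve_subtopology) (use torus in blast)
    moreover have D01: "0 \<in> D" "1 \<in> D"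
      using torus_nonzero[OF st(1)] torus_nonzero[OF st(2)] by (auto simp: D_def)
    moreover have "\<gamma> 0 = s" "\<gamma> 1 = t"
      using st(1,2) by (auto simp: \<gamma>_def torus_def PiE_def extensional_def restrict_def)
    ultimately have "irreducible_curve ?Y D (\<lambda>z. act (\<gamma> z) U)"
        "V \<in> (\<lambda>z. act (\<gamma> z) U) ` D" "W \<in> (\<lambda>z. act (\<gamma> z) U) ` D"
      using st(3,4) imageI[OF D01(1), of "\<lambda>z. act (\<gamma> z) U"] imageI[OF D01(2), of "\<lambda>z. act (\<gamma> z) U"]
      by simp_all
    then show "\<exists>D g. irreducible_curve ?Y (D :: complex set) g \<and> V \<in> g ` D \<and> W \<in> g ` D"
      by (intro exI[of _ D] exI[of _ "\<lambda>z. act (\<gamma> z) U"] conjI)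
  qed
  then show ?thesis
    by (simp only: topspace_orbit[OF U])
qed

lemma subspace_eqI:
  assumes A: "finite A" "independent A" "int (card A) = n" and B: "finite B" "int (card B) = n"
    and sub: "span A \<subseteq> span B"
  shows "span A = span B"
proof (rule ccontr)
  assume "span A \<noteq> span B"
  with sub obtain w where w: "w \<in> span B" "w \<notin> span A" by blast
  have "independent (insert w A)"
    by (rule independent_insertI[OF w(2) A(2)])
  moreover have "insert w A \<subseteq> span B"
    using w(1) sub span_superset[of A] by blast
  ultimately have "card (insert w A) \<le> card B"
    using independent_span_bound[OF B(1)] by blast
  moreover have "w \<notin> A"
    using w(2) span_base by blast
  ultimately show False
    using A(1,3) B(2) by simp
qed

text \<open>The dimensions agree, so one inclusion is enough; limit points are identified this way
  by exhibiting enough of their vectors.\<close>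

lemma prod_grassmannian_eqI:
  assumes U: "U \<in> prod_grassmannian Q M e" and W: "W \<in> prod_grassmannian Q M e"
    and sub: "\<And>i. i \<in> verts Q \<Longrightarrow> U i \<subseteq> W i"
  shows "U = W"
proof
  fix i
  show "U i = W i"
  proof (cases "i \<in> verts Q")
    case i: True
    obtain A where A: "finite A" "independent A" "span A = U i" "int (card A) = e i"
      by (rule grassmannian_basis[OF U i]) (rule that)
    obtain B where B: "finite B" "span B = W i" "int (card B) = e i"
      by (rule grassmannian_basis[OF W i]) (rule that)
    show ?thesis
      using subspace_eqI[OF A(1,2,4) B(1,3)] A(3) B(2) sub[OF i] by simp
  next
    case False
    have "U i = undefined" "W i = undefined"
      using U W False unfolding prod_grassmannian_def by (auto dest: PiE_arb)
    then show ?thesis by simp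
  qed
qed

text \<open>Meeting the line through \<open>u\<close> non-trivially means containing
  \<open>u\<close>. A point containing every vector of \<open>U\<close> equals \<open>U\<close> by
  dimension.\<close>

lemma closedin_point:
  assumes U: "U \<in> X"
  shows "closedin Zar {U}"
proof -
  have Up: "U \<in> prod_grassmannian Q M e"
    using U by (simp add: quiver_grassmannian_def)
  define F where "F = {{W \<in> X. \<exists>w\<in>W i \<inter> span {u}. w \<noteq> 0} |i u. i \<in> verts Q \<and> u \<in> U i \<and> u \<noteq> 0}"
  \<comment> \<open>\<open>F\<close> is empty when all the spaces \<open>U i\<close> are zero;
    inserting \<open>X\<close> keeps the intersection meaningful.\<close>
  have "closedin Zar (\<Inter>(insert X F))"
  proof (rule closedin_Inter)
    fix T assume "T \<in> insert X F"
    then show "closedin Zar T"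
    proof
      assume "T = X"
      then show ?thesis
        using closedin_topspace[of Zar] by (simp only: topspace_Zar)
    next
      assume "T \<in> F"
      then obtain i u where "T = {W \<in> X. \<exists>w\<in>W i \<inter> span {u}. w \<noteq> 0}" "i \<in> verts Q"
        by (auto simp: F_def)
      then show ?thesis
        using closedin_meets_subspace[OF subspace_span] by simp
    qed
  qed simp
  moreover have "\<Inter>(insert X F) = {U}"
  proof (intro equalityI subsetI)
    fix W assume W: "W \<in> \<Inter>(insert X F)"
    then have WX: "W \<in> X" by simp
    then have Wp: "W \<in> prod_grassmannian Q M e"
      by (simp add: quiver_grassmannian_def)
    have "U = W"
    proof (rule prod_grassmannian_eqI[OF Up Wp], rule subsetI)
      fix i u assume i: "i \<in> verts Q" and u: "u \<in> U i"
      have Wi: "subspace (W i)"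
        using Wp i by (auto simp: prod_grassmannian_def PiE_iff)
      show "u \<in> W i"
      proof (cases "u = 0")
        case True
        then show ?thesis using subspace_0[OF Wi] by simp
      next
        case False
        then have "{W \<in> X. \<exists>w\<in>W i \<inter> span {u}. w \<noteq> 0} \<in> F"
          using i u by (auto simp: F_def)
        then have "W \<in> {W \<in> X. \<exists>w\<in>W i \<inter> span {u}. w \<noteq> 0}"
          using W by blast
        then obtain c where c: "rep_scale M c u \<in> W i" "rep_scale M c u \<noteq> 0"
          by (auto simp: span_singleton)
        have "rep_scale M (inverse c) (rep_scale M c u) \<in> W i"
          by (rule subspace_scale[OF Wi c(1)])
        moreover have "rep_scale M (inverse c) (rep_scale M c u) = u"
          using c(2) by auto
        ultimately show ?thesis
          by (simp only:)
      qed
    qed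
    then show "W \<in> {U}" by auto
  next
    fix W assume "W \<in> {U}"
    then show "W \<in> \<Inter>(insert X F)"
      using U span_base[of _ "{_}"] by (auto simp: F_def)
  qed
  ultimately show ?thesis by simp
qed

text \<open>
  The points of the orbit of \<open>U\<close> with the same \<open>(k, l)\<close>-entry of the echelon form as \<open>U\<close> are those
  meeting the subspace of all vectors whose pivot coordinates other than the \<open>k\<close>-th vanish and
  whose \<open>k\<close>-th and \<open>l\<close>-th coordinates are in the proportion prescribed by that entry.
\<close>

lemma closedin_orbit_entry:
  assumes S: "S \<subseteq> verts G" "reduced S C" and U: "span_family S C \<in> X"
    and k: "(i, k) \<in> S" and l: "l \<in> range_of i" and nz: "C (i, k) l \<noteq> 0"
  obtains K where "closedin Zar K"
    "\<And>t. t \<in> torus I \<Longrightarrow> act t (span_family S C) \<in> K \<longleftrightarrow> scal t (i, l) = scal t (i, k)"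
proof -
  have i: "i \<in> verts Q" and kr: "k \<in> range_of i"
    using k S by (auto simp: in_verts_G)
  define P where "P = {w \<in> rep_space M i. (\<forall>m. (i, m) \<in> S \<longrightarrow> m \<noteq> k \<longrightarrow> coord i w m = 0) \<and>
    coord i w l = C (i, k) l * coord i w k}"
  have "subspace P"
    unfolding P_def using subspace_space[OF i]
    by (auto simp: coord_add[OF i] coord_scale[OF i] coord_zero distrib_left
        intro!: subspaceI intro: subspace_0 subspace_add subspace_scale)
  then have "closedin Zar {W \<in> X. \<exists>w\<in>W i \<inter> P. w \<noteq> 0}"
    by (rule closedin_meets_subspace[OF _ i])
  moreover have "act t (span_family S C) \<in> {W \<in> X. \<exists>w\<in>W i \<inter> P. w \<noteq> 0} \<longleftrightarrow> scal t (i, l) = scal t (i, k)"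
    if t: "t \<in> torus I" for t
  proof -
    let ?C = "translate t C"
    have red: "reduced S ?C"
      by (rule reduced_translate[OF t S])
    have "(\<exists>w\<in>span_family S ?C i \<inter> P. w \<noteq> 0) \<longleftrightarrow> ?C (i, k) l = C (i, k) l"
    proof
      assume "\<exists>w\<in>span_family S ?C i \<inter> P. w \<noteq> 0"
      then obtain w where w: "w \<in> span_family S ?C i" "w \<in> P" "w \<noteq> 0" by blast
      have co: "coord i w m = coord i w k * ?C (i, k) m" if m: "m \<in> range_of i" for m
      proof -
        have "coord i w m = (\<Sum>n | (i, n) \<in> S. coord i w n * ?C (i, n) m)"
          using mem_span_family[OF S(1) red i, THEN iffD1, OF w(1)] m by blast
        also have "\<dots> = (\<Sum>n | (i, n) \<in> S. (coord i w n * ?C (i, n) m) * (if k = n then 1 else 0))"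
          using w(2) by (intro sum.cong) (auto simp: P_def)
        also have "\<dots> = coord i w k * ?C (i, k) m"
          by (rule sum_fibre_delta[OF S(1) k])
        finally show ?thesis .
      qed
      have wV: "w \<in> rep_space M i"
        using w(2) by (simp add: P_def)
      have "coord i w k \<noteq> 0"
      proof
        assume 0: "coord i w k = 0"
        have "coord i w m = coord i 0 m" if "m \<in> range_of i" for m
          using co[OF that] 0 by (simp add: coord_zero)
        then have "w = 0"
          by (intro coord_eqI[OF i wV subspace_0[OF subspace_space[OF i]]])
        with w(3) show False ..
      qed
      moreover have "coord i w l = C (i, k) l * coord i w k"
        using w(2) by (simp add: P_def)
      ultimately show "?C (i, k) l = C (i, k) l"
        using co[OF l] by simp
    next
      assume eq: "?C (i, k) l = C (i, k) l"
      let ?w = "lincomb i (?C (i, k))"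
      have one: "coord i ?w k = 1"
        using coord_lincomb[OF i kr] reducedD[OF red k k] by simp
      have "coord i ?w m = 0" if m: "(i, m) \<in> S" "m \<noteq> k" for m
        using coord_lincomb[OF i, of m] reducedD[OF red k m(1)] m S by (auto simp: in_verts_G)
      then have "?w \<in> P"
        using coord_lincomb[OF i l] eq one lincomb_in_space[OF i] by (simp add: P_def)
      moreover have "?w \<noteq> 0"
        using one coord_zero[of i k] by (metis zero_neq_one)
      moreover have "?w \<in> span_family S ?C i"
        by (rule lincomb_in_span_family[OF i k])
      ultimately show "\<exists>w\<in>span_family S ?C i \<inter> P. w \<noteq> 0" by blast
    qed
    also have "\<dots> \<longleftrightarrow> scal t (i, l) = scal t (i, k)"
      using scal_nonzero[OF t, of "(i, k)"] k S nz by (auto simp: translate_def field_simps)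
    finally show ?thesis
      using act_in_X[OF U t] by (simp add: act_span_family_translate[OF t S(1)])
  qed
  ultimately show thesis by (rule that)
qed

section \<open>One-parameter subgroups and the entries of a one-dimensional orbit\<close>

definition curve :: "(('v, 'e) torus_index \<Rightarrow> nat) \<Rightarrow> complex \<Rightarrow> ('v, 'e) torus_index \<Rightarrow> complex" where
  "curve w z = (\<lambda>j\<in>I. z ^ w j)"

text \<open>
  If a one-parameter subgroup fixes one non-zero entry of the echelon form but not another one,
  then its orbit yields an irreducible closed set strictly between a point and the whole orbit.
\<close>

lemma one_dim_orbit_weights:
  assumes S: "S \<subseteq> verts G" "reduced S C" and U: "span_family S C \<in> X"
    and dim: "krull_dim (subtopology Zar (orbit (span_family S C))) = 1"
    and k: "(i, k) \<in> S" "l \<in> range_of i" "l \<noteq> k" "C (i, k) l \<noteq> 0"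
    and k': "(j, k') \<in> S" "l' \<in> range_of j" "C (j, k') l' \<noteq> 0"
    and fixed: "\<And>z. z \<noteq> 0 \<Longrightarrow> scal (curve w z) (i, l) = scal (curve w z) (i, k)"
    and z: "z \<noteq> 0"
  shows "scal (curve w z) (j, l') = scal (curve w z) (j, k')"
proof (rule ccontr)
  assume neq: "scal (curve w z) (j, l') \<noteq> scal (curve w z) (j, k')"
  let ?U = "span_family S C"
  let ?Y = "subtopology Zar (orbit ?U)" and ?D = "UNIV - {0 :: complex}" and ?g = "\<lambda>z. act (curve w z) ?U"
  have torus: "curve w z \<in> torus I" if "z \<in> ?D" for z
    using that by (simp add: curve_def torus_def)
  have "irreducible_curve Zar ?D ?g"
  proof (rule irreducible_curve_act[OF U _ _ torus])
    show "infinite ?D"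
      by (metis finite_Diff2 finite.emptyI finite_insert infinite_UNIV_char_0)
    fix j assume "j \<in> I"
    then show "\<exists>q. \<forall>z\<in>?D. curve w z j = poly q z"
      by (intro exI[of _ "Polynomial.monom 1 (w j)"]) (simp add: curve_def poly_monom)
  qed
  then have "irreducible_curve ?Y ?D ?g"
    by (rule irreducible_curve_subtopology) (use torus in blast)
  then have Z: "irreducible_closed ?Y (?Y closure_of (?g ` ?D))"
    by (rule irreducible_closure_of_curve)
  obtain K where K: "closedin Zar K"
    "\<And>t. t \<in> torus I \<Longrightarrow> act t ?U \<in> K \<longleftrightarrow> scal t (i, l) = scal t (i, k)"
    by (rule closedin_orbit_entry[where C = C, OF S U k(1,2,4)]) (rule that)
  have kG: "(i, k) \<in> verts G" "(i, l) \<in> verts G"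
    using S k by (auto simp: in_verts_G)
  have kG': "(j, k') \<in> verts G" "(j, l') \<in> verts G"
    using S k' by (auto simp: in_verts_G)
  have "?g ` ?D \<subseteq> K"
    using K(2)[OF torus] fixed by auto
  then have gK: "?g ` ?D \<subseteq> orbit ?U \<inter> K"
    using torus by blast
  have "closedin ?Y (orbit ?U \<inter> K)"
    by (rule closedin_subtopology_Int_closed[OF K(1)])
  then have ZK: "?Y closure_of (?g ` ?D) \<subseteq> orbit ?U \<inter> K"
    by (rule closure_of_minimal[OF gK])
  \<comment> \<open>Strictness at the top: some element of the torus moves the entry that the
    subgroup fixes, since its two ends have different characters.\<close>
  obtain t where t: "t \<in> torus I" "scal t (i, k) \<noteq> scal t (i, l)"
    using scal_distinct[OF kG] k(3) by metis
  then have "act t ?U \<notin> K" "act t ?U \<in> orbit ?U"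
    using K(2)[OF t(1)] by auto
  with ZK have ZO: "?Y closure_of (?g ` ?D) \<subset> orbit ?U" by blast
  have gZ: "?g ` ?D \<subseteq> ?Y closure_of (?g ` ?D)"
    by (rule closure_of_subset) (use torus topspace_orbit[OF U] in blast)
  have "curve w 1 = (\<lambda>j\<in>I. 1)"
    by (simp add: curve_def)
  then have "?g 1 = ?U"
    using act_one[OF U] by simp
  then have UZ: "?U \<in> ?Y closure_of (?g ` ?D)"
    using gZ by force
  \<comment> \<open>Strictness at the bottom: the second entry changes at \<open>z\<close>, and
    entries are invariants of the point.\<close>
  have "?g z \<noteq> ?U"
  proof
    have tz: "curve w z \<in> torus I"
      using torus z by simp
    assume "?g z = ?U"
    then have "span_family S (translate (curve w z) C) j = span_family S C j"
      using act_span_family_translate[OF tz S(1)] by simp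
    then have "translate (curve w z) C (j, k') l' = C (j, k') l'"
      by (rule span_family_eq_imp[OF S(1) reduced_translate[OF tz S] S(2) _ k'(1,2)])
    then show False
      using k'(3) neq scal_nonzero[OF tz kG'(1)] by (simp add: translate_def field_simps)
  qed
  moreover have "?g z \<in> ?Y closure_of (?g ` ?D)"
    using gZ z by blast
  ultimately have UZ': "{?U} \<subset> ?Y closure_of (?g ` ?D)"
    using UZ by blast
  have "orbit ?U \<inter> {?U} = {?U}"
    using UZ ZO by blast
  then have "closedin ?Y {?U}"
    using closedin_subtopology_Int_closed[OF closedin_point[OF U], of "orbit ?U"] by simp
  then have "irreducible_closed ?Y {?U}"
    by (rule irreducible_closed_singleton)
  then have "krull_dim ?Y \<noteq> 1"
    by (rule krull_dim_chain[OF _ Z irreducible_orbit[OF U] UZ' ZO])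
  with dim show False by simp
qed

lemma scal_curve:
  assumes "x \<in> verts G"
  shows "scal (curve w z) x = z ^ (w (Inl (component_of G x)) +
    (\<Sum>y\<leftarrow>preceding_segment G x. w (Inr (underlying_arc y))))"
proof -
  have "(\<Prod>y\<leftarrow>p. curve w z (Inr (underlying_arc y))) = z ^ (\<Sum>y\<leftarrow>p. w (Inr (underlying_arc y)))"
    if "set p \<subseteq> arcs G" for p
    using that by (induction p) (simp_all add: curve_def Inr_in_I power_add)
  from this[OF preceding_segment_arcs[OF assms]] show ?thesis
    using Inl_in_I[OF assms] by (simp add: scaling_factor_def power_add curve_def)
qed

text \<open>With the same weight \<open>n\<close> on all arrows, the exponent depends on a vertex
  only through its string and its position.\<close>

lemma scal_curve_string:
  "x \<in> verts G \<Longrightarrow> scal (curve (case_sum w (\<lambda>_. n)) z) x = z ^ (w (component_of G x) + position x * n)"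
  by (simp add: scal_curve sum_list_triv)

lemma power_two_eq: "(2 :: complex) ^ m = 2 ^ n \<Longrightarrow> m = n"
proof -
  assume "(2 :: complex) ^ m = 2 ^ n"
  then have "norm ((2 :: complex) ^ m) = norm ((2 :: complex) ^ n)" by simp
  then show "m = n" by (simp add: norm_power)
qed

text \<open>On a common string the smaller index comes first, and then \<open>(i, l)\<close> would
  be a successor of \<open>(i, k)\<close> and belong to \<open>S\<close>.\<close>

lemma different_strings:
  assumes "successor_closed G S" "(i, k) \<in> S" "(i, l) \<in> verts G" "(i, l) \<notin> S" "k < l"
  shows "\<not> same_string (i, k) (i, l)"
proof
  assume "same_string (i, k) (i, l)"
  moreover have "(i, k) \<in> verts G"
    using assms(1,2) by (auto simp: successor_closed_def)
  ultimately show False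
    using same_string_position_less[of i k l] successor_closed_string[OF assms(1,2,3)] assms(3,4,5) by simp
qed

text \<open>Every subgroup fixing the first entry must fix the second one too. Suitable weights on
  strings and arrows then show that the second entry joins the same two strings at the same
  distance.\<close>

lemma one_dim_orbit_entries:
  assumes S: "successor_closed G S" "reduced S C" and U: "span_family S C \<in> X"
    and low: "\<And>i k m. (i, k) \<in> S \<Longrightarrow> m \<in> range_of i \<Longrightarrow> m < k \<Longrightarrow> C (i, k) m = 0"
    and dim: "krull_dim (subtopology Zar (orbit (span_family S C))) = 1"
    and k: "(i, k) \<in> S" "l \<in> range_of i" "l \<noteq> k" "C (i, k) l \<noteq> 0"
    and k': "(j, k') \<in> S" "l' \<in> range_of j" "l' \<noteq> k'" "C (j, k') l' \<noteq> 0"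
  shows "same_string (j, k') (i, k)" "same_string (j, l') (i, l)"
    "position (i, l) + position (j, k') = position (i, k) + position (j, l')"
proof -
  have SG: "S \<subseteq> verts G"
    using S(1) by (simp add: successor_closed_def)
  have G: "(i, k) \<in> verts G" "(i, l) \<in> verts G" "(j, k') \<in> verts G" "(j, l') \<in> verts G"
    using SG k k' by (auto simp: in_verts_G)
  have less: "k < l" "k' < l'"
    using low[OF k(1,2)] low[OF k'(1,2)] k(3,4) k'(3,4) by (metis linorder_neqE_nat)+
  have notS: "(i, l) \<notin> S" "(j, l') \<notin> S"
    using reducedD[OF S(2) k(1)] reducedD[OF S(2) k'(1)] k(3,4) k'(3,4) by auto
  have diff: "\<not> same_string (i, k) (i, l)" "\<not> same_string (j, k') (j, l')"
    using different_strings[OF S(1)] k(1) k'(1) G notS less by blast+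
  have weights: "scal (curve w 2) (j, l') = scal (curve w 2) (j, k')"
    if "\<And>z. scal (curve w z) (i, l) = scal (curve w z) (i, k)" for w
    by (rule one_dim_orbit_weights[OF SG S(2) U dim k k'(1,2,4) that]) simp
  have comp: "s = component_of G (i, k) \<or> s = component_of G (i, l)"
    if s: "s = component_of G (j, k') \<or> s = component_of G (j, l')" for s
  proof (rule ccontr)
    assume ns: "\<not> ?thesis"
    \<comment> \<open>Scaling only the string \<open>s\<close> leaves the first entry alone but
      moves the second, exactly one end of which lies on \<open>s\<close>.\<close>
    let ?w = "case_sum (\<lambda>c. if c = s then 1 else 0) (\<lambda>_. 0) :: ('v, 'e) torus_index \<Rightarrow> nat"
    have "scal (curve ?w z) (i, l) = scal (curve ?w z) (i, k)" for z
      using ns G(1,2) by (auto simp: scal_curve_string)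
    then have "scal (curve ?w 2) (j, l') = scal (curve ?w 2) (j, k')"
      by (rule weights)
    then show False
      using s diff(2) G(3,4) by (auto simp: scal_curve_string split: if_splits)
  qed
  \<comment> \<open>Weights alone do not exclude an inverse character, where the strings are joined
    in the opposite direction. Here pivots lie in the successor closed \<open>S\<close> and the
    other ends do not, which orders the positions as in \<open>no_crossed_strings\<close>.\<close>
  have "\<not> (same_string (j, k') (i, l) \<and> same_string (j, l') (i, k))"
  proof
    assume sw: "same_string (j, k') (i, l) \<and> same_string (j, l') (i, k)"
    have "position (j, l') < position (i, k)" "position (i, l) < position (j, k')"
      using successor_closed_string[OF S(1) k(1) G(4)] successor_closed_string[OF S(1) k'(1) G(2)]
        notS sw by (metis not_less)+
    then show False
      using no_crossed_strings[OF G(1,2) less(1) G(3,4) less(2)] sw by metis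
  qed
  then show c: "same_string (j, k') (i, k)" "same_string (j, l') (i, l)"
    using comp[of "component_of G (j, k')"] comp[of "component_of G (j, l')"] diff by metis+
  \<comment> \<open>With arrow weight 1, both ends of the first entry get the exponent
    \<open>position (i, k) + position (i, l)\<close>. Equality of the exponents at the ends of the
    second entry is the claimed relation.\<close>
  let ?w = "case_sum (\<lambda>c. if c = component_of G (i, k) then position (i, l) else
    if c = component_of G (i, l) then position (i, k) else 0) (\<lambda>_. 1) :: ('v, 'e) torus_index \<Rightarrow> nat"
  have "scal (curve ?w z) (i, l) = scal (curve ?w z) (i, k)" for z
    using diff(1) G(1,2) by (simp add: scal_curve_string add.commute)
  then have "scal (curve ?w 2) (j, l') = scal (curve ?w 2) (j, k')"
    by (rule weights)
  then have "(2 :: complex) ^ (position (i, k) + position (j, l')) = 2 ^ (position (i, l) + position (j, k'))"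
    using c diff(1) G(3,4) by (simp add: scal_curve_string)
  then show "position (i, l) + position (j, k') = position (i, k) + position (j, l')"
    by (metis power_two_eq)
qed

text \<open>If all entries off the diagonal vanish, no translate changes the matrix and the orbit is
  a single point.\<close>

lemma one_dim_orbit_nontrivial:
  assumes S: "S \<subseteq> verts G" "reduced S C" and U: "span_family S C \<in> X"
    and dim: "krull_dim (subtopology Zar (orbit (span_family S C))) = 1"
  obtains i k l where "(i, k) \<in> S" "l \<in> range_of i" "l \<noteq> k" "C (i, k) l \<noteq> 0"
proof (rule ccontr)
  note entry = that
  assume no: "\<not> thesis"
  have trivial: "span_family S C' = span_family S C" if C': "C' = translate t C" "t \<in> torus I" for C' t
  proof (rule span_family_cong)
    fix i k l assume kl: "(i, k) \<in> S" "l \<in> range_of i"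
    show "C' (i, k) l = C (i, k) l"
    proof (cases "l = k")
      case True
      then show ?thesis
        using scal_nonzero[OF C'(2), of "(i, k)"] kl S by (auto simp: C'(1) translate_def)
    next
      case False
      then have "C (i, k) l = 0"
        using no entry kl by blast
      then show ?thesis by (simp add: C'(1) translate_def)
    qed
  qed
  have "act t (span_family S C) = span_family S C" if "t \<in> torus I" for t
    using trivial[OF refl that] act_span_family_translate[OF that S(1)] by simp
  then have "orbit (span_family S C) = {span_family S C}"
    using one_in_torus by auto
  then have "topspace (subtopology Zar (orbit (span_family S C))) = {span_family S C}"
    using topspace_orbit[OF U] by simp
  from krull_dim_singleton[OF this] dim show False by simp
qed

section \<open>The curve of a mutation\<close>

lemma obtain_vertex_at:
  assumes "w \<in> verts G" "m \<le> position w"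
  obtains v where "v \<in> verts G" "same_string w v" "position v = m"
proof -
  have "\<exists>v\<in>verts G. same_string w v \<and> position v = m" if "n = position w - m" for n
    using that assms
  proof (induction n arbitrary: w)
    case 0
    then show ?case by force
  next
    case (Suc n)
    then obtain a where a: "a \<in> arcs G" "head G a = w" "position (tail G a) = position w - 1"
        "component_of G (tail G a) = component_of G w"
      using obtain_in_arc[of w] by (metis Zero_neq_Suc bot_nat_0.not_eq_extremum diff_0_eq_0)
    have "n = position (tail G a) - m" "m \<le> position (tail G a)"
      using Suc.prems a(3) by linarith+
    then obtain v where "v \<in> verts G" "same_string (tail G a) v" "position v = m"
      using Suc.IH[OF _ tail_in_verts[OF a(1)]] by blast
    then show ?case
      using a(4) by (intro bexI[of _ v]) simp_all
  qed
  then show thesis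
    using that by blast
qed

text \<open>The part of a fundamental mutation that does not mention \<open>S\<close>. The final
  clause keeps \<open>string_segment y h\<close> from being truncated; for \<open>x\<close> the same
  follows by copying, as its index is smaller.\<close>

definition exchange :: "'v \<times> nat \<Rightarrow> 'v \<times> nat \<Rightarrow> nat \<Rightarrow> bool" where
  "exchange x y h \<longleftrightarrow> x \<in> verts G \<and> y \<in> verts G \<and> fst x = fst y \<and> snd x < snd y \<and> \<not> same_string x y \<and>
     (\<exists>v\<in>verts G. same_string y v \<and> position v = position y + h)"

text \<open>The vertices \<open>u\<close> and \<open>v\<close> have the same offset from
  \<open>x\<close> and \<open>y\<close>; the equation is written with sums because subtraction of
  natural numbers truncates.\<close>

definition paired :: "'v \<times> nat \<Rightarrow> 'v \<times> nat \<Rightarrow> nat \<Rightarrow> 'v \<times> nat \<Rightarrow> 'v \<times> nat \<Rightarrow> bool" where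
  "paired x y h u v \<longleftrightarrow> u \<in> string_segment x h \<and> v \<in> string_segment y h \<and>
     position u + position y = position v + position x"

lemma pairedD:
  assumes "paired x y h u v"
  shows "u \<in> verts G" "same_string u x" "position x \<le> position u" "position u \<le> position x + h"
    "v \<in> verts G" "same_string v y" "position y \<le> position v" "position v \<le> position y + h"
    "position u + position y = position v + position x"
  using assms by (auto simp: paired_def string_segment_def)

lemma paired_left_unique:
  assumes "paired x y h u v" "paired x y h u' v"
  shows "u = u'"
proof (rule string_position_unique)
  note u = pairedD[OF assms(1)] and u' = pairedD[OF assms(2)]
  show "u \<in> verts G" "u' \<in> verts G"
    by (rule u(1), rule u'(1))
  show "same_string u u'"
    by (simp only: u(2) u'(2))
  show "position u = position u'"
    using u(9) u'(9) by linarith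
qed

lemma paired_right_unique:
  assumes "paired x y h u v" "paired x y h u v'"
  shows "v = v'"
proof (rule string_position_unique)
  note v = pairedD[OF assms(1)] and v' = pairedD[OF assms(2)]
  show "v \<in> verts G" "v' \<in> verts G"
    by (rule v(5), rule v'(5))
  show "same_string v v'"
    by (simp only: v(6) v'(6))
  show "position v = position v'"
    using v(9) v'(9) by linarith
qed

lemma exchange_right:
  assumes E: "exchange x y h" and v: "v \<in> string_segment y h"
  obtains k where "paired x y h (fst v, k) v" "k < snd v"
proof -
  have v': "v \<in> verts G" "same_string y v" "position y \<le> position v" "position v \<le> position y + h"
    using v by (auto simp: string_segment_def)
  have e: "(fst x, snd y) = y"
    using E by (simp add: exchange_def prod_eq_iff)
  have xy: "(fst x, snd x) \<in> verts G" "(fst x, snd y) \<in> verts G" "snd x < snd y"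
    unfolding e prod.collapse using E by (simp_all add: exchange_def)
  obtain k where k: "(fst v, k) \<in> verts G" "k < snd v" "same_string (fst x, snd x) (fst v, k)"
    "position (fst v, k) = position (fst x, snd x) + (position v - position (fst x, snd y))"
    by (rule copy_vertex[OF xy v'(1)]) (use v' e that in simp_all)
  have "position (fst v, k) + position y = position v + position x"
    using k(4)[unfolded e prod.collapse] v'(3) by linarith
  then have "paired x y h (fst v, k) v"
    using k(1) k(3)[unfolded prod.collapse] v v' by (simp add: paired_def string_segment_def)
  from this k(2) show thesis by (rule that)
qed

text \<open>Copying works only from the larger index to the smaller one. So the partner is first
  located by its position on the string of \<open>y\<close>, and copying it back is seen to return
  \<open>u\<close>.\<close>

lemma exchange_left:
  assumes E: "exchange x y h" and u: "u \<in> string_segment x h"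
  obtains l where "paired x y h u (fst u, l)" "snd u < l"
proof -
  obtain w where w: "w \<in> verts G" "same_string y w" "position w = position y + h"
    using E by (auto simp: exchange_def)
  have u': "u \<in> verts G" "position x \<le> position u" "position u \<le> position x + h"
    using u by (auto simp: string_segment_def)
  obtain v where v: "v \<in> verts G" "same_string w v" "position v = position y + (position u - position x)"
    by (rule obtain_vertex_at[OF w(1), of "position y + (position u - position x)"]) (use u' w(3) that in simp_all)
  have "position v + position x = position u + position y"
    using v(3) u'(2) by linarith
  then have vs: "v \<in> string_segment y h"
    using v(1,2) w(2) u' by (simp add: string_segment_def)
  obtain k where k: "paired x y h (fst v, k) v" "k < snd v"
    by (rule exchange_right[OF E vs]) (rule that)
  have e: "(fst v, k) = u"
  proof (rule string_position_unique)
    note vk = pairedD[OF k(1)]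
    show "(fst v, k) \<in> verts G" "u \<in> verts G"
      by (rule vk(1), rule u'(1))
    show "same_string (fst v, k) u"
      using vk(2) u by (simp add: string_segment_def)
    show "position (fst v, k) = position u"
      using vk(9) \<open>position v + position x = position u + position y\<close> by linarith
  qed
  then have "(fst u, snd v) = v" "snd u = k"
    by (auto simp: prod_eq_iff)
  then show thesis
    using that[of "snd v"] k[unfolded e] k(2) by simp
qed

lemma paired_ends:
  assumes "exchange x y h" "paired x y h u v"
  shows "fst u = fst v" "snd u < snd v"
proof -
  have "v \<in> string_segment y h"
    using assms(2) by (simp add: paired_def)
  then obtain k where k: "paired x y h (fst v, k) v" "k < snd v"
    by (rule exchange_right[OF assms(1)])
  have "u = (fst v, k)"
    by (rule paired_left_unique[OF assms(2) k(1)])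
  with k(2) show "fst u = fst v" "snd u < snd v" by simp_all
qed

lemma paired_start:
  assumes "exchange x y h"
  shows "paired x y h x y"
  using assms by (auto simp: paired_def exchange_def string_segment_def)

text \<open>The arrow leaving \<open>v\<close> is copied to \<open>u\<close>. Past the end of the
  segments the arrows remain parallel although their heads no longer count as a pair, hence the
  guarded conclusion.\<close>

lemma paired_arc:
  assumes E: "exchange x y h" and uv: "paired x y h u v" and a: "(v, a, v') \<in> arcs G"
  obtains k where "(u, a, (fst v', k)) \<in> arcs G" "k < snd v'"
    "position v' \<le> position y + h \<Longrightarrow> paired x y h (fst v', k) v'"
    "position v' = position v + 1" "position (fst v', k) = position u + 1"
    "same_string v' y" "same_string (fst v', k) x"
proof -
  have e: "(fst u, snd v) = v"
    using paired_ends(1)[OF E uv] by (simp add: prod_eq_iff)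
  have "((fst u, snd v), a, v') \<in> arcs G" "(fst u, snd u) \<in> verts G" "snd u < snd v"
    unfolding e prod.collapse using a pairedD(1)[OF uv] paired_ends(2)[OF E uv] by simp_all
  then obtain k where "((fst u, snd u), a, (fst v', k)) \<in> arcs G" and k2: "k < snd v'"
    by (rule copy_arc)
  then have k: "(u, a, (fst v', k)) \<in> arcs G" by simp
  have pos: "position v' = position v + 1" "position (fst v', k) = position u + 1"
    using preceding_segment_head[OF a] preceding_segment_head[OF k] by (simp_all add: ends_G)
  have str: "same_string v' y" "same_string (fst v', k) x"
    using component_of_arc[OF a] component_of_arc[OF k] pairedD[OF uv] by (simp_all add: ends_G)
  have "paired x y h (fst v', k) v'" if "position v' \<le> position y + h"
    using that pos str pairedD[OF uv] head_in_verts[OF a] head_in_verts[OF k]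
    by (simp add: paired_def string_segment_def ends_G)
  from that[OF k k2 this pos str] show thesis .
qed

text \<open>Moves along both segments at once, over the same arrows of Q: the arrow into
  \<open>v\<close> is copied to its partner, and uniqueness of partners identifies the copied head
  with \<open>u\<close>.\<close>

lemma paired_induct [consumes 2, case_names start step]:
  assumes E: "exchange x y h" and uv: "paired x y h u v"
    and start: "P x y"
    and step: "\<And>u v a u' v'. paired x y h u v \<Longrightarrow> P u v \<Longrightarrow> paired x y h u' v' \<Longrightarrow>
      (u, a, u') \<in> arcs G \<Longrightarrow> (v, a, v') \<in> arcs G \<Longrightarrow> P u' v'"
  shows "P u v"
proof -
  have "P u v" if "n = position v - position y" for n
    using that uv
  proof (induction n arbitrary: u v)
    case 0
    then have "v = y"
      using pairedD[OF 0(2)] E by (intro string_position_unique) (auto simp: exchange_def)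
    with 0(2) paired_start[OF E] have "u = x"
      by (metis paired_left_unique)
    with \<open>v = y\<close> start show ?case by simp
  next
    case (Suc n)
    note uv = pairedD[OF Suc.prems(2)]
    have "0 < position v"
      using Suc.prems(1) by linarith
    then obtain c where c: "c \<in> arcs G" "head G c = v" "position (tail G c) = position v - 1"
        "component_of G (tail G c) = component_of G v"
      using obtain_in_arc[OF uv(5)] by metis
    have seg: "tail G c \<in> string_segment y h" "n = position (tail G c) - position y"
      using c uv Suc.prems(1) tail_in_verts[OF c(1)] by (auto simp: string_segment_def)
    obtain k where k: "paired x y h (fst (tail G c), k) (tail G c)"
      by (rule exchange_right[OF E seg(1)]) (rule that)
    obtain a where a: "c = (tail G c, a, v)"
      using c(2) by (cases c) (simp add: ends_G)
    then have arc: "(tail G c, a, v) \<in> arcs G"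
      using c(1) by simp
    obtain m where m: "((fst (tail G c), k), a, (fst v, m)) \<in> arcs G" "paired x y h (fst v, m) v"
      using paired_arc[OF E k arc] uv(8) by metis
    then have "(fst v, m) = u"
      using paired_left_unique Suc.prems(2) by metis
    then show ?case
      using step[OF k Suc.IH[OF seg(2) k] Suc.prems(2)] m(1) arc by metis
  qed
  then show ?thesis by simp
qed

text \<open>Parallel arrows lie over the same arrow of Q and multiply both factors by the same
  coordinate, so the quotient is constant along the segments. This is why one character describes
  the whole edge.\<close>

lemma scal_paired:
  assumes "exchange x y h" "paired x y h u v"
  shows "scal t v * scal t x = scal t u * scal t y"
  using assms
proof (induction rule: paired_induct)
  case start
  then show ?case by simp
next
  case (step u v a u' v')
  then show ?case
    using scal_head[OF step.hyps(3), of t] scal_head[OF step.hyps(4), of t]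
    by (simp add: ends_G underlying_arc_def)
qed

definition exchange_coeff ::
    "'v \<times> nat \<Rightarrow> 'v \<times> nat \<Rightarrow> nat \<Rightarrow> complex \<Rightarrow> 'v \<times> nat \<Rightarrow> nat \<Rightarrow> complex" where
  "exchange_coeff x y h c u l = delta u l + (if paired x y h u (fst u, l) then c else 0)"

text \<open>Replaces the two paths of a mutation by their common length, so that the exchanged sets
  are described by positions alone.\<close>

definition mutation_data ::
    "('v \<times> nat) set \<Rightarrow> 'v \<times> nat \<Rightarrow> 'v \<times> nat \<Rightarrow> nat \<Rightarrow> ('v \<times> nat) set \<Rightarrow> bool" where
  "mutation_data S x y h S' \<longleftrightarrow> exchange x y h \<and>
     S \<in> dimensional_subquivers Q G e \<and> S' \<in> dimensional_subquivers Q G e \<and>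
     S - S' = string_segment x h \<and> S' - S = string_segment y h"

lemma fundamental_mutation_data:
  assumes "(S, (i, k, l), S') \<in> fundamental_mutations Q G e"
  obtains h where "mutation_data S (i, k) (i, l) h S'"
proof -
  from assms obtain p p' where S: "S \<in> dimensional_subquivers Q G e" "S' \<in> dimensional_subquivers Q G e"
      and p: "traced_by G (S - S') (i, k) p" "traced_by G (S' - S) (i, l) p'"
        "map underlying_arc p = map underlying_arc p'" "k < l"
    unfolding fundamental_mutations_def mutations_def by blast
  have len: "length p = length p'"
    using p(3) by (metis length_map)
  obtain v where v: "awalk (i, k) p v" "S - S' = set (awalk_verts (i, k) p)"
    using p(1) by (auto simp: traced_by_def apath_def)
  obtain v' where v': "awalk (i, l) p' v'" "S' - S = set (awalk_verts (i, l) p')"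
    using p(2) by (auto simp: traced_by_def apath_def)
  have seg: "S - S' = string_segment (i, k) (length p)" "S' - S = string_segment (i, l) (length p)"
    using v v' awalk_verts_segment[OF v(1)] awalk_verts_segment[OF v'(1)] len by simp_all
  have G: "(i, k) \<in> verts G" "(i, l) \<in> verts G" "v' \<in> verts G"
    using v(1) v'(1) awalk_hd_in_verts awalk_last_in_verts by blast+
  then have "(i, k) \<in> S - S'" "(i, l) \<in> S' - S"
    unfolding seg by (simp_all add: string_segment_def)
  then have "\<not> same_string (i, k) (i, l)"
    using S G(2) p(4) by (intro different_strings) (auto simp: dimensional_subquivers_iff)
  moreover have "same_string (i, l) v'" "position v' = position (i, l) + length p"
    using component_of_awalk[OF v'(1)] preceding_segment_append[OF v'(1)] len by simp_all
  ultimately have "exchange (i, k) (i, l) (length p)"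
    using G p(4) by (auto simp: exchange_def)
  with S seg show thesis
    by (intro that[of "length p"]) (simp add: mutation_data_def)
qed

text \<open>A walk through the upper segment, copied down to \<open>(i, k)\<close>, has the same
  underlying path in Q, and by its length it traces the lower segment.\<close>

lemma mutation_data_fundamental:
  assumes D: "mutation_data S (i, k) (i, l) h S'"
  shows "(S, (i, k, l), S') \<in> fundamental_mutations Q G e"
proof -
  have E: "exchange (i, k) (i, l) h"
    using D by (simp add: mutation_data_def)
  then obtain v where v: "v \<in> verts G" "same_string (i, l) v" "position v = position (i, l) + h"
    by (auto simp: exchange_def)
  have G: "(i, k) \<in> verts G" "(i, l) \<in> verts G" "k < l"
    using E by (auto simp: exchange_def)
  obtain p where p: "awalk (i, l) p v" "length p = h"
    using obtain_awalk[OF G(2) v(1,2)] v(3) by auto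
  obtain p' k' where p': "awalk (i, k) p' (fst v, k')" "map underlying_arc p' = map underlying_arc p"
    using copy_awalk[OF p(1) G(1,3)] by metis
  have "length p' = h"
    using p(2) p'(2) by (metis length_map)
  then have L: "S - S' = set (awalk_verts (i, k) p')" "S' - S = set (awalk_verts (i, l) p)"
    using D awalk_verts_segment[OF p(1)] awalk_verts_segment[OF p'(1)] p(2) by (simp_all add: mutation_data_def)
  have "traced_by G (S - S') (i, k) p'" "traced_by G (S' - S) (i, l) p"
    unfolding traced_by_def apath_iff_awalk using L p(1) p'(1) by blast+
  moreover have "Digraph_Component.connected (G \<restriction> (S - S'))" "Digraph_Component.connected (G \<restriction> (S' - S))"
    unfolding L by (rule connected_awalk_verts[OF p'(1)], rule connected_awalk_verts[OF p(1)])
  ultimately show ?thesis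
    using D G(3) p'(2) unfolding fundamental_mutations_def mutations_def mutation_data_def by blast
qed

context
  fixes S x y h S'
  assumes D: "mutation_data S x y h S'"
begin

lemma mutation_exchange: "exchange x y h"
  using D by (simp add: mutation_data_def)

lemma mutation_sets:
  "S \<subseteq> verts G" "S' \<subseteq> verts G" "successor_closed G S" "successor_closed G S'" "dimensional S" "dimensional S'"
  using D by (auto simp: mutation_data_def dimensional_subquivers_iff successor_closed_def)

lemma mutation_segments: "u \<in> string_segment x h \<longleftrightarrow> u \<in> S \<and> u \<notin> S'" "v \<in> string_segment y h \<longleftrightarrow> v \<in> S' \<and> v \<notin> S"
  using D unfolding mutation_data_def by blast+

abbreviation "swap \<equiv> exchange_coeff x y h"

lemma coeff_common: "u \<in> S' \<Longrightarrow> swap c u = delta u"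
  using mutation_segments(1)[of u] by (auto simp: exchange_coeff_def paired_def)

lemma coeff_paired: "paired x y h u v \<Longrightarrow> swap c u = (\<lambda>l. delta u l + c * delta v l)"
proof
  fix l assume uv: "paired x y h u v"
  have fst: "fst u = fst v"
    by (rule paired_ends(1)[OF mutation_exchange uv])
  have "paired x y h u (fst u, l) \<longleftrightarrow> l = snd v"
    using paired_right_unique[OF uv, of "(fst u, l)"] uv fst by (metis prod.collapse snd_conv)
  then show "swap c u l = delta u l + c * delta v l"
    by (simp add: exchange_coeff_def)
qed

lemma lincomb_delta_basis: "u \<in> verts G \<Longrightarrow> lincomb (fst u) (delta u) = b (fst u) (snd u)"
  using lincomb_delta[of "snd u" "fst u"] by (cases u) (simp add: in_verts_G)

lemma lincomb_coeff_paired: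
  assumes "paired x y h u v"
  shows "lincomb (fst u) (swap c u) = b (fst u) (snd u) + rep_scale M c (b (fst v) (snd v))"
proof -
  have "lincomb (fst u) (swap c u) = lincomb (fst u) (delta u) + rep_scale M c (lincomb (fst u) (delta v))"
    by (simp add: coeff_paired[OF assms] lincomb_add scale_lincomb)
  then show ?thesis
    using pairedD[OF assms] lincomb_delta_basis[of u] lincomb_delta_basis[of v] paired_ends(1)[OF mutation_exchange assms]
    by simp
qed

lemma reduced_coeff: "reduced S (swap c)"
  unfolding reduced_def
proof (intro allI impI)
  fix i k l assume "(i, k) \<in> S" "(i, l) \<in> S"
  then have "\<not> paired x y h (i, k) (i, l)"
    using mutation_segments(2)[of "(i, l)"] by (auto simp: paired_def)
  then show "swap c (i, k) l = (if l = k then 1 else 0)"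
    by (simp add: exchange_coeff_def)
qed

lemma basis_in_family:
  assumes "u \<in> S" "u \<in> S'"
  shows "b (fst u) (snd u) \<in> span_family S (swap c) (fst u)"
proof -
  have "u \<in> verts G"
    using assms mutation_sets by blast
  moreover from this have "fst u \<in> verts Q"
    by (cases u) (simp add: in_verts_G)
  ultimately show ?thesis
    using lincomb_in_span_family[of "fst u" "snd u" S "swap c"] assms coeff_common[OF assms(2)] lincomb_delta_basis
    by simp
qed

lemma paired_in_family:
  assumes "paired x y h u v"
  shows "b (fst u) (snd u) + rep_scale M c (b (fst u) (snd v)) \<in> span_family S (swap c) (fst u)"
proof -
  have u: "u \<in> verts G" "u \<in> S"
    using pairedD[OF assms] assms mutation_segments(1) by (auto simp: paired_def)
  then have "fst u \<in> verts Q"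
    by (cases u) (simp add: in_verts_G)
  then have "lincomb (fst u) (swap c u) \<in> span_family S (swap c) (fst u)"
    using lincomb_in_span_family[of "fst u" "snd u" S "swap c"] u(2) by simp
  then show ?thesis
    by (simp only: lincomb_coeff_paired[OF assms] paired_ends(1)[OF mutation_exchange assms, symmetric])
qed

text \<open>A common row is sent to zero or to another common row. A row of a pair is sent to the
  next row of the pairs, or, at the end of the segments, into the span of common rows; the case of
  an image of \<open>b ?i l\<close> equal to zero needs an argument that the lower segment ends
  there too.\<close>

lemma family_in_X: "span_family S (swap c) \<in> X"
proof (rule span_family_in_X[OF mutation_sets(5) reduced_coeff])
  fix a k assume a: "a \<in> arcs Q" and k: "(tail Q a, k) \<in> S"
  let ?i = "tail Q a" and ?j = "head Q a"
  let ?W = "span_family S (swap c) ?j"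
  have W: "subspace ?W"
    by (rule span_family_subspace[OF ends_Q(2)[OF a]])
  have kG: "(?i, k) \<in> verts G"
    using k mutation_sets(1) by blast
  then have kr: "k \<in> range_of ?i"
    by (simp add: in_verts_G)
  show "rep_map M a (lincomb ?i (swap c (?i, k))) \<in> ?W"
  proof (cases "(?i, k) \<in> S'")
    case True
    from a kr have "rep_map M a (b ?i k) \<in> ?W"
    proof (cases rule: rep_map_basis_cases)
      case 1
      then show ?thesis using subspace_0[OF W] by simp
    next
      case (2 m)
      then have "(?j, m) \<in> S" "(?j, m) \<in> S'"
        using mutation_sets(3,4) k True by (force simp: successor_closed_def ends_G)+
      then show ?thesis
        using basis_in_family[of "(?j, m)" c] 2(3) by simp
    qed
    then show ?thesis
      using coeff_common[OF True, of c] lincomb_delta_basis[OF kG] by simp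
  next
    case False
    then have ks: "(?i, k) \<in> string_segment x h"
      using k mutation_segments(1) by blast
    obtain l where uv: "paired x y h (?i, k) (?i, l)"
      by (rule exchange_left[OF mutation_exchange ks]) (use that in simp)
    note uv' = pairedD[OF uv]
    have lr: "l \<in> range_of ?i"
      using uv'(5) by (simp add: in_verts_G)
    have spaces: "b ?i k \<in> rep_space M ?i" "b ?i l \<in> rep_space M ?i"
      using basis_in_space[OF ends_Q(1)[OF a]] kr lr by auto
    have eq: "rep_map M a (lincomb ?i (swap c (?i, k))) = rep_map M a (b ?i k) + rep_scale M c (rep_map M a (b ?i l))"
      using lincomb_coeff_paired[OF uv, of c] rep_map_add[OF a spaces(1)] rep_map_scale[OF a spaces(2)]
        subspace_scale[OF subspace_space[OF ends_Q(1)[OF a]] spaces(2)] by simp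
    from a lr show ?thesis
    proof (cases rule: rep_map_basis_cases)
      case 1
      from a kr have "rep_map M a (b ?i k) \<in> ?W"
      proof (cases rule: rep_map_basis_cases)
        case 1
        then show ?thesis using subspace_0[OF W] by simp
      next
        case (2 m)
        \<comment> \<open>If the lower segment went on, so would the upper one. The arrow leaving
          \<open>(?i, l)\<close> would be copied to the only arrow leaving \<open>(?i, k)\<close>,
          hence lie over \<open>a\<close>, although \<open>a\<close> kills
          \<open>b ?i l\<close>.\<close>
        have "(?j, m) \<notin> string_segment x h"
        proof
          assume ms: "(?j, m) \<in> string_segment x h"
          obtain l' where l': "paired x y h (?j, m) (?j, l')"
            by (rule exchange_left[OF mutation_exchange ms]) (use that in simp)
          have "position (?j, m) = position (?i, k) + 1"
            using preceding_segment_head[OF 2(1)] by (simp add: ends_G)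
          then have pos: "position (?i, l) < position (?j, l')"
            using pairedD(9)[OF l'] uv'(9) by linarith
          obtain a' where a': "a' \<in> arcs G" "tail G a' = (?i, l)"
            using obtain_out_arc[OF uv'(5) pairedD(5)[OF l'] _ pos] pairedD(6)[OF l'] uv'(6) by metis
          obtain c' v' where c': "a' = ((?i, l), c', v')"
            using a'(2) by (cases a') (simp add: ends_G)
          then have arc: "((?i, l), c', v') \<in> arcs G"
            using a'(1) by simp
          obtain n where "((?i, k), c', (fst v', n)) \<in> arcs G"
            using paired_arc[OF mutation_exchange uv arc] by metis
          then have "((?i, k), c', (fst v', n)) = ((?i, k), a, (?j, m))"
            by (rule arc_tail_unique[OF _ 2(1)]) (simp add: ends_G)
          then have c'a: "c' = a" by simp
          then have "rep_map M a (b ?i l) = b ?j (snd v')" "snd v' \<in> range_of ?j"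
            using arc by (auto simp: in_arcs_G)
          then show False
            using \<open>rep_map M a (b ?i l) = 0\<close> basis_nonzero[OF ends_Q(2)[OF a]] by metis
        qed
        moreover have "(?j, m) \<in> S"
          using mutation_sets(3) k 2(1) by (force simp: successor_closed_def ends_G)
        ultimately have "(?j, m) \<in> S" "(?j, m) \<in> S'"
          using mutation_segments(1) by blast+
        then show ?thesis
          using basis_in_family[of "(?j, m)" c] 2(3) by simp
      qed
      then show ?thesis
        using 1 eq by simp
    next
      case (2 l')
      obtain k' where k': "((?i, k), a, (?j, k')) \<in> arcs G"
        "position (?j, l') \<le> position y + h \<Longrightarrow> paired x y h (?j, k') (?j, l')"
        "position (?j, l') = position (?i, l) + 1" "position (?j, k') = position (?i, k) + 1"
        "same_string (?j, l') y" "same_string (?j, k') x"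
        using paired_arc[OF mutation_exchange uv 2(1)] by (metis fst_conv)
      have Mk: "rep_map M a (b ?i k) = b ?j k'"
        using k'(1) by (simp add: in_arcs_G)
      show ?thesis
      proof (cases "position (?j, l') \<le> position y + h")
        case True
        from paired_in_family[OF k'(2)[OF True], of c] show ?thesis
          using eq Mk 2(3) by simp
      next
        case False
        \<comment> \<open>Both heads are now past the ends of their segments; each is a successor in
          its own subquiver and outside the exchanged part, hence common to \<open>S\<close> and
          \<open>S'\<close>.\<close>
        have "(?j, l') \<in> S'"
          using mutation_sets(4) mutation_segments(2)[of "(?i, l)"] uv 2(1) by (force simp: successor_closed_def ends_G paired_def)
        moreover have "(?j, l') \<notin> string_segment y h"
          using False by (simp add: string_segment_def)
        ultimately have l'S: "(?j, l') \<in> S" "(?j, l') \<in> S'"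
          using mutation_segments(2) by blast+
        have "(?j, k') \<in> S"
          using mutation_sets(3) k k'(1) by (force simp: successor_closed_def ends_G)
        moreover have "(?j, k') \<notin> string_segment x h"
          using False k'(3,4) uv'(9) by (simp add: string_segment_def)
        ultimately have k'S: "(?j, k') \<in> S" "(?j, k') \<in> S'"
          using mutation_segments(1) by blast+
        have "b ?j k' + rep_scale M c (b ?j l') \<in> ?W"
          using basis_in_family[OF k'S, of c] basis_in_family[OF l'S, of c]
          by (intro subspace_add[OF W] subspace_scale[OF W]) simp_all
        then show ?thesis
          using eq Mk 2(3) by simp
      qed
    qed
  qed
qed

lemma family_zero: "span_family S (swap 0) = pt S"
  using mutation_sets(1) by (simp add: pt_eq_span_family exchange_coeff_def[abs_def])

lemma family_inj: "span_family S (swap c) = span_family S (swap c') \<Longrightarrow> c = c'"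
proof -
  assume eq: "span_family S (swap c) = span_family S (swap c')"
  have xy: "paired x y h x y" "fst x = fst y" "snd x < snd y"
    using paired_start[OF mutation_exchange] mutation_exchange by (auto simp: exchange_def)
  have "x \<in> S"
    using xy(1) mutation_segments(1) by (simp add: paired_def)
  moreover have "snd y \<in> range_of (fst x)"
    using pairedD(5)[OF xy(1)] xy(2) by (cases y) (simp add: in_verts_G)
  ultimately have "swap c x (snd y) = swap c' x (snd y)"
    using span_family_eq_imp[OF mutation_sets(1) reduced_coeff reduced_coeff, of c "fst x" c' "snd x" "snd y"] eq by simp
  then show ?thesis
    using coeff_paired[OF xy(1)] xy(3) by simp
qed

definition edge_weight :: "(('v, 'e) torus_index \<Rightarrow> complex) \<Rightarrow> complex" where
  "edge_weight t = scal t y / scal t x"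

text \<open>All pairs are scaled by the same factor by \<open>scal_paired\<close>, so the torus acts
  on the curve merely by rescaling its parameter.\<close>

lemma act_family:
  assumes t: "t \<in> torus I"
  shows "act t (span_family S (swap c)) = span_family S (swap (edge_weight t * c))"
  unfolding act_span_family_translate[OF t mutation_sets(1)]
proof (rule span_family_cong)
  fix i k l assume k: "(i, k) \<in> S"
  have nz: "scal t (i, k) \<noteq> 0" "scal t x \<noteq> 0"
    using scal_nonzero[OF t] k mutation_sets(1) mutation_exchange by (auto simp: exchange_def)
  show "translate t (swap c) (i, k) l = swap (edge_weight t * c) (i, k) l"
  proof (cases "paired x y h (i, k) (i, l)")
    case True
    have "l \<noteq> k"
      using paired_ends(2)[OF mutation_exchange True] by simp
    moreover have "scal t (i, l) / scal t (i, k) = edge_weight t"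
      using scal_paired[OF mutation_exchange True, of t] nz by (simp add: edge_weight_def field_simps)
    ultimately show ?thesis
      using True by (simp add: translate_def exchange_coeff_def) (metis mult.commute times_divide_eq_right)
  next
    case False
    then show ?thesis
      using nz by (simp add: translate_def exchange_coeff_def)
  qed
qed

lemma edge_weight_nonzero: "t \<in> torus I \<Longrightarrow> edge_weight t \<noteq> 0"
  using scal_nonzero mutation_exchange by (simp add: edge_weight_def exchange_def)

text \<open>Positivity of the exponent is what orients the edge: \<open>x\<close> has the smaller
  index, and an attractive grading grows with the index.\<close>

lemma edge_weight_\<eta>:
  assumes "z \<noteq> 0"
  shows "edge_weight (\<eta> z) = z ^ nat (wt y - wt x)" "0 < nat (wt y - wt x)"
proof -
  have xy: "x \<in> verts G" "y \<in> verts G" "fst x = fst y" "snd x < snd y"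
    using mutation_exchange by (auto simp: exchange_def)
  have less: "wt x < wt y"
    using wt_less[of "fst x" "snd x" "snd y"] xy by (metis prod.collapse)
  then show "0 < nat (wt y - wt x)" by simp
  have "edge_weight (\<eta> z) = z powi (wt y - wt x)"
    using scal_\<eta>[OF assms, of "fst x" "snd x"] scal_\<eta>[OF assms, of "fst y" "snd y"] xy(1,2) assms
    by (simp add: edge_weight_def power_int_diff)
  also have "\<dots> = z ^ nat (wt y - wt x)"
    using less by (simp add: power_int_def)
  finally show "edge_weight (\<eta> z) = z ^ nat (wt y - wt x)" .
qed

text \<open>The cocharacter alone is transitive on the non-zero parameters, since every complex
  number has a root of the required order.\<close>

lemma orbit_family:
  assumes "c \<noteq> 0"
  shows "orbit (span_family S (swap c)) = (\<lambda>c. span_family S (swap c)) ` (UNIV - {0})"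
proof (intro equalityI subsetI)
  fix W assume "W \<in> orbit (span_family S (swap c))"
  then obtain t where t: "t \<in> torus I" "W = act t (span_family S (swap c))" by blast
  then have "W = span_family S (swap (edge_weight t * c))"
    by (simp only: act_family)
  moreover have "edge_weight t * c \<in> UNIV - {0}"
    using edge_weight_nonzero[OF t(1)] assms by simp
  ultimately show "W \<in> (\<lambda>c. span_family S (swap c)) ` (UNIV - {0})"
    by (rule image_eqI)
next
  fix W assume "W \<in> (\<lambda>c. span_family S (swap c)) ` (UNIV - {0})"
  then obtain c' where c': "c' \<noteq> 0" "W = span_family S (swap c')" by blast
  have n: "nat (wt y - wt x) \<noteq> 0"
    using edge_weight_\<eta>(2)[of 1] by simp
  obtain z where z: "c' / c = z ^ nat (wt y - wt x)"
    by (rule exists_complex_root[OF n]) (rule that)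
  have "z \<noteq> 0"
  proof
    assume "z = 0"
    then have "c' / c = 0"
      using z n by (simp add: zero_power)
    with c'(1) assms show False by simp
  qed
  then have "edge_weight (\<eta> z) = c' / c"
    unfolding z by (rule edge_weight_\<eta>(1))
  then have "edge_weight (\<eta> z) * c = c'"
    using assms by simp
  then have "act (\<eta> z) (span_family S (swap c)) = W"
    using act_family[OF \<eta>_torus[OF \<open>z \<noteq> 0\<close>]] c'(2) by simp
  then show "W \<in> orbit (span_family S (swap c))"
    using \<eta>_torus[OF \<open>z \<noteq> 0\<close>] by blast
qed

lemma irreducible_curve_coeff: "irreducible_curve Zar UNIV (\<lambda>c. span_family S (swap c))"
proof (rule irreducible_curve_family[OF infinite_UNIV_char_0 mutation_sets(5)])
  fix i k l
  show "\<exists>q. \<forall>z\<in>UNIV. swap z (i, k) l = poly q z"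
    by (intro exI[of _ "[:delta (i, k) l, if paired x y h (i, k) (i, l) then 1 else 0:]"])
       (simp add: exchange_coeff_def)
qed (rule family_in_X)

lemma limit_coeff:
  assumes "c \<noteq> 0"
  shows "limitin Cls (\<lambda>z. act (\<eta> z) (span_family S (swap c))) (pt S) (at 0)"
proof -
  let ?n = "nat (wt y - wt x)"
  have n: "0 < ?n"
    by (rule edge_weight_\<eta>(2)[of 1]) simp
  have "limitin Cls (\<lambda>z. span_family S (swap (z ^ ?n * c))) (span_family S (swap 0)) (at 0)"
  proof (rule limitin_family[OF mutation_sets(5)])
    fix i k l
    have "((\<lambda>z. swap (z ^ ?n * c) (i, k) l) \<longlongrightarrow> swap (0 ^ ?n * c) (i, k) l) (at 0)"
      unfolding exchange_coeff_def fst_conv snd_conv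
      by (cases "paired x y h (i, k) (i, l)") (auto intro!: tendsto_intros)
    moreover have "0 ^ ?n * c = 0"
      using n by (simp add: zero_power)
    ultimately show "((\<lambda>z. swap (z ^ ?n * c) (i, k) l) \<longlongrightarrow> swap 0 (i, k) l) (at 0)"
      by (simp only:)
  qed (simp_all add: family_in_X)
  moreover have "eventually (\<lambda>z. span_family S (swap (z ^ ?n * c)) = act (\<eta> z) (span_family S (swap c))) (at 0)"
    unfolding eventually_at_filter
    by (rule always_eventually) (simp add: act_family \<eta>_torus edge_weight_\<eta>(1))
  ultimately show ?thesis
    unfolding family_zero by (rule limitin_transform_eventually[rotated])
qed

end

lemma X_in_prod: "U \<in> X \<Longrightarrow> U \<in> prod_grassmannian Q M e"
  by (simp add: quiver_grassmannian_def)

lemma X_subspace: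
  assumes "U \<in> X" "i \<in> verts Q"
  shows "subspace (U i)" "U i \<subseteq> rep_space M i"
  using assms by (auto simp: quiver_grassmannian_def prod_grassmannian_def PiE_iff)

lemma vertex_basis:
  assumes "u \<in> verts G"
  shows "fst u \<in> verts Q" "snd u \<in> range_of (fst u)" "b (fst u) (snd u) \<in> rep_space M (fst u)"
    "b (fst u) (snd u) \<noteq> 0"
  using assms basis_in_space basis_nonzero by (cases u; simp add: in_verts_G)+

lemma scal_regular: "u \<in> verts G \<Longrightarrow> (\<lambda>t. scal t u) \<in> torus_regular I"
  and inverse_scal_regular: "u \<in> verts G \<Longrightarrow> (\<lambda>t. inverse (scal t u)) \<in> torus_regular I"
proof -
  assume u: "u \<in> verts G"
  have "(\<lambda>t. \<Prod>y\<leftarrow>p. t (Inr (underlying_arc y))) \<in> torus_regular I \<and>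
      (\<lambda>t. inverse (\<Prod>y\<leftarrow>p. t (Inr (underlying_arc y)))) \<in> torus_regular I" if "set p \<subseteq> arcs G" for p
    using that
  proof (induction p)
    case (Cons y p)
    then have y: "Inr (underlying_arc y) \<in> I"
      by (intro Inr_in_I) simp
    with Cons show ?case
      using torus_regular.mult[OF torus_regular.coord[OF y]] torus_regular.mult[OF torus_regular.inv_coord[OF y]]
      by simp
  qed (simp add: torus_regular.const)
  note p = this[OF preceding_segment_arcs[OF u]]
  show "(\<lambda>t. scal t u) \<in> torus_regular I" "(\<lambda>t. inverse (scal t u)) \<in> torus_regular I"
    unfolding scaling_factor_def inverse_mult_distrib
    using torus_regular.mult[OF torus_regular.coord[OF Inl_in_I[OF u]] p[THEN conjunct1]]
      torus_regular.mult[OF torus_regular.inv_coord[OF Inl_in_I[OF u]] p[THEN conjunct2]]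
    by simp_all
qed

lemma scal_mult:
  assumes "u \<in> verts G"
  shows "scal (torus_mult I s t) u = scal s u * scal t u"
proof -
  have "(\<Prod>y\<leftarrow>p. torus_mult I s t (Inr (underlying_arc y))) =
      (\<Prod>y\<leftarrow>p. s (Inr (underlying_arc y))) * (\<Prod>y\<leftarrow>p. t (Inr (underlying_arc y)))" if "set p \<subseteq> arcs G" for p
    using that by (induction p) (simp_all add: torus_mult_def Inr_in_I)
  from this[OF preceding_segment_arcs[OF assms]] show ?thesis
    using Inl_in_I[OF assms] by (simp add: scaling_factor_def torus_mult_def)
qed

text \<open>One of the two bracketed terms in the label of an edge; on the torus its value is the
  scaling factor of \<open>u\<close>.\<close>

definition path_char :: "'v \<times> nat \<Rightarrow> (('v, 'e) torus_index \<Rightarrow> complex) \<Rightarrow> complex" where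
  "path_char u = char_sum I (eps_char I (component_of G u) #
     map (delta_char I \<circ> underlying_arc) (preceding_segment G u))"

lemma path_char: "t \<in> torus I \<Longrightarrow> path_char u t = scal t u"
  by (simp add: path_char_def char_sum_def eps_char_def delta_char_def scaling_factor_def comp_def)

section \<open>Closure, dimension and label of an edge\<close>

context
  fixes S x y h S'
  assumes D: "mutation_data S x y h S'"
begin

abbreviation "fam c \<equiv> span_family S (swap x y h c)"
abbreviation "edge \<equiv> fam ` (UNIV - {0})"

text \<open>The same curve seen from its other end: \<open>b_v + c b_u\<close> is \<open>c\<close>
  times \<open>b_u + (1/c) b_v\<close>. With pivots in \<open>S'\<close> the matrix also makes sense
  at \<open>c = 0\<close>, where the original parameter becomes infinite.\<close>

definition rev_coeff :: "complex \<Rightarrow> 'v \<times> nat \<Rightarrow> nat \<Rightarrow> complex" where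
  "rev_coeff c v l = delta v l + (if paired x y h (fst v, l) v then c else 0)"

lemma reduced_rev: "reduced S' (rev_coeff c)"
  unfolding reduced_def
proof (intro allI impI)
  fix i k l assume "(i, k) \<in> S'" "(i, l) \<in> S'"
  then have "\<not> paired x y h (i, l) (i, k)"
    using mutation_segments(1)[OF D, of "(i, l)"] by (auto simp: paired_def)
  then show "rev_coeff c (i, k) l = (if l = k then 1 else 0)"
    by (simp add: rev_coeff_def)
qed

lemma family_rev:
  assumes "c \<noteq> 0"
  shows "span_family S' (rev_coeff c) = fam (inverse c)"
proof (rule prod_grassmannian_eqI)
  show "span_family S' (rev_coeff c) \<in> prod_grassmannian Q M e"
    by (rule span_family_in_prod[OF mutation_sets(6)[OF D] reduced_rev])
  show "fam (inverse c) \<in> prod_grassmannian Q M e"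
    by (rule X_in_prod[OF family_in_X[OF D]])
  fix i assume i: "i \<in> verts Q"
  have W: "subspace (fam (inverse c) i)"
    by (rule span_family_subspace[OF i])
  have "lincomb i (rev_coeff c (i, k)) \<in> fam (inverse c) i" if k: "(i, k) \<in> S'" for k
  proof (cases "(i, k) \<in> S")
    case True
    then have "rev_coeff c (i, k) = delta (i, k)"
      using mutation_segments(2)[OF D, of "(i, k)"] by (auto simp: rev_coeff_def paired_def)
    then show ?thesis
      using basis_in_family[OF D True k, of "inverse c"] lincomb_delta_basis[OF D, of "(i, k)"] k mutation_sets(2)[OF D] by auto
  next
    case False
    then have "(i, k) \<in> string_segment y h"
      using k mutation_segments(2)[OF D] by blast
    then obtain m where m: "paired x y h (i, m) (i, k)"
      by (rule exchange_right[OF mutation_exchange[OF D]]) simp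
    have "paired x y h (i, l) (i, k) \<longleftrightarrow> l = m" for l
      using paired_left_unique[OF m, of "(i, l)"] m by auto
    then have "rev_coeff c (i, k) = (\<lambda>l. delta (i, k) l + c * delta (i, m) l)"
      by (auto simp: rev_coeff_def)
    then have "lincomb i (rev_coeff c (i, k)) = lincomb i (delta (i, k)) + rep_scale M c (lincomb i (delta (i, m)))"
      by (simp only: lincomb_add scale_lincomb)
    also have "\<dots> = b i k + rep_scale M c (b i m)"
      using lincomb_delta_basis[OF D pairedD(1)[OF m]] lincomb_delta_basis[OF D pairedD(5)[OF m]] by simp
    also have "\<dots> = rep_scale M c (b i m + rep_scale M (inverse c) (b i k))"
      using assms by (simp add: scale_right_distrib add.commute)
    also have "\<dots> \<in> fam (inverse c) i"
      using paired_in_family[OF D m, of "inverse c"] by (intro subspace_scale[OF W]) simp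
    finally show ?thesis .
  qed
  then show "span_family S' (rev_coeff c) i \<subseteq> fam (inverse c) i"
    using i W unfolding span_family_def[of S' "rev_coeff c"] by (simp add: span_minimal image_subset_iff)
qed

lemma family_rev_zero: "span_family S' (rev_coeff 0) = pt S'"
  using mutation_sets(2)[OF D] by (simp add: pt_eq_span_family rev_coeff_def[abs_def])

lemma mutation_dimensional: "S \<in> dimensional_subquivers Q G e" "S' \<in> dimensional_subquivers Q G e"
  using D by (simp_all add: mutation_data_def)

lemma irreducible_curve_rev: "irreducible_curve Zar UNIV (\<lambda>c. span_family S' (rev_coeff c))"
proof (rule irreducible_curve_family[OF infinite_UNIV_char_0 mutation_sets(6)[OF D]])
  fix i k l
  show "\<exists>q. \<forall>z\<in>UNIV. rev_coeff z (i, k) l = poly q z"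
    by (intro exI[of _ "[:delta (i, k) l, if paired x y h (i, l) (i, k) then 1 else 0:]"])
       (simp add: rev_coeff_def)
next
  fix c :: complex
  show "span_family S' (rev_coeff c) \<in> X"
  proof (cases "c = 0")
    case True
    then show ?thesis
      using pt_in_X[OF mutation_dimensional(2)] family_rev_zero by simp
  next
    case False
    then show ?thesis
      using family_in_X[OF D] family_rev by simp
  qed
qed

lemma infinite_nonzero: "infinite (UNIV - {0 :: complex})"
  by (metis finite_Diff2 finite.emptyI finite_insert infinite_UNIV_char_0)

text \<open>The closure contains the curve at infinitely many parameters, hence at all of them,
  including 0.\<close>

lemma curve_limit_in_closure:
  assumes g: "irreducible_curve Zar UNIV g" and E: "\<And>c. c \<noteq> 0 \<Longrightarrow> g c \<in> T" and T: "T \<subseteq> X"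
  shows "g (0 :: complex) \<in> Zar closure_of T"
proof -
  have "UNIV - {0} \<subseteq> {z \<in> UNIV. g z \<in> Zar closure_of T}"
    using E closure_of_subset[of T Zar] T by (auto simp: topspace_Zar)
  then have "infinite {z \<in> UNIV. g z \<in> Zar closure_of T}"
    using infinite_nonzero infinite_super by blast
  then have "g ` UNIV \<subseteq> Zar closure_of T"
    using irreducible_curveD(3)[OF g closedin_closure_of] by blast
  then show ?thesis by blast
qed

lemma edge_subset: "edge \<subseteq> X"
  using family_in_X[OF D] by blast

lemma ends_in_closure: "pt S \<in> Zar closure_of edge" "pt S' \<in> Zar closure_of edge"
proof -
  show "pt S \<in> Zar closure_of edge"
    using curve_limit_in_closure[OF irreducible_curve_coeff[OF D] _ edge_subset] family_zero[OF D] by simp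
  have "span_family S' (rev_coeff c) \<in> edge" if "c \<noteq> 0" for c
    using family_rev[OF that] that by simp
  then show "pt S' \<in> Zar closure_of edge"
    using curve_limit_in_closure[OF irreducible_curve_rev _ edge_subset] family_rev_zero by simp
qed

text \<open>Closed conditions pass from the edge to its closure. Applied to lines and planes spanned
  by basis vectors, this produces explicit vectors in an unknown limit point.\<close>

lemma closure_meets:
  assumes P: "subspace P" and i: "i \<in> verts Q" and E: "\<And>c. \<exists>w\<in>fam c i \<inter> P. w \<noteq> 0"
    and W: "W \<in> Zar closure_of edge"
  obtains w where "w \<in> W i" "w \<in> P" "w \<noteq> 0"
proof -
  have "edge \<subseteq> {W \<in> X. \<exists>w\<in>W i \<inter> P. w \<noteq> 0}"
    using E family_in_X[OF D] by blast
  then have "Zar closure_of edge \<subseteq> {W \<in> X. \<exists>w\<in>W i \<inter> P. w \<noteq> 0}"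
    by (rule closure_of_minimal[OF _ closedin_meets_subspace[OF P i]])
  with W have "\<exists>w\<in>W i \<inter> P. w \<noteq> 0" by blast
  with that show thesis by blast
qed

lemma closure_common:
  assumes W: "W \<in> Zar closure_of edge" and u: "u \<in> S" "u \<in> S'"
  shows "b (fst u) (snd u) \<in> W (fst u)"
proof -
  have uG: "u \<in> verts G"
    using u mutation_sets(1)[OF D] by blast
  have WX: "W \<in> X"
    using W closure_of_subset_topspace[of Zar edge] by (auto simp: topspace_Zar)
  have "b (fst u) (snd u) \<in> fam c (fst u) \<inter> span {b (fst u) (snd u)}" for c
    using basis_in_family[OF D u] span_base by simp
  then obtain w where w: "w \<in> W (fst u)" "w \<in> span {b (fst u) (snd u)}" "w \<noteq> 0"
    using closure_meets[OF subspace_span vertex_basis(1)[OF uG] _ W] vertex_basis(4)[OF uG] by metis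
  then obtain c where c: "w = rep_scale M c (b (fst u) (snd u))"
    by (auto simp: span_singleton)
  have "rep_scale M (inverse c) w \<in> W (fst u)"
    by (rule subspace_scale[OF X_subspace(1)[OF WX vertex_basis(1)[OF uG]] w(1)])
  moreover have "rep_scale M (inverse c) w = b (fst u) (snd u)"
    using w(3) by (auto simp: c)
  ultimately show ?thesis by simp
qed

text \<open>A point \<open>W\<close> of the closure meets the plane of \<open>b_x\<close> and
  \<open>b_y\<close> in some \<open>s b_x + t b_y\<close>. The ratio of \<open>s\<close> and
  \<open>t\<close> then determines \<open>W\<close>, because these vectors and the common rows
  already have the full dimension.\<close>

lemma closure_edge: "Zar closure_of edge = edge \<union> {pt S, pt S'}"
proof
  show "edge \<union> {pt S, pt S'} \<subseteq> Zar closure_of edge"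
    using ends_in_closure closure_of_subset[of edge Zar] edge_subset by (auto simp: topspace_Zar)
  show "Zar closure_of edge \<subseteq> edge \<union> {pt S, pt S'}"
  proof
    fix W assume W: "W \<in> Zar closure_of edge"
    have WX: "W \<in> X"
      using W closure_of_subset_topspace[of Zar edge] by (auto simp: topspace_Zar)
    note E = mutation_exchange[OF D]
    note xy = paired_start[OF E]
    note xG = pairedD(1)[OF xy] and yG = pairedD(5)[OF xy]
    have fy: "fst x = fst y" "snd x \<noteq> snd y"
      using paired_ends[OF E xy] by simp_all
    let ?i = "fst x"
    have i: "?i \<in> verts Q"
      by (rule vertex_basis(1)[OF xG])
    have nz: "b ?i (snd x) + rep_scale M c (b ?i (snd y)) \<noteq> 0" for c
    proof
      assume "b ?i (snd x) + rep_scale M c (b ?i (snd y)) = 0"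
      then have "coord ?i (b ?i (snd x) + rep_scale M c (b ?i (snd y))) (snd x) = 0"
        by (simp add: coord_zero)
      moreover have "b ?i (snd y) \<in> rep_space M ?i" "snd y \<in> range_of ?i"
        using vertex_basis[OF yG] fy(1) by simp_all
      moreover have "coord ?i (b ?i (snd y)) (snd x) = 0"
        using coord_basis[OF i calculation(3) vertex_basis(2)[OF xG]] fy(2) by simp
      ultimately show False
        using coord_basis[OF i vertex_basis(2)[OF xG] vertex_basis(2)[OF xG]] vertex_basis(3)[OF xG]
        by (simp add: coord_add[OF i] coord_scale[OF i] subspace_scale[OF subspace_space[OF i]])
    qed
    have "b ?i (snd x) + rep_scale M c (b ?i (snd y)) \<in> fam c ?i \<inter> span {b ?i (snd x), b ?i (snd y)}" for c
      using paired_in_family[OF D xy, of c] by (simp add: span_add span_scale span_base)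
    then have "\<exists>w\<in>fam c ?i \<inter> span {b ?i (snd x), b ?i (snd y)}. w \<noteq> 0" for c
      using nz[of c] by blast
    then obtain w where w: "w \<in> W ?i" "w \<in> span {b ?i (snd x), b ?i (snd y)}" "w \<noteq> 0"
      using closure_meets[OF subspace_span i _ W] by metis
    obtain s where "w - rep_scale M s (b ?i (snd x)) \<in> span {b ?i (snd y)}"
      using w(2) by (auto simp: span_insert)
    then obtain t where "w - rep_scale M s (b ?i (snd x)) = rep_scale M t (b ?i (snd y))"
      by (auto simp: span_singleton)
    then have w_eq: "w = rep_scale M s (b ?i (snd x)) + rep_scale M t (b ?i (snd y))"
      by (simp add: algebra_simps)
    \<comment> \<open>\<open>W\<close> is a subrepresentation, so applying parallel arrows carries
      the vector with the same coefficients \<open>s\<close> and \<open>t\<close> along all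
      pairs.\<close>
    have along: "rep_scale M s (b (fst u) (snd u)) + rep_scale M t (b (fst u) (snd v)) \<in> W (fst u)"
      if "paired x y h u v" for u v
      using E that
    proof (induction rule: paired_induct)
      case start
      show ?case
        using w(1) w_eq by simp
    next
      case (step u v a u' v')
      have uG: "u \<in> verts G" and vG: "v \<in> verts G"
        using pairedD[OF step.hyps(1)] by blast+
      have fst: "fst u = fst v" "fst u' = fst v'"
        using paired_ends(1)[OF E] step.hyps(1,2) by blast+
      have a: "a \<in> arcs Q" "fst u = tail Q a" "fst u' = head Q a"
          "rep_map M a (b (tail Q a) (snd u)) = b (head Q a) (snd u')"
          "rep_map M a (b (tail Q a) (snd v)) = b (head Q a) (snd v')"
        using step.hyps(3,4) by (auto simp: in_arcs_G)
      have sp: "b (tail Q a) (snd u) \<in> rep_space M (tail Q a)" "b (tail Q a) (snd v) \<in> rep_space M (tail Q a)"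
        using vertex_basis(3)[OF uG] vertex_basis(3)[OF vG] fst a(2) by simp_all
      have "rep_map M a (rep_scale M s (b (fst u) (snd u)) + rep_scale M t (b (fst u) (snd v))) \<in> W (head Q a)"
        using WX step.IH a(1,2) by (auto simp: quiver_grassmannian_def)
      then show ?case
        using a sp ends_Q(1)[OF a(1)]
        by (simp add: rep_map_add rep_map_scale subspace_scale subspace_space)
    qed
    have Wsub: "subspace (W j)" if "j \<in> verts Q" for j
      by (rule X_subspace(1)[OF WX that])
    show "W \<in> edge \<union> {pt S, pt S'}"
    proof (cases "s = 0")
      case False
      have "fam (t / s) = W"
      proof (rule prod_grassmannian_eqI[OF X_in_prod[OF family_in_X[OF D]] X_in_prod[OF WX]])
        fix j assume j: "j \<in> verts Q"
        have "lincomb j (swap x y h (t / s) (j, k)) \<in> W j" if k: "(j, k) \<in> S" for k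
        proof (cases "(j, k) \<in> S'")
          case True
          then show ?thesis
            using closure_common[OF W k True] coeff_common[OF D True] lincomb_delta_basis[OF D, of "(j, k)"]
              k mutation_sets(1)[OF D] by auto
        next
          case kS': False
          then have "(j, k) \<in> string_segment x h"
            using k mutation_segments(1)[OF D] by blast
          then obtain l where l: "paired x y h (j, k) (j, l)"
            by (rule exchange_left[OF E]) simp
          have "lincomb j (swap x y h (t / s) (j, k)) = b j k + rep_scale M (t / s) (b j l)"
            using lincomb_coeff_paired[OF D l] by simp
          also have "\<dots> = rep_scale M (inverse s) (rep_scale M s (b j k) + rep_scale M t (b j l))"
            using False by (simp add: scale_right_distrib divide_inverse mult.commute)
          also have "\<dots> \<in> W j"
            using along[OF l] by (intro subspace_scale[OF Wsub[OF j]]) simp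
          finally show ?thesis .
        qed
        then show "fam (t / s) j \<subseteq> W j"
          using j Wsub[OF j] unfolding span_family_def by (simp add: span_minimal image_subset_iff)
      qed
      \<comment> \<open>The parameter \<open>t / s\<close> may be 0, in which case the family is the
        end \<open>pt S\<close> and not a point of \<open>edge\<close>.\<close>
      then show ?thesis
        using family_zero[OF D] by (cases "t / s = 0") auto
    next
      case True
      have t: "t \<noteq> 0"
        using w(3) w_eq True by auto
      have "pt S' = W"
      proof (rule prod_grassmannian_eqI[OF X_in_prod[OF pt_in_X[OF mutation_dimensional(2)]] X_in_prod[OF WX]])
        fix j assume j: "j \<in> verts Q"
        have "b j k \<in> W j" if k: "(j, k) \<in> S'" for k
        proof (cases "(j, k) \<in> S")
          case True
          then show ?thesis
            using closure_common[OF W True k] by simp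
        next
          case False
          then have "(j, k) \<in> string_segment y h"
            using k mutation_segments(2)[OF D] by blast
          then obtain m where m: "paired x y h (j, m) (j, k)"
            by (rule exchange_right[OF E]) simp
          have "rep_scale M t (b j k) \<in> W j"
            using along[OF m] True by simp
          then have "rep_scale M (inverse t) (rep_scale M t (b j k)) \<in> W j"
            by (rule subspace_scale[OF Wsub[OF j]])
          then show ?thesis
            using t by simp
        qed
        then show "pt S' j \<subseteq> W j"
          using j Wsub[OF j] unfolding subquiver_point_def by (simp add: span_minimal image_subset_iff)
      qed
      then show ?thesis by blast
    qed
  qed
qed

text \<open>A closed set pulls back along \<open>fam\<close> to finitely many parameters or to all
  of them, so the edge carries the topology required by \<open>krull_dim_cofinite\<close>.\<close>

lemma krull_dim_edge: "krull_dim (subtopology Zar edge) = 1"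
proof (rule krull_dim_cofinite)
  have top: "topspace (subtopology Zar edge) = edge"
    using edge_subset by (auto simp: topspace_Zar)
  have inj: "inj fam"
    using family_inj[OF D] by (rule injI)
  show "infinite (topspace (subtopology Zar edge))"
    unfolding top using infinite_nonzero finite_imageD[OF _ inj_on_subset[OF inj subset_UNIV]] by blast
  show "closedin (subtopology Zar edge) {W}" if "W \<in> topspace (subtopology Zar edge)" for W
  proof -
    have W: "W \<in> edge"
      using that top by blast
    then have "closedin (subtopology Zar edge) (edge \<inter> {W})"
      using edge_subset by (intro closedin_subtopology_Int_closed closedin_point) blast
    moreover have "edge \<inter> {W} = {W}"
      using W by blast
    ultimately show ?thesis by (simp only:)
  qed
  fix A assume "closedin (subtopology Zar edge) A"
  then obtain B where B: "closedin Zar B" "A = B \<inter> edge"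
    by (auto simp: closedin_subtopology)
  from irreducible_curveD(3)[OF irreducible_curve_coeff[OF D] B(1)]
  show "finite A \<or> A = topspace (subtopology Zar edge)"
  proof
    assume "finite {z \<in> UNIV. fam z \<in> B}"
    then have "finite (fam ` {z \<in> UNIV. fam z \<in> B})"
      by (rule finite_imageI)
    moreover have "A \<subseteq> fam ` {z \<in> UNIV. fam z \<in> B}"
      using B(2) by blast
    ultimately show ?thesis
      using finite_subset by blast
  next
    assume "range fam \<subseteq> B"
    then have "A = topspace (subtopology Zar edge)"
      unfolding top using B(2) by blast
    then show ?thesis ..
  qed
qed

lemma edge_one_dim_orbit: "edge \<in> one_dim_orbits Zar (torus I) act"
  unfolding one_dim_orbits_def topspace_Zar
proof (intro CollectI conjI bexI)
  show "edge = orbit (fam 1)"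
    using orbit_family[OF D, of 1] by simp
qed (rule family_in_X[OF D], rule krull_dim_edge)

lemma edge_label: "t \<in> torus I \<Longrightarrow> char_diff I (path_char y) (path_char x) t = edge_weight x y t"
  by (simp add: char_diff_def path_char edge_weight_def[OF D])

lemma describes_edge: "describes_action I act edge (char_diff I (path_char y) (path_char x))"
proof -
  let ?\<alpha> = "char_diff I (path_char y) (path_char x)"
  have xyG: "x \<in> verts G" "y \<in> verts G"
    using mutation_exchange[OF D] by (auto simp: exchange_def)
  have "?\<alpha> \<in> torus_characters I"
    unfolding torus_characters_def
  proof (intro CollectI conjI ballI)
    show "?\<alpha> \<in> torus I \<rightarrow>\<^sub>E UNIV - {0}"
      using edge_label edge_weight_nonzero[OF D] by (auto simp: char_diff_def)
    show "\<exists>f\<in>torus_regular I. \<forall>t\<in>torus I. ?\<alpha> t = f t"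
    proof (intro bexI ballI)
      show "(\<lambda>t. scal t y * inverse (scal t x)) \<in> torus_regular I"
        by (intro torus_regular.mult scal_regular inverse_scal_regular xyG)
      show "?\<alpha> t = scal t y * inverse (scal t x)" if "t \<in> torus I" for t
        using that by (simp add: char_diff_def path_char divide_inverse)
    qed
    fix s t assume st: "s \<in> torus I" "t \<in> torus I"
    then have "torus_mult I s t \<in> torus I"
      using torus_nonzero[OF st(1)] torus_nonzero[OF st(2)] by (auto simp: torus_def torus_mult_def)
    with st show "?\<alpha> (torus_mult I s t) = ?\<alpha> s * ?\<alpha> t"
      by (simp add: char_diff_def path_char scal_mult xyG)
  qed
  \<comment> \<open>The coordinate on the orbit is the parameter itself, that is, the inverse of
    \<open>fam\<close>; equivariance is then \<open>act_family\<close>.\<close>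
  moreover have "\<exists>\<phi>. bij_betw \<phi> edge (UNIV - {0}) \<and> (\<forall>t\<in>torus I. \<forall>W\<in>edge. \<phi> (act t W) = ?\<alpha> t * \<phi> W)"
  proof (intro exI conjI ballI)
    have inj: "inj_on fam (UNIV - {0})"
      using family_inj[OF D] by (rule inj_onI)
    then have "bij_betw fam (UNIV - {0}) edge"
      by (simp add: bij_betw_def)
    then show "bij_betw (the_inv_into (UNIV - {0}) fam) edge (UNIV - {0})"
      by (rule bij_betw_the_inv_into)
    fix t W assume t: "t \<in> torus I" and "W \<in> edge"
    then obtain c where c: "c \<noteq> 0" "W = fam c" by blast
    have "the_inv_into (UNIV - {0}) fam (fam (edge_weight x y t * c)) = edge_weight x y t * c"
      using c(1) edge_weight_nonzero[OF D t] by (intro the_inv_into_f_f[OF inj]) simp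
    moreover have "the_inv_into (UNIV - {0}) fam W = c"
      unfolding c(2) using c(1) by (intro the_inv_into_f_f[OF inj]) simp
    ultimately show "the_inv_into (UNIV - {0}) fam (act t W) = ?\<alpha> t * the_inv_into (UNIV - {0}) fam W"
      using c(2) act_family[OF D t] edge_label[OF t] by simp
  qed
  ultimately show ?thesis
    by (simp add: describes_action_def)
qed

lemma edge_limit: "W \<in> edge \<Longrightarrow> limitin Cls (\<lambda>z. act (\<eta> z) W) (pt S) (at 0)"
  using limit_coeff[OF D] by blast

end

section \<open>One-dimensional orbits and the moment graph\<close>

text \<open>The non-zero entries off the pivots are all parallel by
  \<open>one_dim_orbit_entries\<close>. The first and the last of them bound two segments, stability
  under the arrows fills the gaps with one constant value, and exchanging the segments gives the
  second fixed point.\<close>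

lemma one_dim_orbit_mutation:
  assumes U: "U \<in> X" and dim: "krull_dim (subtopology Zar (orbit U)) = 1"
  obtains S x y h S' c where "mutation_data S x y h S'" "c \<noteq> 0" "U = fam S x y h c"
proof -
  obtain S C where SC: "dimensional S" "successor_closed G S" "S \<subseteq> verts G" "reduced S C" "U = span_family S C"
    and low: "\<And>i k m. (i, k) \<in> S \<Longrightarrow> m \<in> range_of i \<Longrightarrow> m < k \<Longrightarrow> C (i, k) m = 0"
    by (rule X_reduced[OF U]) (rule that)
  \<comment> \<open>The support of the echelon form off its diagonal. It will turn out to be exactly
    the pairing of two segments.\<close>
  define N where "N u v \<longleftrightarrow> u \<in> S \<and> v \<in> verts G \<and> fst v = fst u \<and> v \<noteq> u \<and> C u (snd v) \<noteq> 0" for u v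
  have N_rel: "same_string u' u" "same_string v' v" "position v + position u' = position u + position v'"
    if "N u v" "N u' v'" for u v u' v'
  proof -
    have uv: "(fst u, snd u) \<in> S" "snd v \<in> range_of (fst u)" "snd v \<noteq> snd u" "C (fst u, snd u) (snd v) \<noteq> 0"
      "v = (fst u, snd v)"
      using that(1) vertex_basis(2)[of v] by (simp_all add: N_def prod_eq_iff)
    have uv': "(fst u', snd u') \<in> S" "snd v' \<in> range_of (fst u')" "snd v' \<noteq> snd u'" "C (fst u', snd u') (snd v') \<noteq> 0"
      "v' = (fst u', snd v')"
      using that(2) vertex_basis(2)[of v'] by (simp_all add: N_def prod_eq_iff)
    note * = one_dim_orbit_entries[OF SC(2,4) U[unfolded SC(5)] low dim[unfolded SC(5)] uv(1-4) uv'(1-4)]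
    show "same_string u' u" "same_string v' v" "position v + position u' = position u + position v'"
      using * uv(5) uv'(5) by simp_all
  qed
  have N_props: "u \<in> S" "u \<in> verts G" "v \<in> verts G" "fst v = fst u" "v \<notin> S" "snd u < snd v" "\<not> same_string u v"
    if "N u v" for u v
  proof -
    show u: "u \<in> S" "u \<in> verts G" and v: "v \<in> verts G" "fst v = fst u"
      using that SC(3) by (auto simp: N_def)
    have ne: "snd v \<noteq> snd u" "C (fst u, snd u) (snd v) \<noteq> 0" and e: "v = (fst u, snd v)"
      using that by (auto simp: N_def prod_eq_iff)
    show nS: "v \<notin> S"
    proof
      assume "v \<in> S"
      then have "(fst u, snd v) \<in> S"
        using e by simp
      then have "C (fst u, snd u) (snd v) = 0"
        using reducedD[OF SC(4), of "fst u" "snd u" "snd v"] u(1) ne(1) by simp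
      with ne(2) show False ..
    qed
    have "snd v \<in> range_of (fst u)"
      using v by (cases v) (simp add: in_verts_G)
    then show less: "snd u < snd v"
      using low[of "fst u" "snd u" "snd v"] u(1) ne by (metis linorder_neqE_nat prod.collapse)
    have "\<not> same_string (fst u, snd u) (fst u, snd v)"
      using different_strings[OF SC(2), of "fst u" "snd u" "snd v"] u(1) v(1) nS less e by simp
    then show "\<not> same_string u v"
      using e by simp
  qed
  have N_unique: "v = v'" if "N u v" "N u v'" for u v v'
    using N_rel[OF that] N_props(3)[OF that(1)] N_props(3)[OF that(2)]
    by (intro string_position_unique) simp_all
  obtain x0 y0 where N0: "N x0 y0"
  proof -
    obtain i k l where "(i, k) \<in> S" "l \<in> range_of i" "l \<noteq> k" "C (i, k) l \<noteq> 0"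
      by (rule one_dim_orbit_nontrivial[OF SC(3,4) U[unfolded SC(5)] dim[unfolded SC(5)]]) (rule that)
    then have "N (i, k) (i, l)"
      using SC(3) by (auto simp: N_def in_verts_G)
    with that show thesis by blast
  qed
  \<comment> \<open>The segments start at the first row with such an entry; that no row in between
    lacks one is shown only later, in \<open>paired_N\<close>.\<close>
  obtain x where x: "\<exists>v. N x v" "\<And>u. \<exists>v. N u v \<Longrightarrow> position x \<le> position u"
    using ex_has_least_nat[of "\<lambda>u. \<exists>v. N u v" x0 position] N0 by blast
  then obtain y where Nxy: "N x y" by blast
  obtain top where top: "\<And>z. z \<in> verts G \<Longrightarrow> same_string x z \<Longrightarrow> position z \<le> position top"
    using obtain_last_vertex[OF N_props(2)[OF Nxy]] by metis
  \<comment> \<open>All rows with an entry lie on the string of \<open>x\<close>, so their positions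
    are bounded and a last one exists.\<close>
  have "\<forall>u. (\<exists>v. N u v) \<longrightarrow> position u < Suc (position top)"
    using top N_props(2) N_rel(1)[OF Nxy] by (metis le_imp_less_Suc)
  then obtain p where p: "\<exists>v. N p v" "\<And>u. \<exists>v. N u v \<Longrightarrow> position u \<le> position p"
    using ex_has_greatest_nat[of "\<lambda>u. \<exists>v. N u v" x position "Suc (position top)"] x(1) by blast
  then obtain q where Npq: "N p q" by blast
  define h where "h = position p - position x"
  have pos_p: "position p = position x + h"
    using x(2)[OF p(1)] by (simp add: h_def)
  have pos_q: "position q = position y + h"
    using N_rel(3)[OF Nxy Npq] pos_p by linarith
  have E: "exchange x y h"
    unfolding exchange_def
  proof (intro conjI bexI)
    show "x \<in> verts G" "y \<in> verts G" "fst x = fst y" "snd x < snd y" "\<not> same_string x y"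
      using N_props[OF Nxy] by simp_all
    show "same_string y q" "q \<in> verts G" "position q = position y + h"
      using N_rel(2)[OF Nxy Npq] N_props(3)[OF Npq] pos_q by simp_all
  qed
  have N_paired: "paired x y h u v" if uv: "N u v" for u v
  proof -
    have "position x \<le> position u" "position u \<le> position p"
      using x(2) p(2) uv by blast+
    moreover note N_rel[OF Nxy uv] N_props(2,3)[OF uv]
    ultimately show ?thesis
      using pos_p by (simp add: paired_def string_segment_def)
  qed
  have row: "C u l = delta u l + C u (snd v) * delta v l" if "N u v" "l \<in> range_of (fst u)" for u v l
  proof (cases "l = snd u \<or> l = snd v")
    case True
    have "C u (snd u) = 1"
      using reducedD[OF SC(4), of "fst u" "snd u" "snd u"] N_props(1)[OF that(1)] by simp
    with True N_props(6)[OF that(1)] show ?thesis by auto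
  next
    case False
    have "C u l = 0"
    proof (rule ccontr)
      assume "C u l \<noteq> 0"
      then have "N u (fst u, l)"
        using False that N_props(1,2)[OF that(1)] by (cases u) (auto simp: N_def in_verts_G)
      then have "v = (fst u, l)"
        by (rule N_unique[OF that(1)])
      with False show False by simp
    qed
    with False show ?thesis by simp
  qed
  have row_trivial: "C u l = delta u l" if "u \<in> S" "\<And>v. \<not> N u v" "l \<in> range_of (fst u)" for u l
  proof (cases "l = snd u")
    case True
    then show ?thesis
      using reducedD[OF SC(4), of "fst u" "snd u" "snd u"] that(1) by simp
  next
    case False
    have "u \<in> verts G"
      using that(1) SC(3) by blast
    then have "\<not> C u l \<noteq> 0"
      using that(2)[of "(fst u, l)"] that(1,3) False by (cases u) (auto simp: N_def in_verts_G)
    with False show ?thesis by simp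
  qed
  \<comment> \<open>With all other pivot coordinates zero, the expansion in
    \<open>mem_span_family\<close> keeps a single summand, so \<open>z\<close> is a multiple of the
    row of \<open>w\<close>.\<close>
  have entry: "coord (fst w) z m = C w m * coord (fst w) z (snd w)"
    if z: "z \<in> U (fst w)" and w: "w \<in> S" "m \<in> range_of (fst w)"
      and "\<And>n. (fst w, n) \<in> S \<Longrightarrow> n \<noteq> snd w \<Longrightarrow> coord (fst w) z n = 0" for z w m
  proof -
    have "fst w \<in> verts Q"
      using w(1) SC(3) vertex_basis(1) by blast
    then have "coord (fst w) z m = (\<Sum>n | (fst w, n) \<in> S. coord (fst w) z n * C (fst w, n) m)"
      using mem_span_family[OF SC(3,4), THEN iffD1, OF _ z[unfolded SC(5)]] w(2) by blast
    also have "\<dots> = (\<Sum>n | (fst w, n) \<in> S. (coord (fst w) z n * C (fst w, n) m) * (if snd w = n then 1 else 0))"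
      using that(4) by (intro sum.cong) auto
    also have "\<dots> = C w m * coord (fst w) z (snd w)"
      using sum_fibre_delta[OF SC(3), of "fst w" "snd w" "\<lambda>n. coord (fst w) z n * C (fst w, n) m"] w(1)
      by (simp add: mult.commute)
    finally show ?thesis .
  qed
  have gen: "lincomb (fst u) (C u) \<in> U (fst u)" if "u \<in> S" for u
    using lincomb_in_span_family[OF vertex_basis(1)[OF subsetD[OF SC(3) that]], of "snd u" S C] that
    by (simp add: SC(5))
  have U_closed: "rep_map M a z \<in> U (head Q a)" if "a \<in> arcs Q" "z \<in> U (tail Q a)" for a z
    using U that by (auto simp: quiver_grassmannian_def)
  \<comment> \<open>The arrow maps the row of \<open>u\<close> to the basis vector of
    \<open>w\<close> plus \<open>C u (snd v)\<close> times that of \<open>v'\<close>. Since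
    \<open>v'\<close> is no pivot, the only non-zero pivot coordinate is at \<open>w\<close>, and
    \<open>entry\<close> reads off the same value in the row of \<open>w\<close>.\<close>
  have advance: "\<exists>w. (u, a, w) \<in> arcs G \<and> N w v' \<and> C w (snd v') = C u (snd v)"
    if uv: "N u v" and arc: "(v, a, v') \<in> arcs G" and v': "v' \<notin> S" for u v a v'
  proof -
    note uv' = N_props[OF uv]
    have a: "a \<in> arcs Q" "fst v = tail Q a" "fst v' = head Q a" "snd v' \<in> range_of (head Q a)"
        "rep_map M a (b (tail Q a) (snd v)) = b (head Q a) (snd v')"
      using arc by (auto simp: in_arcs_G)
    have e: "(fst u, snd v) = v"
      using uv'(4) by (simp add: prod_eq_iff)
    obtain k where k: "(u, a, (fst v', k)) \<in> arcs G" "k < snd v'"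
      using copy_arc[of "fst u" "snd v" a v' "snd u"] arc uv'(2,6) e by (metis prod.collapse)
    let ?w = "(fst v', k)"
    let ?c = "C u (snd v)"
    have wS: "?w \<in> S"
      using SC(2) uv'(1) k(1) by (force simp: successor_closed_def ends_G)
    have w: "k \<in> range_of (head Q a)" "rep_map M a (b (tail Q a) (snd u)) = b (head Q a) k"
      using k(1) by (auto simp: in_arcs_G)
    have i: "fst u = tail Q a" "tail Q a \<in> verts Q" "head Q a \<in> verts Q"
      using uv'(4) a(2) ends_Q[OF a(1)] by simp_all
    have sp: "b (tail Q a) (snd u) \<in> rep_space M (tail Q a)" "b (tail Q a) (snd v) \<in> rep_space M (tail Q a)"
      using vertex_basis(3)[OF uv'(2)] vertex_basis(3)[OF uv'(3)] i(1) a(2) by simp_all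
    have "lincomb (fst u) (C u) = lincomb (fst u) (\<lambda>l. delta u l + ?c * delta v l)"
      by (rule lincomb_cong) (rule row[OF uv])
    also have "\<dots> = lincomb (fst u) (delta u) + rep_scale M ?c (lincomb (fst v) (delta v))"
      by (simp only: lincomb_add scale_lincomb uv'(4))
    also have "\<dots> = b (tail Q a) (snd u) + rep_scale M ?c (b (tail Q a) (snd v))"
      using lincomb_delta[OF vertex_basis(2)[OF uv'(2)]] lincomb_delta[OF vertex_basis(2)[OF uv'(3)]] i(1) a(2)
      by simp
    finally have "rep_map M a (b (tail Q a) (snd u) + rep_scale M ?c (b (tail Q a) (snd v))) \<in> U (head Q a)"
      using U_closed[OF a(1)] gen[OF uv'(1)] i(1) by simp
    then have z: "b (head Q a) k + rep_scale M ?c (b (head Q a) (snd v')) \<in> U (head Q a)"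
      using rep_map_add[OF a(1) sp(1) subspace_scale[OF subspace_space[OF i(2)] sp(2)]]
        rep_map_scale[OF a(1) sp(2)] w(2) a(5) by simp
    have sp': "b (head Q a) k \<in> rep_space M (head Q a)" "b (head Q a) (snd v') \<in> rep_space M (head Q a)"
      using basis_in_space[OF i(3)] w(1) a(4) by simp_all
    have co: "coord (head Q a) (b (head Q a) k + rep_scale M ?c (b (head Q a) (snd v'))) n =
        (if k = n then 1 else 0) + ?c * (if snd v' = n then 1 else 0)" if "n \<in> range_of (head Q a)" for n
      using coord_basis[OF i(3) w(1) that] coord_basis[OF i(3) a(4) that]
      by (simp add: coord_add[OF i(3) sp'(1) subspace_scale[OF subspace_space[OF i(3)] sp'(2)]]
          coord_scale[OF i(3) sp'(2)])
    have "?c = C ?w (snd v') * 1"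
    proof -
      have "coord (head Q a) (b (head Q a) k + rep_scale M ?c (b (head Q a) (snd v'))) n = 0"
        if n: "(head Q a, n) \<in> S" "n \<noteq> k" for n
      proof -
        have "n \<in> range_of (head Q a)"
          using n(1) SC(3) by (auto simp: in_verts_G)
        moreover have "snd v' \<noteq> n"
          using n(1) v' a(3) by (metis prod.collapse)
        ultimately show ?thesis
          using co[of n] n(2) by simp
      qed
      then have "coord (head Q a) (b (head Q a) k + rep_scale M ?c (b (head Q a) (snd v'))) (snd v') =
          C ?w (snd v') * coord (head Q a) (b (head Q a) k + rep_scale M ?c (b (head Q a) (snd v'))) k"
        using entry[of _ ?w "snd v'"] z wS a(3,4) by simp
      then show ?thesis
        using co[OF a(4)] co[OF w(1)] k(2) by simp
    qed
    moreover have "?c \<noteq> 0" "v' \<in> verts G"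
      using uv head_in_verts[OF arc] by (auto simp: N_def ends_G)
    ultimately have "N ?w v'" "C ?w (snd v') = ?c"
      using wS k(2) by (auto simp: N_def prod_eq_iff)
    with k(1) show ?thesis by blast
  qed
  have qS: "q \<notin> S"
    by (rule N_props(5)[OF Npq])
  \<comment> \<open>\<open>q\<close> is the last vertex of the upper segment and no pivot; an
    earlier pivot on its string would force \<open>q\<close> into the successor closed
    \<open>S\<close>.\<close>
  have above: "v \<notin> S" if "paired x y h u v" for u v
  proof
    assume "v \<in> S"
    then have "q \<in> S"
      by (rule successor_closed_string[OF SC(2)])
        (use pairedD[OF that] N_rel(2)[OF Nxy Npq] N_props(3)[OF Npq] pos_q in simp_all)
    with qS show False ..
  qed
  define c where "c = C x (snd y)"
  have paired_N: "N u v \<and> C u (snd v) = c" if "paired x y h u v" for u v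
    using E that
  proof (induction rule: paired_induct)
    case start
    then show ?case
      using Nxy by (simp add: c_def)
  next
    case (step u v a u' v')
    have "N u v"
      using step.IH by simp
    from advance[OF this step.hyps(4) above[OF step.hyps(2)]] obtain w
      where w: "(u, a, w) \<in> arcs G" "N w v'" "C w (snd v') = C u (snd v)" by blast
    have "(u, a, w) = (u, a, u')"
      by (rule arc_tail_unique[OF w(1) step.hyps(3)]) (simp add: ends_G)
    with w step.IH show ?case by simp
  qed
  have c: "c \<noteq> 0"
    using Nxy by (simp add: c_def N_def)
  let ?L = "string_segment x h" and ?L' = "string_segment y h"
  have LS: "?L \<subseteq> S"
  proof
    fix u assume "u \<in> ?L"
    then obtain l where "paired x y h u (fst u, l)"
      by (rule exchange_left[OF E])
    then show "u \<in> S"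
      using paired_N N_props(1) by blast
  qed
  have L'S: "?L' \<inter> S = {}"
  proof (intro equalityI subsetI)
    fix v assume v: "v \<in> ?L' \<inter> S"
    then obtain k where "paired x y h (fst v, k) v"
      using exchange_right[OF E] by blast
    then show "v \<in> {}"
      using above v by blast
  qed simp
  \<comment> \<open>When the parameter \<open>c\<close> tends to infinity, the second vector takes
    over in each exchanged row; this suggests the other end of the edge.\<close>
  define S' where "S' = (S - ?L) \<union> ?L'"
  have diff: "S - S' = ?L" "S' - S = ?L'"
    using LS L'S by (auto simp: S'_def)
  have S'G: "S' \<subseteq> verts G"
    using SC(3) by (auto simp: S'_def string_segment_def)
  have "dimensional S'"
    unfolding dimensional_def
  proof (intro conjI ballI S'G)
    fix i assume i: "i \<in> verts Q"
    let ?f = "\<lambda>k. SOME l. paired x y h (i, k) (i, l)"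
    have f: "paired x y h (i, k) (i, ?f k)" if kL: "(i, k) \<in> ?L" for k
    proof -
      obtain l where "paired x y h (i, k) (fst (i, k), l)"
        by (rule exchange_left[OF E kL]) (rule that)
      then show ?thesis
        by (intro someI[of "\<lambda>l. paired x y h (i, k) (i, l)" l]) simp
    qed
    have "bij_betw ?f {k. (i, k) \<in> ?L} {k. (i, k) \<in> ?L'}"
      unfolding bij_betw_def
    proof (intro conjI inj_onI equalityI subsetI)
      fix k k' assume "k \<in> {k. (i, k) \<in> ?L}" "k' \<in> {k. (i, k) \<in> ?L}" "?f k = ?f k'"
      then have "(i, k) = (i, k')"
        using paired_left_unique[OF f[of k], of "(i, k')"] f[of k'] by simp
      then show "k = k'" by simp
    next
      fix l assume "l \<in> ?f ` {k. (i, k) \<in> ?L}"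
      then show "l \<in> {k. (i, k) \<in> ?L'}"
        using f by (auto simp: paired_def)
    next
      fix l assume "l \<in> {k. (i, k) \<in> ?L'}"
      then have "(i, l) \<in> ?L'" by simp
      then obtain k where k: "paired x y h (fst (i, l), k) (i, l)"
        by (rule exchange_right[OF E])
      then have kL: "(i, k) \<in> ?L"
        by (simp add: paired_def)
      then have "(i, l) = (i, ?f k)"
        using paired_right_unique[OF _ f[OF kL], of "(i, l)"] k by simp
      with kL show "l \<in> ?f ` {k. (i, k) \<in> ?L}" by auto
    qed
    then have card: "card {k. (i, k) \<in> ?L} = card {k. (i, k) \<in> ?L'}"
      by (rule bij_betw_same_card)
    have fin: "finite {k. (i, k) \<in> S}" "finite {k. (i, k) \<in> ?L'}"
      using finite_fibre[OF SC(3)] finite_fibre[of ?L' i] by (auto simp: string_segment_def)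
    have "{k. (i, k) \<in> S'} = ({k. (i, k) \<in> S} - {k. (i, k) \<in> ?L}) \<union> {k. (i, k) \<in> ?L'}"
      by (auto simp: S'_def)
    moreover have "({k. (i, k) \<in> S} - {k. (i, k) \<in> ?L}) \<inter> {k. (i, k) \<in> ?L'} = {}"
      using L'S by blast
    ultimately have "card {k. (i, k) \<in> S'} = card ({k. (i, k) \<in> S} - {k. (i, k) \<in> ?L}) + card {k. (i, k) \<in> ?L'}"
      using fin by (simp add: card_Un_disjoint)
    also have sub: "{k. (i, k) \<in> ?L} \<subseteq> {k. (i, k) \<in> S}"
      using LS by blast
    then have "card ({k. (i, k) \<in> S} - {k. (i, k) \<in> ?L}) + card {k. (i, k) \<in> ?L'} = card {k. (i, k) \<in> S}"
      using card card_mono[OF fin(1) sub] by (simp add: card_Diff_subset[OF finite_subset[OF sub fin(1)] sub])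
    finally show "int (card {k. (i, k) \<in> S'}) = e i"
      using SC(1) i by (simp add: dimensional_def)
  qed
  moreover have "successor_closed G S'"
    unfolding successor_closed_def
  proof (intro conjI ballI impI S'G)
    fix z assume z: "z \<in> arcs G" "tail G z \<in> S'"
    obtain u a w where uaw: "z = (u, a, w)" by (rule prod_cases3)
    then have arc: "(u, a, w) \<in> arcs G" and u: "u \<in> S'"
      using z by (simp_all add: ends_G)
    have a: "a \<in> arcs Q" "fst u = tail Q a" "fst w = head Q a" "snd w \<in> range_of (head Q a)"
        "rep_map M a (b (tail Q a) (snd u)) = b (head Q a) (snd w)"
      using arc by (auto simp: in_arcs_G)
    have "w \<in> S'"
    proof (cases "u \<in> S")
      case True
      then have uL: "u \<notin> ?L"
        using u diff by blast
      then have "\<not> N u v" for v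
        using N_paired uL unfolding paired_def by blast
      then have "lincomb (fst u) (C u) = lincomb (fst u) (delta u)"
        using row_trivial[OF True] by (intro lincomb_cong) blast
      also have "\<dots> = b (fst u) (snd u)"
        using True SC(3) vertex_basis(2) by (intro lincomb_delta) blast
      finally have bw: "b (head Q a) (snd w) \<in> U (head Q a)"
        using gen[OF True] U_closed[OF a(1), of "b (tail Q a) (snd u)"] a(2,5) by simp
      have wS: "w \<in> S"
        using SC(2) True arc by (force simp: successor_closed_def ends_G)
      \<comment> \<open>The image of the row of \<open>u\<close> is the bare basis vector of
        \<open>w\<close>. For \<open>w\<close> in \<open>?L\<close> the row of \<open>w\<close> has
        the same pivot coordinates but a further non-zero entry, so this basis vector could not lie
        in \<open>U\<close>.\<close>
      moreover have "w \<notin> ?L"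
      proof
        assume "w \<in> ?L"
        then obtain l where "paired x y h w (fst w, l)"
          by (rule exchange_left[OF E])
        then have Nl: "N w (fst w, l)"
          using paired_N by blast
        have l: "l \<in> range_of (head Q a)" "l \<noteq> snd w" "C w l \<noteq> 0"
          using Nl N_props(6)[OF Nl] a(3) by (simp_all add: N_def in_verts_G)
        have co: "coord (head Q a) (b (head Q a) (snd w)) n = (if snd w = n then 1 else 0)"
          if "n \<in> range_of (head Q a)" for n
          by (rule coord_basis[OF ends_Q(2)[OF a(1)] a(4) that])
        have "coord (fst w) (b (head Q a) (snd w)) n = 0" if "(fst w, n) \<in> S" "n \<noteq> snd w" for n
          using co[of n] that SC(3) a(3) by (auto simp: in_verts_G)
        then have "coord (head Q a) (b (head Q a) (snd w)) l = C w l * coord (head Q a) (b (head Q a) (snd w)) (snd w)"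
          using entry[of "b (head Q a) (snd w)" w l] bw wS l(1) a(3) by simp
        then show False
          using co[OF l(1)] co[OF a(4)] l(2,3) by simp
      qed
      ultimately show ?thesis
        by (simp add: S'_def)
    next
      case False
      then have "u \<in> ?L'"
        using u diff by blast
      then obtain k where k: "paired x y h (fst u, k) u"
        by (rule exchange_right[OF E])
      show ?thesis
      proof (cases "w \<in> S")
        case True
        have "same_string w y"
          using component_of_arc[OF arc] pairedD(6)[OF k] by (simp add: ends_G)
        then have "w \<notin> ?L"
          using E by (auto simp: string_segment_def exchange_def)
        with True show ?thesis
          by (simp add: S'_def)
      next
        case False
        have "N (fst u, k) u"
          using paired_N[OF k] by simp
        from advance[OF this arc False] obtain w' where "N w' w" by blast
        then have "w \<in> ?L'"
          using N_paired by (auto simp: paired_def)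
        then show ?thesis
          by (simp add: S'_def)
      qed
    qed
    then show "head G z \<in> S'"
      by (simp add: uaw ends_G)
  qed
  ultimately have "mutation_data S x y h S'"
    using SC(1,2) E diff by (simp add: mutation_data_def dimensional_subquivers_iff)
  moreover have "U = fam S x y h c"
    unfolding SC(5)
  proof (rule span_family_cong)
    fix i k l assume k: "(i, k) \<in> S" and l: "l \<in> range_of i"
    show "C (i, k) l = exchange_coeff x y h c (i, k) l"
    proof (cases "\<exists>v. N (i, k) v")
      case True
      then obtain v where v: "N (i, k) v" ..
      have e: "v = (i, snd v)"
        using N_props(4)[OF v] by (simp add: prod_eq_iff)
      have "paired x y h (i, k) (i, l) \<longleftrightarrow> l = snd v"
        using paired_right_unique[OF N_paired[OF v], of "(i, l)"] N_paired[OF v] e by (metis prod.inject)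
      moreover have "C (i, k) (snd v) = c"
        using paired_N[OF N_paired[OF v]] by simp
      ultimately show ?thesis
        using row[OF v, of l] l by (simp add: exchange_coeff_def)
    next
      case False
      then have no: "\<And>v. \<not> N (i, k) v" by blast
      then have "\<not> paired x y h (i, k) (i, l)"
        using paired_N by blast
      then show ?thesis
        using row_trivial[OF k no, of l] l by (simp add: exchange_coeff_def)
    qed
  qed
  ultimately show thesis
    using c by (intro that)
qed

lemma edge_not_fixed:
  assumes D: "mutation_data S x y h S'" and W: "W \<in> edge S x y h"
  shows "W \<notin> fixed_points (torus I) act X"
proof
  obtain c where c: "c \<noteq> 0" "W = fam S x y h c"
    using W by blast
  have torus: "\<eta> 2 \<in> torus I"
    by (rule \<eta>_torus) simp
  assume "W \<in> fixed_points (torus I) act X"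
  then have "act (\<eta> 2) W = W"
    using torus by (simp add: fixed_points_def)
  then have "fam S x y h (edge_weight x y (\<eta> 2) * c) = fam S x y h c"
    using act_family[OF D torus] c(2) by simp
  then have "edge_weight x y (\<eta> 2) * c = c"
    by (rule family_inj[OF D])
  then have "(2 :: complex) ^ nat (wt y - wt x) = 2 ^ 0"
    using c(1) edge_weight_\<eta>(1)[OF D, of 2] by simp
  then have "nat (wt y - wt x) = 0"
    by (rule power_two_eq)
  then show False
    using edge_weight_\<eta>(2)[OF D, of 1] by simp
qed

lemma string_segment_start:
  assumes "string_segment x h = string_segment x' h'" "x \<in> verts G" "x' \<in> verts G"
  shows "x = x'"
proof -
  have "x \<in> string_segment x h" "x' \<in> string_segment x' h'"
    using assms(2,3) by (simp_all add: string_segment_def)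
  then have "x \<in> string_segment x' h'" "x' \<in> string_segment x h"
    using assms(1) by simp_all
  then show ?thesis
    using assms(2,3) by (intro string_position_unique) (simp_all add: string_segment_def)
qed

text \<open>The curve depends on the length only through the two segments, and these are
  \<open>S - S'\<close> and \<open>S' - S\<close>. So any choice of length gives the same
  edge.\<close>

lemma mutation_data_length:
  assumes "mutation_data S x y h S'" "mutation_data S x y h' S'"
  shows "edge S x y h = edge S x y h'"
proof -
  have "string_segment x h = string_segment x h'" "string_segment y h = string_segment y h'"
    using assms by (simp_all add: mutation_data_def)
  then have "exchange_coeff x y h = exchange_coeff x y h'"
    by (simp add: exchange_coeff_def[abs_def] paired_def)
  then show ?thesis by simp
qed

section \<open>Edges and fundamental mutations in bijection\<close>

definition mutation_edge ::
    "('v \<times> nat) set \<times> ('v \<times> nat \<times> nat) \<times> ('v \<times> nat) set \<Rightarrow> ('v \<Rightarrow> 'b set) set" where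
  "mutation_edge = (\<lambda>(S, (i, k, l), S'). edge S (i, k) (i, l) (SOME h. mutation_data S (i, k) (i, l) h S'))"

lemma mutation_edge_eq:
  assumes "mutation_data S (i, k) (i, l) h S'"
  shows "mutation_edge (S, (i, k, l), S') = edge S (i, k) (i, l) h"
  unfolding mutation_edge_def using mutation_data_length[OF someI[of _ h] assms] assms by simp

abbreviation "fundamental \<equiv> fundamental_mutations Q G e"

lemma one_dim_orbits_eq: "one_dim_orbits Zar (torus I) act = mutation_edge ` fundamental"
proof
  show "mutation_edge ` fundamental \<subseteq> one_dim_orbits Zar (torus I) act"
  proof (rule image_subsetI)
    fix m assume m: "m \<in> fundamental"
    obtain S i k l S' where m_eq: "m = (S, (i, k, l), S')" by (metis surj_pair)
    obtain h where D: "mutation_data S (i, k) (i, l) h S'"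
      by (rule fundamental_mutation_data[OF m[unfolded m_eq]])
    show "mutation_edge m \<in> one_dim_orbits Zar (torus I) act"
      unfolding m_eq mutation_edge_eq[OF D] by (rule edge_one_dim_orbit[OF D])
  qed
  show "one_dim_orbits Zar (torus I) act \<subseteq> mutation_edge ` fundamental"
  proof
    fix E assume "E \<in> one_dim_orbits Zar (torus I) act"
    then obtain U where U: "U \<in> X" "E = orbit U" "krull_dim (subtopology Zar (orbit U)) = 1"
      by (auto simp: one_dim_orbits_def topspace_Zar)
    obtain S x y h S' c where D: "mutation_data S x y h S'" "c \<noteq> 0" "U = fam S x y h c"
      by (rule one_dim_orbit_mutation[OF U(1,3)])
    obtain i k l where xy: "x = (i, k)" "y = (i, l)"
      using mutation_exchange[OF D(1)] unfolding exchange_def by (metis prod.collapse)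
    note D' = D(1)[unfolded xy]
    have "E = mutation_edge (S, (i, k, l), S')"
      unfolding U(2) D(3) orbit_family[OF D(1,2)] mutation_edge_eq[OF D'] by (simp only: xy)
    then show "E \<in> mutation_edge ` fundamental"
      using mutation_data_fundamental[OF D'] by blast
  qed
qed

text \<open>The fixed points in the closure recover the two subquivers up to order, and their
  differences recover the starting vertices. The reversed order is impossible because the first
  index is the smaller one in both mutations.\<close>

lemma inj_closure_mutation_edge: "inj_on (\<lambda>m. Zar closure_of mutation_edge m) fundamental"
proof (rule inj_onI)
  fix m m' assume m: "m \<in> fundamental" "m' \<in> fundamental"
    and eq: "Zar closure_of mutation_edge m = Zar closure_of mutation_edge m'"
  obtain S i k l S' where m_eq: "m = (S, (i, k, l), S')" by (metis surj_pair)
  obtain T j k' l' T' where m'_eq: "m' = (T, (j, k', l'), T')" by (metis surj_pair)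
  obtain h where D: "mutation_data S (i, k) (i, l) h S'"
    by (rule fundamental_mutation_data[OF m(1)[unfolded m_eq]])
  obtain h' where D': "mutation_data T (j, k') (j, l') h' T'"
    by (rule fundamental_mutation_data[OF m(2)[unfolded m'_eq]])
  have fixed: "(Zar closure_of mutation_edge (S, (i, k, l), S')) \<inter> fixed_points (torus I) act X = {pt S, pt S'}"
    if D: "mutation_data S (i, k) (i, l) h S'" for S i k l S' h
    using edge_not_fixed[OF D] mutation_dimensional[OF D] unfolding mutation_edge_eq[OF D] closure_edge[OF D] fixed_points_eq
    by blast
  have "{pt S, pt S'} = {pt T, pt T'}"
    using fixed[OF D] fixed[OF D'] eq by (simp add: m_eq m'_eq)
  then have "pt S = pt T \<and> pt S' = pt T' \<or> pt S = pt T' \<and> pt S' = pt T"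
    by (simp only: doubleton_eq_iff)
  then have cases: "S = T \<and> S' = T' \<or> S = T' \<and> S' = T"
    using pt_inj mutation_sets(1,2)[OF D] mutation_sets(1,2)[OF D'] by metis
  have seg: "S - S' = string_segment (i, k) h" "S' - S = string_segment (i, l) h"
      "T - T' = string_segment (j, k') h'" "T' - T = string_segment (j, l') h'"
    using D D' by (simp_all add: mutation_data_def)
  have G: "(i, k) \<in> verts G" "(i, l) \<in> verts G" "k < l" "(j, k') \<in> verts G" "(j, l') \<in> verts G" "k' < l'"
    using mutation_exchange[OF D] mutation_exchange[OF D'] by (simp_all add: exchange_def)
  from cases show "m = m'"
  proof
    assume ST: "S = T \<and> S' = T'"
    have "(i, k) = (j, k')" "(i, l) = (j, l')"
      using string_segment_start[of "(i, k)" h "(j, k')" h'] string_segment_start[of "(i, l)" h "(j, l')" h'] seg G ST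
      by simp_all
    with ST show ?thesis
      by (simp add: m_eq m'_eq)
  next
    assume ST: "S = T' \<and> S' = T"
    have "(i, k) = (j, l')" "(i, l) = (j, k')"
      using string_segment_start[of "(i, k)" h "(j, l')" h'] string_segment_start[of "(i, l)" h "(j, k')" h'] seg G ST
      by simp_all
    with G(3,6) show ?thesis by simp
  qed
qed

lemma moment_graph:
  obtains \<G> \<Phi> where "is_moment_graph Zar Cls I act \<eta> \<G>"
    "bij_betw pt (dimensional_subquivers Q G e) (verts \<G>)" "bij_betw \<Phi> fundamental (arcs \<G>)"
    "\<And>S i k l S'. (S, (i, k, l), S') \<in> fundamental \<Longrightarrow>
       tail \<G> (\<Phi> (S, (i, k, l), S')) = pt S \<and> head \<G> (\<Phi> (S, (i, k, l), S')) = pt S' \<and>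
       label \<G> (\<Phi> (S, (i, k, l), S')) = char_diff I (path_char (i, l)) (path_char (i, k))"
proof -
  define \<Phi> where "\<Phi> m = Zar closure_of mutation_edge m" for m
  \<comment> \<open>\<open>tail\<close>, \<open>head\<close> and \<open>label\<close> take the
    closure of the orbit as argument, so the mutation has to be recovered from it.\<close>
  define \<Psi> where "\<Psi> = the_inv_into fundamental \<Phi>"
  define \<G> :: "('v \<Rightarrow> 'b set, ('v, 'e) torus_index \<Rightarrow> complex) moment_graph" where
    "\<G> = \<lparr> verts = fixed_points (torus I) act X, arcs = \<Phi> ` fundamental,
       tail = (\<lambda>E. pt (fst (\<Psi> E))), head = (\<lambda>E. pt (snd (snd (\<Psi> E)))),
       label = (\<lambda>E. case \<Psi> E of (S, (i, k, l), S') \<Rightarrow> char_diff I (path_char (i, l)) (path_char (i, k))) \<rparr>"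
  have inj: "inj_on \<Phi> fundamental"
    unfolding \<Phi>_def[abs_def] by (rule inj_closure_mutation_edge)
  have \<Psi>: "\<Psi> (\<Phi> m) = m" if "m \<in> fundamental" for m
    unfolding \<Psi>_def by (rule the_inv_into_f_f[OF inj that])
  have data: "tail \<G> (\<Phi> (S, (i, k, l), S')) = pt S \<and> head \<G> (\<Phi> (S, (i, k, l), S')) = pt S' \<and>
      label \<G> (\<Phi> (S, (i, k, l), S')) = char_diff I (path_char (i, l)) (path_char (i, k))"
    if "(S, (i, k, l), S') \<in> fundamental" for S i k l S'
    using \<Psi>[OF that] by (simp add: \<G>_def)
  have "is_moment_graph Zar Cls I act \<eta> \<G>"
    unfolding is_moment_graph_def
  proof (intro conjI ballI)
    show "verts \<G> = fixed_points (torus I) act (topspace Zar)"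
      by (simp add: \<G>_def topspace_Zar)
    show "arcs \<G> = (\<lambda>E. Zar closure_of E) ` one_dim_orbits Zar (torus I) act"
      by (simp add: \<G>_def one_dim_orbits_eq image_image \<Phi>_def)
    fix E assume "E \<in> one_dim_orbits Zar (torus I) act"
    then obtain m where m: "m \<in> fundamental" "E = mutation_edge m"
      unfolding one_dim_orbits_eq by blast
    obtain S i k l S' where m_eq: "m = (S, (i, k, l), S')" by (metis surj_pair)
    obtain h where D: "mutation_data S (i, k) (i, l) h S'"
      by (rule fundamental_mutation_data[OF m(1)[unfolded m_eq]])
    have E: "E = edge S (i, k) (i, l) h"
      by (simp only: m(2) m_eq mutation_edge_eq[OF D])
    have cl: "Zar closure_of E = \<Phi> (S, (i, k, l), S')"
      by (simp add: m(2) m_eq \<Phi>_def)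
    show "\<exists>x\<in>verts \<G>. \<exists>y\<in>verts \<G>. tail \<G> (Zar closure_of E) = x \<and> head \<G> (Zar closure_of E) = y \<and>
        Zar closure_of E = E \<union> {x, y} \<and> (\<forall>p\<in>E. limitin Cls (\<lambda>z. act (\<eta> z) p) x (at 0)) \<and>
        describes_action I act E (label \<G> (Zar closure_of E))"
    proof (intro bexI conjI ballI)
      show "tail \<G> (Zar closure_of E) = pt S" "head \<G> (Zar closure_of E) = pt S'"
        using data[OF m(1)[unfolded m_eq]] by (simp_all add: cl)
      show "Zar closure_of E = E \<union> {pt S, pt S'}"
        unfolding E by (rule closure_edge[OF D])
      show "limitin Cls (\<lambda>z. act (\<eta> z) W) (pt S) (at 0)" if "W \<in> E" for W
        by (rule edge_limit[OF D that[unfolded E]])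
      show "describes_action I act E (label \<G> (Zar closure_of E))"
      proof -
        have "label \<G> (Zar closure_of E) = char_diff I (path_char (i, l)) (path_char (i, k))"
          unfolding cl using data[OF m(1)[unfolded m_eq]] by blast
        then show ?thesis
          using describes_edge[OF D] by (simp only: E)
      qed
      show "pt S \<in> verts \<G>" "pt S' \<in> verts \<G>"
        using mutation_dimensional[OF D] by (simp_all add: \<G>_def fixed_points_eq)
    qed
  qed
  moreover have "inj_on pt (dimensional_subquivers Q G e)"
    using pt_inj by (intro inj_onI) (auto simp: dimensional_subquivers_iff dimensional_def)
  then have "bij_betw pt (dimensional_subquivers Q G e) (verts \<G>)"
    by (simp add: bij_betw_def \<G>_def fixed_points_eq)
  moreover have "bij_betw \<Phi> fundamental (arcs \<G>)"
    using inj by (simp add: bij_betw_def \<G>_def)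
  ultimately show thesis
    using data by (rule that)
qed

end

theorem theorem5p3:
  fixes Q :: "('v, 'e) pre_digraph"
    and M :: "('v, 'e, 'b::ab_group_add) quiver_rep"
    and e :: "'v \<Rightarrow> int"
    and b :: "'v \<Rightarrow> nat \<Rightarrow> 'b"
    and \<eta> :: "complex \<Rightarrow> ('v, 'e) torus_index \<Rightarrow> complex"
  defines "G \<equiv> coeff_quiver Q M b"
    and "I \<equiv> rep_torus_index Q M b"
    and "pt \<equiv> subquiver_point Q M b"
  assumes "fin_digraph Q"
    and "is_representation Q M"
    and "straight Q M"
    and "torus_cocharacter I \<eta>"
    and "generic_cocharacter (torus I) (point_action Q M b) (quiver_grassmannian Q M e) \<eta>"
    and "attractive_compatible Q M \<eta> b"
  shows "\<exists>\<G> \<Phi>.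
     is_moment_graph (zariski_quiver_grassmannian Q M e) (classical_quiver_grassmannian Q M e)
       I (point_action Q M b) \<eta> \<G> \<and>
     bij_betw pt (dimensional_subquivers Q G e) (verts \<G>) \<and>
     bij_betw \<Phi> (fundamental_mutations Q G e) (arcs \<G>) \<and>
     (\<forall>S i k l S'. (S, (i, k, l), S') \<in> fundamental_mutations Q G e \<longrightarrow>
        tail \<G> (\<Phi> (S, (i, k, l), S')) = pt S \<and>
        head \<G> (\<Phi> (S, (i, k, l), S')) = pt S' \<and>
        label \<G> (\<Phi> (S, (i, k, l), S')) =
          char_diff I
            (char_sum I (eps_char I (component_of G (i, l)) #
               map (delta_char I \<circ> underlying_arc) (preceding_segment G (i, l))))
            (char_sum I (eps_char I (component_of G (i, k)) #
               map (delta_char I \<circ> underlying_arc) (preceding_segment G (i, k)))))"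
proof -
  obtain wt where wt: "\<forall>z. z \<noteq> 0 \<longrightarrow> (\<forall>(i, k)\<in>verts (coeff_quiver Q M b).
        vector_action Q M b (\<eta> z) i (b i k) = rep_scale M (z powi wt (i, k)) (b i k))"
      "attractive_grading Q (coeff_quiver Q M b) wt"
    and b: "straightening_basis Q M b" "normalized Q M b" "aligned Q M b"
    using assms(9) unfolding attractive_compatible_def by blast
  interpret torus_representation Q M e b \<eta> wt
  proof (intro torus_representation.intro straight_representation.intro representation.intro
      straight_representation_axioms.intro torus_representation_axioms.intro)
    show "\<eta> z \<in> torus (rep_torus_index Q M b)" if "z \<noteq> 0" for z
      using assms(7) that by (simp add: torus_cocharacter_def I_def)
    show "vector_action Q M b (\<eta> z) i (b i k) = rep_scale M (z powi wt (i, k)) (b i k)"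
      if "z \<noteq> 0" "(i, k) \<in> verts (coeff_quiver Q M b)" for z i k
      using wt(1) that by blast
    show "wt (i, k) < wt (i, l)"
      if "(i, k) \<in> verts (coeff_quiver Q M b)" "(i, l) \<in> verts (coeff_quiver Q M b)" "k < l" for i k l
      using wt(2) that unfolding attractive_grading_def by blast
  qed (rule assms b)+
  show ?thesis
    unfolding G_def I_def pt_def
    by (rule moment_graph) (unfold path_char_def, blast)
qed

end
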